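(* Suppose that $\beta_\ast$ is random with $\mathbb{E}[\beta_\ast]=0$ and $\mathbb{E}[\beta_\ast\beta_\ast^\top]=\frac{\alpha^2}{p}I_p$ for some $\alpha>0$ and is independent of $X_n,\varepsilon_n$; that there exists $\delta>0$ with $\mathbb{E}[|Z_{ij}|^{4+\delta}]<+\infty$ for all $i,j$; and that there exists $\gamma_{\max}>0$ with $\sup_{n\ge1}\max_{1\le i\le n,\,1\le j\le p}|\gamma_{ij}^{(n)}|<\gamma_{\max}$. For $\lambda>0$ let $$\hat G(\lambda)=\frac{\hat r_\lambda^{train}(X_n)}{(1-\widehat{df}_1(\lambda))^2},\qquad G(\lambda)=\frac{r_\lambda^{train}(X_n)}{(1-df_1(\lambda))^2}.$$ Then for every $\lambda>0$, $$\lim_{n\to\infty,\ p/n\to c}\bigl|\hat G(\lambda)-G(\lambda)\bigr|=0\quad\text{almost surely}.$$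
   Context: Asymptotic regime: $p=p(n)$, $n\to\infty$ and $p/n\to c$ for some $c\in(0,\infty)$. Design: $X_n=\Upsilon_n\circ Z_n\in\mathbb{R}^{n\times p}$, where $\circ$ is the entrywise product, $\Upsilon_n=(\gamma_{ij}^{(n)})$ is a deterministic real $n\times p$ matrix, and $Z_n=(Z_{ij})$ is a real random matrix with i.i.d. centered entries of variance one (common law not depending on $n$). Write $\gamma_{ij}=\gamma_{ij}^{(n)}$, $\widehat\Sigma_n=\frac1nX_n^\top X_n$ and $\Sigma_n=\mathbb{E}[\widehat\Sigma_n]=\frac1n\operatorname{diag}\bigl(\sum_{i=1}^n\gamma_{i1}^2,\dots,\sum_{i=1}^n\gamma_{ip}^2\bigr)$. Model: $Y_n=X_n\beta_\ast+\varepsilon_n\in\mathbb{R}^n$, where $\varepsilon_n$ has i.i.d. entries with mean $0$ and variance $\sigma^2>0$ and is independent of $X_n$. Ridge estimator: $\hat\theta_\lambda=(X_n^\top X_n+n\lambda I_p)^{-1}X_n^\top Y_n$. The variables $\beta_\ast,X_n,\varepsilon_n$ are mutually independent. Training risk: $\hat r_\lambda^{train}(X_n)=\frac1n\mathbb{E}[\|Y_n-X_n\hat\theta_\lambda\|^2\mid X_n]$. Degrees of freedom: $\widehat{df}_1(\lambda)=\frac1p\operatorname{Tr}[\widehat\Sigma_n(\widehat\Sigma_n+\lambda I_p)^{-1}]$. Let $D_i=\operatorname{diag}(\gamma_{i1}^2,\dots,\gamma_{ip}^2)$ and $\widetilde D_j=\operatorname{diag}(\gamma_{1j}^2,\dots,\gamma_{nj}^2)$.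 For $z\in\mathbb{C}\setminus\mathbb{R}^+$ ($\mathbb{R}^+=[0,\infty)$), the diagonal matrices $T_p(z)=\operatorname{diag}(T_p^{(j)}(z))_{1\le j\le p}$ and $\widetilde T_n(z)=\operatorname{diag}(\widetilde T_n^{(i)}(z))_{1\le i\le n}$ are the unique solution of $$T_p^{(j)}(z)=\frac{-1}{z\bigl(1+\frac1n\operatorname{Tr}[\widetilde D_j\widetilde T_n(z)]\bigr)},\qquad \widetilde T_n^{(i)}(z)=\frac{-1}{z\bigl(1+\frac1n\operatorname{Tr}[D_iT_p(z)]\bigr)},$$ in the class where every entry is the Stieltjes transform $z\mapsto\int\frac{\mu(dt)}{t-z}$ of a probability measure $\mu$ on $[0,\infty)$; $\widetilde T_n'$ is the derivative of $\widetilde T_n$ in $z$. Deterministic equivalents: $$r_\lambda^{train}(X_n)=\frac{\lambda^2\alpha^2}{p}\operatorname{Tr}\bigl[\widetilde T_n(-\lambda)-\lambda\widetilde T_n'(-\lambda)\bigr]+\frac{\lambda^2\sigma^2}{n}\operatorname{Tr}[\widetilde T_n'(-\lambda)],$$ $$df_1(\lambda)=\frac1p\operatorname{Tr}[\Sigma_n(\Sigma_n+\kappa(\lambda))^{-1}],\quad \kappa(\lambda)=\operatorname{diag}(\kappa_1(\lambda),\dots,\kappa_p(\lambda)),\quad \kappa_j(\lambda)=\frac{\operatorname{Tr}[\widetilde D_j]}{\operatorname{Tr}[\widetilde D_j\widetilde T_n(-\lambda)]}.$$ Convention: if $\widetilde D_j=0$ (so that $\kappa_j$ reads $0/0$), the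 $j$-th term in the trace defining $df_1(\lambda)$ is understood to be $0$. *)

theory Defs
  imports "HOL-Probability.Probability" "Jordan_Normal_Form.Gauss_Jordan_Elimination"
begin

text \<open>
  The dimensions \<open>n\<close> and \<open>p = p(n)\<close> vary along the sequence, so matrices and vectors with
  \<open>n\<close>-dependent size are those of \<open>Jordan_Normal_Form\<close> (0-based indices). The profile and all
  random vectors and matrices are given by their entries; only entries with row index below \<open>n\<close>
  and column index below \<open>p\<close> matter.
\<close>

definition mtrace :: "'a :: comm_monoid_add mat \<Rightarrow> 'a" where
  "mtrace A = (\<Sum>i<dim_row A. A $$ (i, i))"

text \<open>\<open>mat_inverse\<close> returns \<open>None\<close> on singular matrices; below it is only applied to
  positive definite ones.\<close>

definition minv :: "'a :: field mat \<Rightarrow> 'a mat" where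
  "minv A = the (mat_inverse A)"


section \<open>Random model\<close>

definition iid :: "'w measure \<Rightarrow> 'i set \<Rightarrow> ('i \<Rightarrow> 'w \<Rightarrow> real) \<Rightarrow> real measure \<Rightarrow> bool" where
  "iid M I V \<mu> \<longleftrightarrow>
     prob_space.indep_vars M (\<lambda>_. borel) V I \<and> (\<forall>i\<in>I. distr M borel (V i) = \<mu>)"

definition generated :: "'w measure \<Rightarrow> 'i set \<Rightarrow> ('i \<Rightarrow> 'w \<Rightarrow> real) \<Rightarrow> 'w measure" where
  "generated M I V = vimage_algebra (space M) (\<lambda>\<omega>. \<lambda>i\<in>I. V i \<omega>) (Pi\<^sub>M I (\<lambda>_. borel))"

definition design ::
    "nat \<Rightarrow> nat \<Rightarrow> (nat \<Rightarrow> nat \<Rightarrow> real) \<Rightarrow> (nat \<Rightarrow> nat \<Rightarrow> 'w \<Rightarrow> real) \<Rightarrow> 'w \<Rightarrow> real mat" where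
  "design n p \<gamma> Z \<omega> = Matrix.mat n p (\<lambda>(i, j). \<gamma> i j * Z i j \<omega>)"

definition design_sigma :: "'w measure \<Rightarrow> nat \<Rightarrow> nat \<Rightarrow> ('w \<Rightarrow> real mat) \<Rightarrow> 'w measure" where
  "design_sigma M n p X = generated M ({..<n} \<times> {..<p}) (\<lambda>ij \<omega>. X \<omega> $$ ij)"

text \<open>Mutual independence of the vector \<open>\<beta>\<close>, the matrix \<open>X\<close> and the vector \<open>\<epsilon>\<close>.
  They take values in different spaces, so it is stated for the generated sigma-algebras; this is
  what \<open>indep_vars\<close> unfolds to.\<close>

definition model_indep ::
    "'w measure \<Rightarrow> nat \<Rightarrow> nat \<Rightarrow> (nat \<Rightarrow> 'w \<Rightarrow> real) \<Rightarrow> ('w \<Rightarrow> real mat) \<Rightarrow> (nat \<Rightarrow> 'w \<Rightarrow> real) \<Rightarrow> bool" where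
  "model_indep M n p \<beta> X \<epsilon> \<longleftrightarrow>
     prob_space.indep_sets M
       (\<lambda>k. [sets (generated M {..<p} \<beta>), sets (design_sigma M n p X), sets (generated M {..<n} \<epsilon>)] ! k)
       {..<3}"


section \<open>Ridge regression\<close>

definition sample_cov :: "nat \<Rightarrow> real mat \<Rightarrow> real mat" where
  "sample_cov n X = (1 / real n) \<cdot>\<^sub>m (transpose_mat X * X)"

definition ridge :: "nat \<Rightarrow> real \<Rightarrow> real mat \<Rightarrow> real Matrix.vec \<Rightarrow> real Matrix.vec" where
  "ridge n lam X y =
     minv (transpose_mat X * X + (real n * lam) \<cdot>\<^sub>m (1\<^sub>m (dim_col X))) *\<^sub>v (transpose_mat X *\<^sub>v y)"

definition response ::
    "nat \<Rightarrow> nat \<Rightarrow> (nat \<Rightarrow> 'w \<Rightarrow> real) \<Rightarrow> ('w \<Rightarrow> real mat) \<Rightarrow> (nat \<Rightarrow> 'w \<Rightarrow> real) \<Rightarrow> 'w \<Rightarrow> real Matrix.vec" where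
  "response n p \<beta> X \<epsilon> \<omega> =
     X \<omega> *\<^sub>v Matrix.vec p (\<lambda>j. \<beta> j \<omega>) + Matrix.vec n (\<lambda>i. \<epsilon> i \<omega>)"

definition residual_sq :: "nat \<Rightarrow> real \<Rightarrow> real mat \<Rightarrow> real Matrix.vec \<Rightarrow> real" where
  "residual_sq n lam X y = (let r = y - X *\<^sub>v ridge n lam X y in scalar_prod r r)"

definition train_risk_hat ::
    "'w measure \<Rightarrow> nat \<Rightarrow> nat \<Rightarrow> (nat \<Rightarrow> 'w \<Rightarrow> real) \<Rightarrow> ('w \<Rightarrow> real mat) \<Rightarrow> (nat \<Rightarrow> 'w \<Rightarrow> real) \<Rightarrow>
     real \<Rightarrow> 'w \<Rightarrow> real" where
  "train_risk_hat M n p \<beta> X \<epsilon> lam \<omega> =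
     1 / real n *
       real_cond_exp M (design_sigma M n p X)
         (\<lambda>\<omega>. residual_sq n lam (X \<omega>) (response n p \<beta> X \<epsilon> \<omega>)) \<omega>"

definition df1_hat :: "nat \<Rightarrow> nat \<Rightarrow> real \<Rightarrow> real mat \<Rightarrow> real" where
  "df1_hat n p lam X =
     1 / real p * mtrace (sample_cov n X * minv (sample_cov n X + lam \<cdot>\<^sub>m (1\<^sub>m p)))"

definition G_hat ::
    "'w measure \<Rightarrow> nat \<Rightarrow> nat \<Rightarrow> (nat \<Rightarrow> 'w \<Rightarrow> real) \<Rightarrow> ('w \<Rightarrow> real mat) \<Rightarrow> (nat \<Rightarrow> 'w \<Rightarrow> real) \<Rightarrow>
     real \<Rightarrow> 'w \<Rightarrow> real" where
  "G_hat M n p \<beta> X \<epsilon> lam \<omega> =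
     train_risk_hat M n p \<beta> X \<epsilon> lam \<omega> / (1 - df1_hat n p lam (X \<omega>))\<^sup>2"


section \<open>Deterministic equivalents\<close>

text \<open>Stieltjes transforms, off the nonnegative half-line, of probability measures on \<open>[0,\<infinity>)\<close>.\<close>

definition stieltjes_class :: "(complex \<Rightarrow> complex) \<Rightarrow> bool" where
  "stieltjes_class f \<longleftrightarrow>
     (\<exists>\<mu> :: real measure. prob_space \<mu> \<and> sets \<mu> = sets borel \<and> (AE t in \<mu>. 0 \<le> t) \<and>
        (\<forall>z. z \<notin> \<real>\<^sub>\<ge>\<^sub>0 \<longrightarrow> f z = (\<integral>t. 1 / (complex_of_real t - z) \<partial>\<mu>)))"

text \<open>\<open>T j\<close> and \<open>Tt i\<close> are the diagonal entries of \<open>T\<^sub>p\<close> and of \<open>T\<^sub>n\<close> with a tilde. The system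
  determines them off the nonnegative half-line, hence near each \<open>-lam\<close> with \<open>lam > 0\<close>.\<close>

definition canonical_solution ::
    "nat \<Rightarrow> nat \<Rightarrow> (nat \<Rightarrow> nat \<Rightarrow> real) \<Rightarrow> (nat \<Rightarrow> complex \<Rightarrow> complex) \<Rightarrow> (nat \<Rightarrow> complex \<Rightarrow> complex) \<Rightarrow> bool" where
  "canonical_solution n p \<gamma> T Tt \<longleftrightarrow>
     (\<forall>j<p. stieltjes_class (T j)) \<and> (\<forall>i<n. stieltjes_class (Tt i)) \<and>
     (\<forall>z. z \<notin> \<real>\<^sub>\<ge>\<^sub>0 \<longrightarrow>
        (\<forall>j<p. T j z = -1 / (z * (1 + 1 / of_nat n * (\<Sum>i<n. of_real ((\<gamma> i j)\<^sup>2) * Tt i z)))) \<and>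
        (\<forall>i<n. Tt i z = -1 / (z * (1 + 1 / of_nat n * (\<Sum>j<p. of_real ((\<gamma> i j)\<^sup>2) * T j z)))))"

text \<open>The deterministic equivalents are kept complex-valued, being built from the complex
  functions \<open>Tt i\<close>; their values are in fact real.\<close>

definition train_risk_det ::
    "nat \<Rightarrow> nat \<Rightarrow> real \<Rightarrow> real \<Rightarrow> (nat \<Rightarrow> complex \<Rightarrow> complex) \<Rightarrow> real \<Rightarrow> complex" where
  "train_risk_det n p \<alpha> \<sigma> Tt lam =
     of_real (lam\<^sup>2 * \<alpha>\<^sup>2 / real p) *
       (\<Sum>i<n. Tt i (- of_real lam) - of_real lam * deriv (Tt i) (- of_real lam)) +
     of_real (lam\<^sup>2 * \<sigma>\<^sup>2 / real n) * (\<Sum>i<n. deriv (Tt i) (- of_real lam))"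

definition kappa ::
    "nat \<Rightarrow> (nat \<Rightarrow> nat \<Rightarrow> real) \<Rightarrow> (nat \<Rightarrow> complex \<Rightarrow> complex) \<Rightarrow> real \<Rightarrow> nat \<Rightarrow> complex" where
  "kappa n \<gamma> Tt lam j =
     of_real (\<Sum>i<n. (\<gamma> i j)\<^sup>2) / (\<Sum>i<n. of_real ((\<gamma> i j)\<^sup>2) * Tt i (- of_real lam))"

text \<open>\<open>pop_cov n \<gamma> j\<close> is the \<open>j\<close>-th diagonal entry of the population covariance. The trace of the
  product of diagonal matrices is written out as a sum, where columns of the profile that
  vanish identically contribute \<open>0\<close> by convention.\<close>

definition pop_cov :: "nat \<Rightarrow> (nat \<Rightarrow> nat \<Rightarrow> real) \<Rightarrow> nat \<Rightarrow> real" where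
  "pop_cov n \<gamma> j = 1 / real n * (\<Sum>i<n. (\<gamma> i j)\<^sup>2)"

definition df1_det ::
    "nat \<Rightarrow> nat \<Rightarrow> (nat \<Rightarrow> nat \<Rightarrow> real) \<Rightarrow> (nat \<Rightarrow> complex \<Rightarrow> complex) \<Rightarrow> real \<Rightarrow> complex" where
  "df1_det n p \<gamma> Tt lam =
     1 / of_nat p *
       (\<Sum>j<p. if \<forall>i<n. \<gamma> i j = 0 then 0
               else of_real (pop_cov n \<gamma> j) / (of_real (pop_cov n \<gamma> j) + kappa n \<gamma> Tt lam j))"

definition G_det ::
    "nat \<Rightarrow> nat \<Rightarrow> real \<Rightarrow> real \<Rightarrow> (nat \<Rightarrow> nat \<Rightarrow> real) \<Rightarrow> (nat \<Rightarrow> complex \<Rightarrow> complex) \<Rightarrow> real \<Rightarrow> complex" where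
  "G_det n p \<alpha> \<sigma> \<gamma> Tt lam = train_risk_det n p \<alpha> \<sigma> Tt lam / (1 - df1_det n p \<gamma> Tt lam)\<^sup>2"

end

(*
  Write A for the design scaled by 1/sqrt n, Q = (A^T A + lam)^-1 and Qt = (A A^T + lam)^-1.
  Averaging over the signal and the noise turns the training risk into an expression in tr Qt and
  tr Qt^2, and 1 - df1 is the normalized trace of lam Q; on the deterministic side the same formulas
  hold with Qt, Qt^2, Q replaced by the solution of the canonical equations at the real point -lam and
  by its derivative. So it suffices to compare normalized traces for lam > 0, without complex spectral
  parameters.

  Zeroing row i of A gives lam Qt_ii = 1 / (1 + x . Q0 x) with Q0 independent of the row x. The
  quadratic form is close in L^1 to the sum of v_ij Q_jj by a fourth-moment bound, and this sum is
  close to its mean by the bounded differences inequality, as changing one row changes a weighted trace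
  of Q by O(1). Hence the expectations of Qt_ii and Q_jj solve the canonical equations up to a uniform
  error O(n^-1/2), and these equations are stable on the positive cone in the Thompson metric.

  The matrices for different n may be arbitrarily dependent, so almost sure convergence needs summable
  tails; the bounded differences inequality makes them exponential. The derivative in lam is handled by
  difference quotients, whose errors are bounded uniformly in n.
*)
theory Submission
  imports Defs "Jordan_Normal_Form.Determinant"
begin

text \<open>The entries are unbounded, so concentration cannot come from the size of a row. What
  replaces it: a positive definite resolvent absorbs a rank-one change. By Sherman-Morrison and
  \<open>l R^2 <= R\<close>, a trace with weights in \<open>[0, D]\<close> moves by at most
  \<open>D / l\<close>, however large the row. A quadratic form in one row is controlled in L^1
  only, which suffices because it enters the equations under an expectation. The rate comes from
  scaling: variances O(1/n) and fourth moments O(n^-2) of the scaled entries, against a squared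
  Frobenius norm O(n) of the resolvent, give the form a variance O(1/n). The stability constants
  depend only on row and column sums of the variances, which stay bounded. Rows and columns enter
  symmetrically, so each estimate is shown once and then transposed. Difference quotients can
  replace derivatives because resolvent entries and Stieltjes transforms obey the same error bound
  \<open>(b - a) / a ^ 3\<close>; the canonical equations are never differentiated. The closing
  division is safe because boundedness of the profile keeps the deterministic denominator away from
  0.\<close>

section \<open>Resolvents of Gram matrices\<close>

text \<open>Applied to the transpose, \<open>resolvent\<close> is the companion resolvent \<open>(A A\<^sup>T + l)\<^sup>-\<^sup>1\<close>; every
  statement about rows thus has a column version.\<close>

definition gram_reg :: "real \<Rightarrow> real mat \<Rightarrow> real mat" where
  "gram_reg l A = transpose_mat A * A + l \<cdot>\<^sub>m 1\<^sub>m (dim_col A)"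

definition resolvent :: "real \<Rightarrow> real mat \<Rightarrow> real mat" where
  "resolvent l A = minv (gram_reg l A)"

text \<open>Zeroing a row in place of deleting it keeps the dimensions and gives the same Gram matrix.\<close>

definition zero_row :: "nat \<Rightarrow> real mat \<Rightarrow> real mat" where
  "zero_row i A = Matrix.mat (dim_row A) (dim_col A) (\<lambda>(k, j). if k = i then 0 else A $$ (k, j))"

lemma scalar_prod_self_nonneg: "0 \<le> scalar_prod v (v :: real Matrix.vec)"
  by (auto simp: scalar_prod_def intro!: sum_nonneg)

text \<open>A right inverse makes the determinant nonzero, so \<open>mat_inverse\<close> does not
  return \<open>None\<close>; uniqueness of inverses does the rest. Formulas for inverses are later
  verified by one multiplication.\<close>

lemma minv_eqI:
  fixes A B :: "'a :: field mat"
  assumes A: "A \<in> carrier_mat n n" and B: "B \<in> carrier_mat n n" and AB: "A * B = 1\<^sub>m n"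
  shows "minv A = B"
proof -
  have "Determinant.det A * Determinant.det B = 1"
    using det_mult[OF A B] by (simp add: AB)
  then have "A \<in> Units (ring_mat TYPE('a) n ())"
    by (intro det_non_zero_imp_unit[OF A]) auto
  then obtain C where C: "mat_inverse A = Some C"
    using mat_inverse(1)[OF A, of "()"] by (cases "mat_inverse A") auto
  have CA: "C * A = 1\<^sub>m n" and Cc: "C \<in> carrier_mat n n"
    using mat_inverse(2)[OF A C] by auto
  have "C = C * (A * B)"
    using AB Cc by simp
  also have "\<dots> = C * A * B"
    by (rule assoc_mult_mat[OF Cc A B, symmetric])
  also have "\<dots> = B"
    using CA B by simp
  finally show ?thesis
    by (simp add: minv_def C)
qed

context
  fixes A :: "real mat" and N P :: nat and l :: real
  assumes A: "A \<in> carrier_mat N P" and l: "l > 0"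
begin

lemma gram_reg_carrier: "gram_reg l A \<in> carrier_mat P P"
  using A unfolding gram_reg_def by (intro add_carrier_mat) auto

lemma gram_reg_sym: "transpose_mat (gram_reg l A) = gram_reg l A"
proof -
  have "transpose_mat (transpose_mat A * A) = transpose_mat A * A"
    using A by (subst transpose_mult) auto
  moreover have "transpose_mat (l \<cdot>\<^sub>m 1\<^sub>m P) = l \<cdot>\<^sub>m 1\<^sub>m P"
    by (intro eq_matI) auto
  ultimately show ?thesis
    using A unfolding gram_reg_def by (subst transpose_add[of _ P P]) auto
qed

lemma gram_reg_mult_vec:
  assumes v: "v \<in> carrier_vec P"
  shows "gram_reg l A *\<^sub>v v = transpose_mat A *\<^sub>v (A *\<^sub>v v) + l \<cdot>\<^sub>v v"
proof -
  have "gram_reg l A *\<^sub>v v = (transpose_mat A * A) *\<^sub>v v + (l \<cdot>\<^sub>m 1\<^sub>m P) *\<^sub>v v"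
    using A v unfolding gram_reg_def by (subst add_mult_distrib_mat_vec[of _ P P]) auto
  also have "(l \<cdot>\<^sub>m 1\<^sub>m P) *\<^sub>v v = l \<cdot>\<^sub>v v"
    using v by (intro eq_vecI) auto
  also have "(transpose_mat A * A) *\<^sub>v v = transpose_mat A *\<^sub>v (A *\<^sub>v v)"
    using A v by (subst assoc_mult_mat_vec) auto
  finally show ?thesis .
qed

text \<open>All positivity comes from here. Dropping the Gram term gives invertibility and the
  bounds by \<open>1 / l\<close>; keeping it later evaluates the signal part of the training
  risk.\<close>

lemma gram_reg_quad:
  assumes v: "v \<in> carrier_vec P"
  shows "scalar_prod v (gram_reg l A *\<^sub>v v)
    = scalar_prod (A *\<^sub>v v) (A *\<^sub>v v) + l * scalar_prod v v"
proof -
  have c: "A *\<^sub>v v \<in> carrier_vec N" "transpose_mat A *\<^sub>v (A *\<^sub>v v) \<in> carrier_vec P"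
    using A v by auto
  have "scalar_prod v (transpose_mat A *\<^sub>v (A *\<^sub>v v)) = scalar_prod (A *\<^sub>v v) (A *\<^sub>v v)"
    using transpose_vec_mult_scalar[OF A v c(1)] comm_scalar_prod[OF v c(2)] by simp
  then show ?thesis
    using v c by (simp add: gram_reg_mult_vec scalar_prod_add_distrib[of _ P])
qed

lemma gram_reg_det: "Determinant.det (gram_reg l A) \<noteq> 0"
proof
  assume "Determinant.det (gram_reg l A) = 0"
  then obtain v where v: "v \<in> carrier_vec P" "v \<noteq> 0\<^sub>v P" "gram_reg l A *\<^sub>v v = 0\<^sub>v P"
    using det_0_iff_vec_prod_zero[OF gram_reg_carrier] by auto
  have "scalar_prod (A *\<^sub>v v) (A *\<^sub>v v) + l * scalar_prod v v = 0"
    using gram_reg_quad[OF v(1)] v by simp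
  then have "l * scalar_prod v v \<le> 0"
    using scalar_prod_self_nonneg[of "A *\<^sub>v v"] by linarith
  then have "scalar_prod v v \<le> 0"
    using l by (simp add: mult_le_0_iff)
  then have "(\<Sum>i\<in>{0..<P}. v $ i * v $ i) = 0"
    using scalar_prod_self_nonneg[of v] v(1) by (simp add: scalar_prod_def)
  then have "\<forall>i\<in>{0..<P}. v $ i * v $ i = 0"
    by (subst (asm) sum_nonneg_eq_0_iff) auto
  then have "v = 0\<^sub>v P"
    using v(1) by (intro eq_vecI) auto
  with v(2) show False ..
qed

lemma resolvent_inverse:
  shows resolvent_carrier: "resolvent l A \<in> carrier_mat P P"
    and gram_reg_mult_resolvent: "gram_reg l A * resolvent l A = 1\<^sub>m P"
    and resolvent_mult_gram_reg: "resolvent l A * gram_reg l A = 1\<^sub>m P"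
proof -
  have "gram_reg l A \<in> Units (ring_mat TYPE(real) P ())"
    by (rule det_non_zero_imp_unit[OF gram_reg_carrier gram_reg_det])
  then obtain C where C: "mat_inverse (gram_reg l A) = Some C"
    using mat_inverse(1)[OF gram_reg_carrier, of "()"] by (cases "mat_inverse (gram_reg l A)") auto
  show "resolvent l A \<in> carrier_mat P P" "gram_reg l A * resolvent l A = 1\<^sub>m P"
    "resolvent l A * gram_reg l A = 1\<^sub>m P"
    using mat_inverse(2)[OF gram_reg_carrier C] by (auto simp: resolvent_def minv_def C)
qed

lemma resolvent_sym: "transpose_mat (resolvent l A) = resolvent l A"
proof -
  have "gram_reg l A * transpose_mat (resolvent l A)
    = transpose_mat (resolvent l A * gram_reg l A)"
    by (subst transpose_mult[OF resolvent_carrier gram_reg_carrier]) (simp add: gram_reg_sym)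
  also have "\<dots> = 1\<^sub>m P"
    by (simp add: resolvent_mult_gram_reg)
  finally have "minv (gram_reg l A) = transpose_mat (resolvent l A)"
    using resolvent_carrier by (intro minv_eqI[OF gram_reg_carrier]) auto
  then show ?thesis
    by (simp add: resolvent_def)
qed

lemma resolvent_index_sym:
  "i < P \<Longrightarrow> j < P \<Longrightarrow> resolvent l A $$ (i, j) = resolvent l A $$ (j, i)"
  using resolvent_sym resolvent_carrier by (metis carrier_matD index_transpose_mat(1))

lemma resolvent_gram_reg_vec:
  assumes v: "v \<in> carrier_vec P"
  shows "resolvent l A *\<^sub>v (gram_reg l A *\<^sub>v v) = v"
    and "gram_reg l A *\<^sub>v (resolvent l A *\<^sub>v v) = v"
  using assoc_mult_mat_vec[OF resolvent_carrier gram_reg_carrier v]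
    assoc_mult_mat_vec[OF gram_reg_carrier resolvent_carrier v] v
  by (simp_all add: resolvent_mult_gram_reg gram_reg_mult_resolvent)

lemma resolvent_scalar_prod_commute:
  assumes u: "u \<in> carrier_vec P" and v: "v \<in> carrier_vec P"
  shows "scalar_prod u (resolvent l A *\<^sub>v v) = scalar_prod (resolvent l A *\<^sub>v u) v"
  using transpose_vec_mult_scalar[OF resolvent_carrier v u] by (simp add: resolvent_sym)

text \<open>The operator inequality \<open>l R^2 <= R\<close>: put \<open>R v\<close> into
  \<open>gram_reg_quad\<close> and discard the Gram term. The bounds on diagonal entries, on columns
  and on leave-one-out forms are instances.\<close>

lemma resolvent_quad:
  assumes v: "v \<in> carrier_vec P"
  shows "l * scalar_prod (resolvent l A *\<^sub>v v) (resolvent l A *\<^sub>v v)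
    \<le> scalar_prod (resolvent l A *\<^sub>v v) v"
proof -
  have w: "resolvent l A *\<^sub>v v \<in> carrier_vec P"
    using resolvent_carrier v by auto
  show ?thesis
    using gram_reg_quad[OF w] scalar_prod_self_nonneg[of "A *\<^sub>v (resolvent l A *\<^sub>v v)"]
    by (simp add: resolvent_gram_reg_vec(2)[OF v])
qed

lemma resolvent_unit_vec_index:
  assumes "j < P" "k < P"
  shows "(resolvent l A *\<^sub>v unit_vec P j) $ k = resolvent l A $$ (k, j)"
  using resolvent_carrier assms by (simp add: scalar_prod_right_unit)

lemma resolvent_diag_scalar_prod:
  assumes "j < P"
  shows "scalar_prod (resolvent l A *\<^sub>v unit_vec P j) (unit_vec P j) = resolvent l A $$ (j, j)"
proof -
  have "resolvent l A *\<^sub>v unit_vec P j \<in> carrier_vec P"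
    using resolvent_carrier by auto
  then show ?thesis
    using assms by (simp add: scalar_prod_right_unit resolvent_unit_vec_index)
qed

lemma resolvent_col_scalar_prod:
  assumes "j < P"
  shows "scalar_prod (resolvent l A *\<^sub>v unit_vec P j) (resolvent l A *\<^sub>v unit_vec P j)
    = (\<Sum>k<P. (resolvent l A $$ (k, j))\<^sup>2)"
proof -
  have "dim_vec (resolvent l A *\<^sub>v unit_vec P j) = P"
    using resolvent_carrier by auto
  then show ?thesis
    unfolding scalar_prod_def using assms
    by (auto simp: resolvent_unit_vec_index power2_eq_square atLeast0LessThan
        simp del: index_mult_mat_vec intro!: sum.cong)
qed

lemma resolvent_col_sq_le: "j < P \<Longrightarrow> l * (\<Sum>k<P. (resolvent l A $$ (k, j))\<^sup>2) \<le> resolvent l A $$ (j, j)"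
  using resolvent_quad[of "unit_vec P j"]
  by (simp add: resolvent_diag_scalar_prod resolvent_col_scalar_prod
      del: index_mult_mat_vec scalar_prod_right_unit scalar_prod_left_unit)

text \<open>The square of a diagonal entry \<open>r\<close> is one term of its column sum, so
  \<open>l r^2 <= r\<close>, which confines \<open>r\<close> to \<open>[0, 1/l]\<close>.\<close>

lemma resolvent_diag_bounds:
  assumes "j < P"
  shows "0 \<le> resolvent l A $$ (j, j)" "resolvent l A $$ (j, j) \<le> 1 / l"
proof -
  have "l * (resolvent l A $$ (j, j))\<^sup>2 \<le> l * (\<Sum>k<P. (resolvent l A $$ (k, j))\<^sup>2)"
    using assms l by (intro mult_left_mono member_le_sum) auto
  then have le: "l * (resolvent l A $$ (j, j))\<^sup>2 \<le> resolvent l A $$ (j, j)"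
    using resolvent_col_sq_le[OF assms] by linarith
  show nn: "0 \<le> resolvent l A $$ (j, j)"
    using le l by (meson mult_nonneg_nonneg order.strict_implies_order order.trans zero_le_power2)
  show "resolvent l A $$ (j, j) \<le> 1 / l"
  proof (cases "resolvent l A $$ (j, j) = 0")
    case False
    have "l * resolvent l A $$ (j, j) * resolvent l A $$ (j, j) \<le> 1 * resolvent l A $$ (j, j)"
      using le by (simp add: power2_eq_square algebra_simps)
    then have "l * resolvent l A $$ (j, j) \<le> 1"
      using nn False by (subst (asm) mult_le_cancel_right) auto
    then show ?thesis
      using l by (simp add: field_simps)
  qed (use l in simp)
qed

lemma resolvent_col_sq_bound:
  assumes "j < P"
  shows "(\<Sum>k<P. (resolvent l A $$ (k, j))\<^sup>2) \<le> 1 / l\<^sup>2"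
proof -
  have "l * (\<Sum>k<P. (resolvent l A $$ (k, j))\<^sup>2) \<le> 1 / l"
    using resolvent_col_sq_le[OF assms] resolvent_diag_bounds(2)[OF assms] by linarith
  then show ?thesis
    using l by (simp add: field_simps power2_eq_square)
qed

text \<open>The push-through identity, checked by multiplying the right-hand side by
  \<open>A A^T + l\<close> and using \<open>A^T A R = 1 - l R\<close>. It identifies the ridge
  residual with a multiple of the companion resolvent and gives access to its diagonal.\<close>

lemma resolvent_transpose:
  "resolvent l (transpose_mat A) = (1 / l) \<cdot>\<^sub>m (1\<^sub>m N - A * resolvent l A * transpose_mat A)"
proof -
  let ?R = "resolvent l A" and ?B = "A * resolvent l A * transpose_mat A"
  have g: "gram_reg l (transpose_mat A) = A * transpose_mat A + l \<cdot>\<^sub>m 1\<^sub>m N"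
    using A by (simp add: gram_reg_def)
  have R: "?R \<in> carrier_mat P P" by (rule resolvent_carrier)
  have AR: "A * ?R \<in> carrier_mat N P" and B: "?B \<in> carrier_mat N N"
    and At: "transpose_mat A \<in> carrier_mat P N" and AAt: "A * transpose_mat A \<in> carrier_mat N N"
    using A R by auto
  have gc: "gram_reg l (transpose_mat A) \<in> carrier_mat N N"
    unfolding g using AAt by auto
  have "gram_reg l (transpose_mat A) * ?B = A * transpose_mat A * ?B + l \<cdot>\<^sub>m ?B"
    unfolding g using AAt B
    by (simp add: add_mult_distrib_mat[of _ N N] mult_smult_assoc_mat[of _ N N]
        left_mult_one_mat[OF B] del: assoc_mult_mat)
  \<comment> \<open>Reassociation exposes the inner factor \<open>A^T A R\<close>, which can then be
    replaced by \<open>1 - l R\<close>.\<close>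
  also have "A * transpose_mat A * ?B = A * (transpose_mat A * A * ?R) * transpose_mat A"
  proof -
    have "A * transpose_mat A * ?B = A * (transpose_mat A * (A * ?R * transpose_mat A))"
      using A R by (intro assoc_mult_mat[of _ N P _ N]) auto
    also have "transpose_mat A * (A * ?R * transpose_mat A) = transpose_mat A * (A * ?R) * transpose_mat A"
      using A R by (intro assoc_mult_mat[of _ P N _ P, symmetric]) auto
    also have "transpose_mat A * (A * ?R) = transpose_mat A * A * ?R"
      using A R by (intro assoc_mult_mat[of _ P N _ P, symmetric]) auto
    also have "A * (transpose_mat A * A * ?R * transpose_mat A)
        = A * (transpose_mat A * A * ?R) * transpose_mat A"
      using A R by (intro assoc_mult_mat[of _ N P _ P, symmetric]) auto
    finally show ?thesis .
  qed
  also have "transpose_mat A * A * ?R = 1\<^sub>m P - l \<cdot>\<^sub>m ?R"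
  proof -
    have "transpose_mat A * A * ?R + l \<cdot>\<^sub>m ?R = gram_reg l A * ?R"
      unfolding gram_reg_def using A R
      by (simp add: add_mult_distrib_mat[of _ P P] mult_smult_assoc_mat[of _ P P])
    then have s: "transpose_mat A * A * ?R + l \<cdot>\<^sub>m ?R = 1\<^sub>m P"
      by (simp add: gram_reg_mult_resolvent)
    show ?thesis
    proof (rule eq_matI)
      fix i j assume "i < dim_row (1\<^sub>m P - l \<cdot>\<^sub>m ?R)" "j < dim_col (1\<^sub>m P - l \<cdot>\<^sub>m ?R)"
      then have ij: "i < P" "j < P" using R by auto
      have "(transpose_mat A * A * ?R + l \<cdot>\<^sub>m ?R) $$ (i, j) = (1\<^sub>m P :: real mat) $$ (i, j)"
        by (simp only: s)
      moreover have "(transpose_mat A * A * ?R + l \<cdot>\<^sub>m ?R) $$ (i, j)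
        = (transpose_mat A * A * ?R) $$ (i, j) + l * ?R $$ (i, j)"
        using A R ij by (subst index_add_mat) auto
      moreover have "(1\<^sub>m P - l \<cdot>\<^sub>m ?R) $$ (i, j) = (1\<^sub>m P) $$ (i, j) - l * ?R $$ (i, j)"
        using R ij by (subst index_minus_mat) auto
      ultimately show "(transpose_mat A * A * ?R) $$ (i, j) = (1\<^sub>m P - l \<cdot>\<^sub>m ?R) $$ (i, j)"
        by linarith
    qed (use A R in auto)
  qed
  also have "A * (1\<^sub>m P - l \<cdot>\<^sub>m ?R) * transpose_mat A = A * transpose_mat A - l \<cdot>\<^sub>m ?B"
  proof -
    have lR: "l \<cdot>\<^sub>m ?R \<in> carrier_mat P P" and lAR: "l \<cdot>\<^sub>m (A * ?R) \<in> carrier_mat N P"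
      using R AR by auto
    have "A * (1\<^sub>m P - l \<cdot>\<^sub>m ?R) = A - l \<cdot>\<^sub>m (A * ?R)"
      using A R lR by (simp add: mult_minus_distrib_mat[OF A one_carrier_mat lR] mult_smult_distrib[OF A R])
    then show ?thesis
      by (simp add: minus_mult_distrib_mat[OF A lAR At] mult_smult_assoc_mat[OF AR At] del: assoc_mult_mat)
  qed
  also have "A * transpose_mat A - l \<cdot>\<^sub>m ?B + l \<cdot>\<^sub>m ?B = A * transpose_mat A"
    using AAt B by (intro eq_matI) auto
  finally have gB: "gram_reg l (transpose_mat A) * ?B = A * transpose_mat A" .
  have "gram_reg l (transpose_mat A) * (1\<^sub>m N - ?B) = gram_reg l (transpose_mat A) - A * transpose_mat A"
    using gc gB by (simp add: mult_minus_distrib_mat[OF gc one_carrier_mat B] del: assoc_mult_mat)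
  also have "\<dots> = l \<cdot>\<^sub>m 1\<^sub>m N"
    unfolding g using AAt by (intro eq_matI) auto
  finally have "gram_reg l (transpose_mat A) * ((1 / l) \<cdot>\<^sub>m (1\<^sub>m N - ?B)) = 1\<^sub>m N"
    using l by (subst mult_smult_distrib[OF gc minus_carrier_mat[OF B]]) (auto intro!: eq_matI)
  then show ?thesis
    unfolding resolvent_def[of l "transpose_mat A"]
    by (intro minv_eqI[OF gc] smult_carrier_mat minus_carrier_mat[OF B])
qed

end

text \<open>The removed term becomes a zero instead of shrinking the index set, to match
  \<open>zero_row\<close>.\<close>

lemma sum_lessThan_remove:
  fixes f :: "nat \<Rightarrow> real"
  assumes "i < N"
  shows "(\<Sum>k<N. f k) = f i + (\<Sum>k<N. if k = i then 0 else f k)"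
proof -
  have "(\<Sum>k<N. f k) = f i + (\<Sum>k\<in>{..<N} - {i}. f k)"
    using assms by (intro sum.remove) auto
  also have "(\<Sum>k\<in>{..<N} - {i}. f k) = (\<Sum>k\<in>{..<N} - {i}. if k = i then 0 else f k)"
    by (intro sum.cong) auto
  also have "\<dots> = (\<Sum>k<N. if k = i then 0 else f k)"
    by (intro sum.mono_neutral_left) auto
  finally show ?thesis .
qed

lemma zero_row_carrier [simp]: "A \<in> carrier_mat N P \<Longrightarrow> zero_row i A \<in> carrier_mat N P"
  by (auto simp: zero_row_def)

context
  fixes A :: "real mat" and N P i :: nat and l :: real
  assumes A: "A \<in> carrier_mat N P" and l: "l > 0" and i: "i < N"
begin

lemma gram_reg_zero_row_index:
  assumes jk: "j < P" "k < P"
  shows "gram_reg l A $$ (j, k) = gram_reg l (zero_row i A) $$ (j, k) + A $$ (i, j) * A $$ (i, k)"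
proof -
  have *: "gram_reg l B $$ (j, k)
      = (\<Sum>m<N. B $$ (m, j) * B $$ (m, k)) + l * (if j = k then 1 else 0)"
    if "B \<in> carrier_mat N P" for B
    using that jk unfolding gram_reg_def
    by (auto simp: scalar_prod_def atLeast0LessThan)
  have "(\<Sum>m<N. zero_row i A $$ (m, j) * zero_row i A $$ (m, k))
      = (\<Sum>m<N. if m = i then 0 else A $$ (m, j) * A $$ (m, k))"
    using A jk by (intro sum.cong) (auto simp: zero_row_def)
  then show ?thesis
    using sum_lessThan_remove[OF i, of "\<lambda>m. A $$ (m, j) * A $$ (m, k)"]
    by (simp add: *[OF A] *[OF zero_row_carrier[OF A]])
qed

lemma gram_reg_zero_row_vec:
  assumes u: "u \<in> carrier_vec P"
  shows "gram_reg l A *\<^sub>v u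
    = gram_reg l (zero_row i A) *\<^sub>v u + scalar_prod (row A i) u \<cdot>\<^sub>v row A i"
proof (rule eq_vecI)
  note c = gram_reg_carrier[OF A l] gram_reg_carrier[OF zero_row_carrier[OF A, of i] l]
  show "dim_vec (gram_reg l A *\<^sub>v u)
      = dim_vec (gram_reg l (zero_row i A) *\<^sub>v u + scalar_prod (row A i) u \<cdot>\<^sub>v row A i)"
    using A c by auto
  fix j assume "j < dim_vec (gram_reg l (zero_row i A) *\<^sub>v u + scalar_prod (row A i) u \<cdot>\<^sub>v row A i)"
  then have j: "j < P" using A by simp
  have "(gram_reg l A *\<^sub>v u) $ j = (\<Sum>k<P. gram_reg l A $$ (j, k) * u $ k)"
    using c j u by (simp add: scalar_prod_def atLeast0LessThan)
  also have "\<dots> = (\<Sum>k<P. gram_reg l (zero_row i A) $$ (j, k) * u $ k)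
      + (\<Sum>k<P. A $$ (i, k) * u $ k) * A $$ (i, j)"
    using j by (simp add: gram_reg_zero_row_index algebra_simps sum.distrib sum_distrib_left)
  also have "\<dots> = (gram_reg l (zero_row i A) *\<^sub>v u + scalar_prod (row A i) u \<cdot>\<^sub>v row A i) $ j"
    using A c j u i by (simp add: scalar_prod_def atLeast0LessThan)
  finally show "(gram_reg l A *\<^sub>v u) $ j
      = (gram_reg l (zero_row i A) *\<^sub>v u + scalar_prod (row A i) u \<cdot>\<^sub>v row A i) $ j" .
qed

text \<open>Leave-one-out quantities. With independent rows, \<open>R0\<close> is independent of
  \<open>x0\<close>, and this is what makes the form \<open>q0\<close> tractable.\<close>

private abbreviation (input) "x0 \<equiv> row A i"
private abbreviation (input) "R0 \<equiv> resolvent l (zero_row i A)"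
private abbreviation (input) "u0 \<equiv> R0 *\<^sub>v x0"
private abbreviation (input) "q0 \<equiv> scalar_prod x0 u0"

lemma row_vec_carrier: "x0 \<in> carrier_vec P"
  using A by auto

lemma loo_vec_carrier: "u0 \<in> carrier_vec P"
  using resolvent_carrier[OF zero_row_carrier[OF A, of i] l] row_vec_carrier by auto

lemma loo_quad_bound: "l * scalar_prod u0 u0 \<le> q0"
  using resolvent_quad[OF zero_row_carrier[OF A] l row_vec_carrier]
    comm_scalar_prod[OF row_vec_carrier loo_vec_carrier] by simp

lemma loo_quad_nonneg: "0 \<le> q0"
  using loo_quad_bound scalar_prod_self_nonneg[of u0] l
  by (meson mult_nonneg_nonneg order.strict_implies_order order.trans)

text \<open>Sherman-Morrison without inverting anything: \<open>gram_reg l A\<close> sends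
  \<open>u0\<close> to \<open>(1 + q0) x0\<close>, and applying the resolvent gives the
  formula.\<close>

lemma resolvent_mult_row: "resolvent l A *\<^sub>v x0 = (1 / (1 + q0)) \<cdot>\<^sub>v u0"
proof -
  note Rc = resolvent_carrier[OF A l]
  have "gram_reg l A *\<^sub>v u0 = x0 + q0 \<cdot>\<^sub>v x0"
    using resolvent_gram_reg_vec(2)[OF zero_row_carrier[OF A] l row_vec_carrier]
    by (simp add: gram_reg_zero_row_vec[OF loo_vec_carrier])
  also have "\<dots> = (1 + q0) \<cdot>\<^sub>v x0"
    using row_vec_carrier by (intro eq_vecI) (auto simp: algebra_simps)
  finally have "resolvent l A *\<^sub>v (gram_reg l A *\<^sub>v u0) = (1 + q0) \<cdot>\<^sub>v (resolvent l A *\<^sub>v x0)"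
    using Rc row_vec_carrier by (simp add: mult_mat_vec)
  then have "u0 = (1 + q0) \<cdot>\<^sub>v (resolvent l A *\<^sub>v x0)"
    by (simp add: resolvent_gram_reg_vec(1)[OF A l loo_vec_carrier])
  then have "(1 / (1 + q0)) \<cdot>\<^sub>v u0 = (1 / (1 + q0)) \<cdot>\<^sub>v ((1 + q0) \<cdot>\<^sub>v (resolvent l A *\<^sub>v x0))"
    by simp
  also have "\<dots> = resolvent l A *\<^sub>v x0"
    using Rc loo_quad_nonneg by (simp add: smult_smult_assoc)
  finally show ?thesis ..
qed

text \<open>By the push-through identity the entry is \<open>(1 - x0 . R x0) / l\<close>, and
  \<open>resolvent_mult_row\<close> gives \<open>x0 . R x0 = q0 / (1 + q0)\<close>. The shape of the
  canonical equations originates here, with \<open>q0\<close> in place of a weighted trace.\<close>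

lemma resolvent_transpose_diag:
  "resolvent l (transpose_mat A) $$ (i, i) = 1 / (l * (1 + q0))"
proof -
  note Rc = resolvent_carrier[OF A l]
  have "(A * resolvent l A * transpose_mat A) $$ (i, i)
      = scalar_prod (row (A * resolvent l A) i) x0"
    using A Rc i by (simp del: row_mult assoc_mult_mat)
  also have "row (A * resolvent l A) i = resolvent l A *\<^sub>v x0"
  proof (rule eq_vecI)
    show "dim_vec (row (A * resolvent l A) i) = dim_vec (resolvent l A *\<^sub>v x0)"
      using A Rc by simp
    fix k assume "k < dim_vec (resolvent l A *\<^sub>v x0)"
    then have k: "k < P" using Rc by simp
    have "col (resolvent l A) k = row (resolvent l A) k"
      using resolvent_sym[OF A l] Rc k by (metis carrier_matD(1) row_transpose carrier_matD(2))
    then show "row (A * resolvent l A) i $ k = (resolvent l A *\<^sub>v x0) $ k"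
      using A Rc i k row_vec_carrier by (simp add: comm_scalar_prod[of x0 P])
  qed
  also have "scalar_prod \<dots> x0 = (1 / (1 + q0)) * q0"
    using row_vec_carrier loo_vec_carrier
    by (simp add: resolvent_mult_row comm_scalar_prod[of u0 P])
  finally have B: "(A * resolvent l A * transpose_mat A) $$ (i, i) = q0 / (1 + q0)"
    by simp
  have "A * resolvent l A * transpose_mat A \<in> carrier_mat N N"
    using A Rc by auto
  then have "resolvent l (transpose_mat A) $$ (i, i)
      = 1 / l * (1 - (A * resolvent l A * transpose_mat A) $$ (i, i))"
    using i by (simp add: resolvent_transpose[OF A l] del: assoc_mult_mat index_mult_mat)
  also have "\<dots> = 1 / (l * (1 + q0))"
    unfolding B using l loo_quad_nonneg by (simp add: field_simps del: index_mult_mat_vec)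
  finally show ?thesis .
qed

text \<open>Sherman-Morrison applied to a unit vector: \<open>R0 e_j\<close> and
  \<open>R e_j\<close> differ by a multiple of \<open>u0\<close>.\<close>

lemma resolvent_diag_loo:
  assumes j: "j < P"
  shows "R0 $$ (j, j) - resolvent l A $$ (j, j) = (u0 $ j)\<^sup>2 / (1 + q0)"
proof -
  note A0 = zero_row_carrier[OF A, of i]
  note Rc = resolvent_carrier[OF A l] and R0c = resolvent_carrier[OF A0 l]
  define w where "w = R0 *\<^sub>v unit_vec P j"
  have wc: "w \<in> carrier_vec P" using R0c by (simp add: w_def)
  have xw: "scalar_prod x0 w = u0 $ j"
    using resolvent_scalar_prod_commute[OF A0 l row_vec_carrier unit_vec_carrier[of P j]]
      loo_vec_carrier j by (simp add: w_def scalar_prod_right_unit del: index_mult_mat_vec)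
  have "gram_reg l A *\<^sub>v w = unit_vec P j + u0 $ j \<cdot>\<^sub>v x0"
    using resolvent_gram_reg_vec(2)[OF A0 l unit_vec_carrier[of P j]]
    by (simp add: gram_reg_zero_row_vec[OF wc] xw del: index_mult_mat_vec) (simp add: w_def)
  then have "resolvent l A *\<^sub>v (gram_reg l A *\<^sub>v w)
      = resolvent l A *\<^sub>v unit_vec P j + u0 $ j \<cdot>\<^sub>v (resolvent l A *\<^sub>v x0)"
    using Rc row_vec_carrier by (simp add: mult_mat_vec mult_add_distrib_mat_vec[of _ P P]
        del: index_mult_mat_vec)
  then have w: "w = resolvent l A *\<^sub>v unit_vec P j + u0 $ j \<cdot>\<^sub>v ((1 / (1 + q0)) \<cdot>\<^sub>v u0)"
    by (simp add: resolvent_gram_reg_vec(1)[OF A l wc] resolvent_mult_row del: index_mult_mat_vec)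
  have "w $ j = (resolvent l A *\<^sub>v unit_vec P j) $ j + u0 $ j * (1 / (1 + q0) * u0 $ j)"
    using Rc R0c j by (subst w) (simp del: index_mult_mat_vec)
  then show ?thesis
    using j by (simp add: w_def resolvent_unit_vec_index[OF A l] resolvent_unit_vec_index[OF A0 l]
        power2_eq_square del: index_mult_mat_vec)
qed

text \<open>The difference is the sum of \<open>d j * (u0 $ j)^2 / (1 + q0)\<close>, and
  \<open>l |u0|^2 <= q0\<close> bounds it by \<open>D / l\<close> whatever the size of the row. This
  is why unbounded entries do no harm to the bounded differences argument.\<close>

lemma resolvent_weighted_trace_loo:
  assumes d: "\<And>j. j < P \<Longrightarrow> 0 \<le> d j" "\<And>j. j < P \<Longrightarrow> d j \<le> D" and D: "0 \<le> D"
  shows "(\<Sum>j<P. d j * resolvent l A $$ (j, j)) \<le> (\<Sum>j<P. d j * R0 $$ (j, j))"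
    and "(\<Sum>j<P. d j * R0 $$ (j, j)) \<le> (\<Sum>j<P. d j * resolvent l A $$ (j, j)) + D / l"
proof -
  have eq: "(\<Sum>j<P. d j * R0 $$ (j, j)) - (\<Sum>j<P. d j * resolvent l A $$ (j, j))
      = (\<Sum>j<P. d j * ((u0 $ j)\<^sup>2 / (1 + q0)))"
    unfolding sum_subtractf[symmetric] right_diff_distrib[symmetric]
    by (intro sum.cong) (auto simp: resolvent_diag_loo simp del: index_mult_mat_vec)
  have "0 \<le> (\<Sum>j<P. d j * ((u0 $ j)\<^sup>2 / (1 + q0)))"
    using d loo_quad_nonneg by (intro sum_nonneg mult_nonneg_nonneg divide_nonneg_nonneg) auto
  then show "(\<Sum>j<P. d j * resolvent l A $$ (j, j)) \<le> (\<Sum>j<P. d j * R0 $$ (j, j))"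
    using eq by linarith
  show "(\<Sum>j<P. d j * R0 $$ (j, j)) \<le> (\<Sum>j<P. d j * resolvent l A $$ (j, j)) + D / l"
  proof -
    have "(\<Sum>j<P. d j * ((u0 $ j)\<^sup>2 / (1 + q0))) \<le> (\<Sum>j<P. D * ((u0 $ j)\<^sup>2 / (1 + q0)))"
      using d loo_quad_nonneg by (intro sum_mono mult_right_mono) auto
    also have "\<dots> = D * (scalar_prod u0 u0 / (1 + q0))"
      using carrier_vecD[OF loo_vec_carrier] by (simp add: scalar_prod_def[of u0 u0] atLeast0LessThan sum_distrib_left
          sum_divide_distrib power2_eq_square del: index_mult_mat_vec dim_mult_mat_vec)
    also have "\<dots> \<le> D * (1 / l)"
    proof (intro mult_left_mono D)
      have "l * scalar_prod u0 u0 \<le> 1 + q0"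
        using loo_quad_bound by linarith
      then show "scalar_prod u0 u0 / (1 + q0) \<le> 1 / l"
        using l loo_quad_nonneg by (simp add: field_simps)
    qed
    finally show ?thesis
      using eq by simp
  qed
qed

end

text \<open>Both matrices have the same \<open>zero_row i\<close>, whose trace exceeds each of the
  two by an amount in \<open>[0, D / l]\<close>; being one-sided, these bounds give
  \<open>D / l\<close> rather than twice that.\<close>

lemma resolvent_weighted_trace_row_change:
  assumes A: "A \<in> carrier_mat N P" and B: "B \<in> carrier_mat N P" and l: "l > 0" and i: "i < N"
    and eq: "\<And>k j. k < N \<Longrightarrow> j < P \<Longrightarrow> k \<noteq> i \<Longrightarrow> A $$ (k, j) = B $$ (k, j)"
    and d: "\<And>j. j < P \<Longrightarrow> 0 \<le> d j" "\<And>j. j < P \<Longrightarrow> d j \<le> D" and D: "0 \<le> D"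
  shows "\<bar>(\<Sum>j<P. d j * resolvent l A $$ (j, j)) - (\<Sum>j<P. d j * resolvent l B $$ (j, j))\<bar> \<le> D / l"
proof -
  have "zero_row i A = zero_row i B"
    using A B eq by (auto simp: zero_row_def intro!: eq_matI)
  then show ?thesis
    using resolvent_weighted_trace_loo[OF A l i, of d D] resolvent_weighted_trace_loo[OF B l i, of d D] d D
    by (simp add: abs_le_iff)
qed

text \<open>The column sum of squares is minus the derivative of the diagonal entry in the
  parameter. With \<open>w\<close> and \<open>w'\<close> the columns at \<open>s\<close> and
  \<open>t\<close>, the resolvent identity makes the quotient equal to \<open>w . w'\<close>, while
  the sum is \<open>w . w\<close>; the gap is \<open>(t - s)\<close> times the form of
  \<open>R_t\<close> at \<open>w\<close>, which is at most
  \<open>|w|^2 / t <= 1 / s ^ 3\<close>.\<close>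

lemma resolvent_diff_quotient:
  assumes A: "A \<in> carrier_mat N P" and s: "0 < s" "s < t" and j: "j < P"
  shows "\<bar>(resolvent s A $$ (j, j) - resolvent t A $$ (j, j)) / (t - s)
    - (\<Sum>k<P. (resolvent s A $$ (k, j))\<^sup>2)\<bar> \<le> (t - s) / s ^ 3"
proof -
  have t: "0 < t" using s by simp
  note Rs = resolvent_carrier[OF A s(1)] and Rt = resolvent_carrier[OF A t]
  let ?e = "unit_vec P j"
  define w where "w = resolvent s A *\<^sub>v ?e"
  define w' where "w' = resolvent t A *\<^sub>v ?e"
  define y where "y = resolvent t A *\<^sub>v w"
  have c: "w \<in> carrier_vec P" "w' \<in> carrier_vec P" "y \<in> carrier_vec P" "?e \<in> carrier_vec P"
    using Rs Rt by (auto simp: w_def w'_def y_def)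
  have "gram_reg t A *\<^sub>v w = gram_reg s A *\<^sub>v w + (t - s) \<cdot>\<^sub>v w"
    using A c by (simp add: gram_reg_mult_vec[OF A s(1)] gram_reg_mult_vec[OF A t])
      (intro eq_vecI, auto simp: algebra_simps)
  also have "gram_reg s A *\<^sub>v w = ?e"
    using resolvent_gram_reg_vec(2)[OF A s(1) c(4)] by (simp add: w_def)
  finally have "resolvent t A *\<^sub>v (gram_reg t A *\<^sub>v w) = w' + (t - s) \<cdot>\<^sub>v y"
    using Rt c by (simp add: mult_mat_vec mult_add_distrib_mat_vec[of _ P P] w'_def y_def)
  then have w: "w = w' + (t - s) \<cdot>\<^sub>v y"
    by (simp add: resolvent_gram_reg_vec(1)[OF A t c(1)])
  have "scalar_prod w ?e = scalar_prod (w' + (t - s) \<cdot>\<^sub>v y) ?e"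
    using w by simp
  also have "\<dots> = scalar_prod w' ?e + (t - s) * scalar_prod y ?e"
    using c by (simp add: add_scalar_prod_distrib[of _ P] del: scalar_prod_right_unit)
  finally have "resolvent s A $$ (j, j) = scalar_prod w' ?e + (t - s) * scalar_prod y ?e"
    using resolvent_diag_scalar_prod[OF A s(1) j] by (simp add: w_def)
  moreover have "scalar_prod y ?e = scalar_prod w w'"
    using resolvent_scalar_prod_commute[OF A t c(1) c(4)] by (simp add: y_def w'_def)
  ultimately have 1: "(resolvent s A $$ (j, j) - resolvent t A $$ (j, j)) / (t - s) = scalar_prod w w'"
    using resolvent_diag_scalar_prod[OF A t j] s by (simp add: w'_def[symmetric])
  have "scalar_prod w w = scalar_prod w (w' + (t - s) \<cdot>\<^sub>v y)"
    using w by simp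
  also have "\<dots> = scalar_prod w w' + (t - s) * scalar_prod w y"
    using c by (simp add: scalar_prod_add_distrib[of _ P])
  finally have "scalar_prod w w = scalar_prod w w' + (t - s) * scalar_prod w y" .
  moreover have "0 \<le> scalar_prod w y \<and> scalar_prod w y \<le> scalar_prod w w / t"
  proof -
    have "l * b \<le> a \<and> 0 \<le> b \<Longrightarrow> 0 < l \<Longrightarrow> 0 \<le> a" for l a b :: real
      by (meson mult_nonneg_nonneg order.strict_implies_order order.trans)
    then have nn: "0 \<le> scalar_prod w y"
      using resolvent_quad[OF A t c(1)] scalar_prod_self_nonneg[of y] t comm_scalar_prod[OF c(3) c(1)]
      unfolding y_def[symmetric] by metis
    \<comment> \<open>Expanding this square and using \<open>t R_t^2 <= R_t\<close> yields
      \<open>t R_t <= 1\<close> as quadratic forms, without eigenvalues.\<close>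
    have "0 \<le> scalar_prod (w - t \<cdot>\<^sub>v y) (w - t \<cdot>\<^sub>v y)"
      by (rule scalar_prod_self_nonneg)
    also have "\<dots> = scalar_prod w w - 2 * t * scalar_prod w y + t * (t * scalar_prod y y)"
      using c by (simp add: minus_scalar_prod_distrib[of _ P] scalar_prod_minus_distrib[of _ P]
          comm_scalar_prod[OF c(3) c(1)] algebra_simps)
    also have "t * (t * scalar_prod y y) \<le> t * scalar_prod w y"
      using resolvent_quad[OF A t c(1)] comm_scalar_prod[OF c(3) c(1)] t
      unfolding y_def[symmetric] by (intro mult_left_mono) auto
    finally have "t * scalar_prod w y \<le> scalar_prod w w" by simp
    then show ?thesis
      using nn t by (simp add: field_simps)
  qed
  moreover have "scalar_prod w w / t \<le> 1 / s ^ 3"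
  proof -
    have "scalar_prod w w \<le> 1 / s\<^sup>2"
      using resolvent_col_sq_bound[OF A s(1) j] resolvent_col_scalar_prod[OF A s(1) j]
      by (simp add: w_def)
    then have "scalar_prod w w / t \<le> (1 / s\<^sup>2) / s"
      using s by (intro frac_le) auto
    then show ?thesis by (simp add: power3_eq_cube power2_eq_square)
  qed
  ultimately have "0 \<le> (t - s) * scalar_prod w y \<and> (t - s) * scalar_prod w y \<le> (t - s) * (1 / s ^ 3)
      \<and> scalar_prod w w = scalar_prod w w' + (t - s) * scalar_prod w y"
    using s by (intro conjI mult_nonneg_nonneg mult_left_mono) linarith+
  then show ?thesis
    using resolvent_col_scalar_prod[OF A s(1) j] unfolding 1 by (simp add: w_def[symmetric])
qed

section \<open>The bounded differences inequality\<close>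

text \<open>Induction on the coordinates: Hoeffding's lemma handles the new coordinate with the
  others frozen, and averaging it out leaves a function of the remaining ones with the same
  difference bound \<open>c\<close>. The bound \<open>B\<close> serves integrability and does not
  enter the estimate.\<close>

lemma bounded_differences_mgf_PiM:
  fixes f :: "('i \<Rightarrow> 'a) \<Rightarrow> real" and \<mu> :: "'i \<Rightarrow> 'a measure"
  assumes "finite I" and prob: "\<And>i. prob_space (\<mu> i)" and s: "s > 0"
    and "f \<in> borel_measurable (PiM I \<mu>)"
    and "\<And>x. x \<in> space (PiM I \<mu>) \<Longrightarrow> \<bar>f x\<bar> \<le> B"
    and "\<And>x i y. x \<in> space (PiM I \<mu>) \<Longrightarrow> i \<in> I \<Longrightarrow> y \<in> space (\<mu> i) \<Longrightarrow> \<bar>f (x(i := y)) - f x\<bar> \<le> c"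
  shows "(\<integral>\<^sup>+x. ennreal (exp (s * (f x - (\<integral>x. f x \<partial>PiM I \<mu>)))) \<partial>PiM I \<mu>)
    \<le> ennreal (exp (s\<^sup>2 * c\<^sup>2 / 2 * card I))"
  using assms(1,4,5,6)
proof (induction I arbitrary: f rule: finite_induct)
  case empty
  show ?case
    by (simp add: PiM_empty nn_integral_count_space_finite lebesgue_integral_count_space_finite)
next
  case (insert i I)
  interpret psf: product_sigma_finite \<mu>
    by (intro product_sigma_finite.intro prob_space_imp_sigma_finite prob)
  interpret P: prob_space "PiM I \<mu>"
    by (intro prob_space_PiM prob)
  interpret Pi: prob_space "PiM (insert i I) \<mu>"
    by (intro prob_space_PiM prob)
  interpret mi: prob_space "\<mu> i" by (rule prob)
  note [measurable] = insert.prems(1)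
  \<comment> \<open>The conditional mean given all coordinates but \<open>i\<close>; the exponent
    splits into \<open>f - g\<close>, which is centered in coordinate \<open>i\<close>, and
    \<open>g - E g\<close>, which is left to the induction hypothesis.\<close>
  define g where "g x = (\<integral>y. f (x(i := y)) \<partial>\<mu> i)" for x
  have f_upd [measurable]: "(\<lambda>(x, y). f (x(i := y))) \<in> borel_measurable (PiM I \<mu> \<Otimes>\<^sub>M \<mu> i)"
    using measurable_comp[OF measurable_add_dim insert.prems(1)] by (simp add: comp_def case_prod_beta)
  have g_meas [measurable]: "g \<in> borel_measurable (PiM I \<mu>)"
    unfolding g_def by measurable
  have upd: "x(i := y) \<in> space (PiM (insert i I) \<mu>)" if "x \<in> space (PiM I \<mu>)" "y \<in> space (\<mu> i)" for x y
    using that by (auto simp: space_PiM PiE_def extensional_def)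
  have int: "integrable (\<mu> i) (\<lambda>y. f (x(i := y)))" if x: "x \<in> space (PiM I \<mu>)" for x
  proof (rule mi.integrable_const_bound[of _ B])
    show "AE y in \<mu> i. norm (f (x(i := y))) \<le> B"
    proof (rule AE_I2)
      show "norm (f (x(i := y))) \<le> B" if "y \<in> space (\<mu> i)" for y
        unfolding real_norm_def by (rule insert.prems(2)[OF upd[OF x that]])
    qed
    show "(\<lambda>y. f (x(i := y))) \<in> borel_measurable (\<mu> i)"
      using measurable_compose_Pair1[OF x f_upd] by simp
  qed
  have "integrable (PiM (insert i I) \<mu>) f"
    using insert.prems(2) by (intro Pi.integrable_const_bound[of _ B] AE_I2) auto
  then have Ef: "(\<integral>x. f x \<partial>PiM (insert i I) \<mu>) = (\<integral>x. g x \<partial>PiM I \<mu>)" (is "_ = ?E")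
    unfolding g_def using insert.hyps by (intro psf.product_integral_insert) auto
  have g_bound: "\<bar>g x\<bar> \<le> B" if x: "x \<in> space (PiM I \<mu>)" for x
  proof -
    have "\<bar>g x\<bar> \<le> (\<integral>y. \<bar>f (x(i := y))\<bar> \<partial>\<mu> i)"
      unfolding g_def by (rule integral_abs_bound)
    also have "\<dots> \<le> (\<integral>y. B \<partial>\<mu> i)"
    proof (intro integral_mono)
      show "\<bar>f (x(i := y))\<bar> \<le> B" if "y \<in> space (\<mu> i)" for y
        by (rule insert.prems(2)[OF upd[OF x that]])
    qed (use int[OF x] in auto)
    finally show ?thesis by (simp add: mi.prob_space)
  qed
  have g_diff: "\<bar>g (x(k := z)) - g x\<bar> \<le> c"
    if x: "x \<in> space (PiM I \<mu>)" and k: "k \<in> I" and z: "z \<in> space (\<mu> k)" for x k z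
  proof -
    have xk: "x(k := z) \<in> space (PiM I \<mu>)"
      using x k z by (auto simp: space_PiM PiE_def extensional_def)
    have ki: "k \<noteq> i" using k insert.hyps by auto
    have "\<bar>g (x(k := z)) - g x\<bar> = \<bar>\<integral>y. f (x(k := z, i := y)) - f (x(i := y)) \<partial>\<mu> i\<bar>"
      unfolding g_def using int[OF x] int[OF xk] by simp
    also have "\<dots> \<le> (\<integral>y. \<bar>f (x(k := z, i := y)) - f (x(i := y))\<bar> \<partial>\<mu> i)"
      by (rule integral_abs_bound)
    also have "\<dots> \<le> (\<integral>y. c \<partial>\<mu> i)"
    proof (intro integral_mono)
      fix y assume y: "y \<in> space (\<mu> i)"
      show "\<bar>f (x(k := z, i := y)) - f (x(i := y))\<bar> \<le> c"
        unfolding fun_upd_twist[OF ki] using insert.prems(3)[OF upd[OF x y], of k z] k z by blast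
    qed (use int[OF x] int[OF xk] in auto)
    finally show ?thesis by (simp add: mi.prob_space)
  qed
  have inner: "(\<integral>\<^sup>+y. ennreal (exp (s * (f (x(i := y)) - g x))) \<partial>\<mu> i) \<le> ennreal (exp (s\<^sup>2 * c\<^sup>2 / 2))"
    if x: "x \<in> space (PiM I \<mu>)" for x
  proof -
    have bd: "f (x(i := y)) \<in> {g x - c..g x + c}" if y: "y \<in> space (\<mu> i)" for y
    proof -
      have le: "\<bar>f (x(i := y)) - f (x(i := z))\<bar> \<le> c" if "z \<in> space (\<mu> i)" for z
        using insert.prems(3)[OF upd[OF x that], of i y] y unfolding fun_upd_upd by blast
      have "\<bar>f (x(i := y)) - g x\<bar> = \<bar>\<integral>z. f (x(i := y)) - f (x(i := z)) \<partial>\<mu> i\<bar>"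
        unfolding g_def using int[OF x] by (simp add: mi.prob_space)
      also have "\<dots> \<le> (\<integral>z. \<bar>f (x(i := y)) - f (x(i := z))\<bar> \<partial>\<mu> i)"
        by (rule integral_abs_bound)
      also have "\<dots> \<le> (\<integral>z. c \<partial>\<mu> i)"
        using int[OF x] le by (intro integral_mono) auto
      finally have "\<bar>f (x(i := y)) - g x\<bar> \<le> c" by (simp add: mi.prob_space)
      then show ?thesis by auto
    qed
    interpret H: interval_bounded_random_variable "\<mu> i" "\<lambda>y. f (x(i := y))" "g x - c" "g x + c"
      using int[OF x] bd by unfold_locales auto
    \<comment> \<open>The values lie within \<open>c\<close> of their mean, an interval of length
      \<open>2 * c\<close>; the constant 1/8 of Hoeffding's lemma thus becomes 1/2.\<close>
    have eq: "s\<^sup>2 * (g x + c - (g x - c))\<^sup>2 / 8 = s\<^sup>2 * c\<^sup>2 / 2"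
      by (simp add: power2_eq_square)
    show ?thesis
      using H.Hoeffdings_lemma_nn_integral[OF s] unfolding eq unfolding g_def .
  qed
  have "(\<integral>\<^sup>+x. ennreal (exp (s * (f x - ?E))) \<partial>PiM (insert i I) \<mu>)
    = (\<integral>\<^sup>+x. \<integral>\<^sup>+y. ennreal (exp (s * (f (x(i := y)) - ?E))) \<partial>\<mu> i \<partial>PiM I \<mu>)"
    using insert.hyps by (intro psf.product_nn_integral_insert) auto
  also have "\<dots> \<le> (\<integral>\<^sup>+x. ennreal (exp (s\<^sup>2 * c\<^sup>2 / 2)) * ennreal (exp (s * (g x - ?E))) \<partial>PiM I \<mu>)"
  proof (intro nn_integral_mono)
    fix x assume x: "x \<in> space (PiM I \<mu>)"
    have "(\<integral>\<^sup>+y. ennreal (exp (s * (f (x(i := y)) - ?E))) \<partial>\<mu> i)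
      = (\<integral>\<^sup>+y. ennreal (exp (s * (f (x(i := y)) - g x))) * ennreal (exp (s * (g x - ?E))) \<partial>\<mu> i)"
      by (intro nn_integral_cong)
        (simp add: ennreal_mult'[symmetric] exp_add[symmetric] algebra_simps)
    also have "\<dots> = (\<integral>\<^sup>+y. ennreal (exp (s * (f (x(i := y)) - g x))) \<partial>\<mu> i) * ennreal (exp (s * (g x - ?E)))"
      using borel_measurable_integrable[OF int[OF x]] by (intro nn_integral_multc) auto
    also have "\<dots> \<le> ennreal (exp (s\<^sup>2 * c\<^sup>2 / 2)) * ennreal (exp (s * (g x - ?E)))"
      by (intro mult_right_mono inner[OF x]) auto
    finally show "(\<integral>\<^sup>+y. ennreal (exp (s * (f (x(i := y)) - ?E))) \<partial>\<mu> i)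
      \<le> ennreal (exp (s\<^sup>2 * c\<^sup>2 / 2)) * ennreal (exp (s * (g x - ?E)))" .
  qed
  also have "\<dots> = ennreal (exp (s\<^sup>2 * c\<^sup>2 / 2)) * (\<integral>\<^sup>+x. ennreal (exp (s * (g x - ?E))) \<partial>PiM I \<mu>)"
    by (intro nn_integral_cmult) auto
  also have "\<dots> \<le> ennreal (exp (s\<^sup>2 * c\<^sup>2 / 2)) * ennreal (exp (s\<^sup>2 * c\<^sup>2 / 2 * card I))"
    by (intro mult_left_mono insert.IH g_meas g_bound g_diff) auto
  also have "\<dots> = ennreal (exp (s\<^sup>2 * c\<^sup>2 / 2 * card (insert i I)))"
    using insert.hyps by (simp add: ennreal_mult'[symmetric] exp_add[symmetric] algebra_simps add_divide_distrib)
  finally show ?case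
    unfolding Ef .
qed

context prob_space
begin

lemma bounded_differences_mgf:
  fixes F :: "('i \<Rightarrow> 'b) \<Rightarrow> real"
  assumes I: "finite I" "I \<noteq> {}" and ind: "indep_vars S r I" and s: "s > 0"
    and F [measurable]: "F \<in> borel_measurable (PiM I S)"
    and bd: "\<And>x. x \<in> space (PiM I S) \<Longrightarrow> \<bar>F x\<bar> \<le> B"
    and diff: "\<And>x i y. x \<in> space (PiM I S) \<Longrightarrow> i \<in> I \<Longrightarrow> y \<in> space (S i) \<Longrightarrow> \<bar>F (x(i := y)) - F x\<bar> \<le> c"
  defines "h \<equiv> \<lambda>\<omega>. F (\<lambda>i\<in>I. r i \<omega>) - expectation (\<lambda>\<omega>. F (\<lambda>i\<in>I. r i \<omega>))"
  shows "integrable M (\<lambda>\<omega>. exp (s * h \<omega>))"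
    and "expectation (\<lambda>\<omega>. exp (s * h \<omega>)) \<le> exp (s\<^sup>2 * c\<^sup>2 / 2 * card I)"
proof -
  \<comment> \<open>Outside \<open>I\<close> an arbitrary point mass is chosen, since the
    product-space version asks for a probability measure at every index.\<close>
  define \<mu> where "\<mu> i = (if i \<in> I then distr M (S i) (r i) else return (count_space UNIV) undefined)" for i
  have r [measurable]: "\<And>i. i \<in> I \<Longrightarrow> r i \<in> measurable M (S i)"
    using ind by (auto simp: indep_vars_def)
  have prob: "prob_space (\<mu> i)" for i
    by (auto simp: \<mu>_def intro!: prob_space_distr prob_space_return)
  have rr [measurable]: "(\<lambda>\<omega>. \<lambda>i\<in>I. r i \<omega>) \<in> measurable M (PiM I S)"
    by measurable
  have sets: "sets (PiM I \<mu>) = sets (PiM I S)"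
    by (intro sets_PiM_cong) (auto simp: \<mu>_def)
  then have sp: "space (PiM I \<mu>) = space (PiM I S)"
    by (rule sets_eq_imp_space_eq)
  have eq: "distr M (PiM I S) (\<lambda>\<omega>. \<lambda>i\<in>I. r i \<omega>) = PiM I \<mu>"
    using indep_vars_iff_distr_eq_PiM'[OF I(2) r] ind
    by (auto simp: \<mu>_def intro!: PiM_cong)
  have E: "expectation (\<lambda>\<omega>. F (\<lambda>i\<in>I. r i \<omega>)) = (\<integral>x. F x \<partial>PiM I \<mu>)"
    unfolding eq[symmetric] by (rule integral_distr[symmetric, OF rr F])
  have rsp: "(\<lambda>i\<in>I. r i \<omega>) \<in> space (PiM I S)" if "\<omega> \<in> space M" for \<omega>
    using measurable_space[OF rr that] .
  have intF: "integrable M (\<lambda>\<omega>. F (\<lambda>i\<in>I. r i \<omega>))"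
    using bd rsp by (intro integrable_const_bound[of _ B] AE_I2) auto
  have h [measurable]: "h \<in> borel_measurable M"
    unfolding h_def by measurable
  have hb: "h \<omega> \<le> B - expectation (\<lambda>\<omega>. F (\<lambda>i\<in>I. r i \<omega>))" if "\<omega> \<in> space M" for \<omega>
    using bd[OF rsp[OF that]] by (auto simp: h_def)
  show int: "integrable M (\<lambda>\<omega>. exp (s * h \<omega>))"
    using s hb
    by (intro integrable_const_bound[of _ "exp (s * (B - expectation (\<lambda>\<omega>. F (\<lambda>i\<in>I. r i \<omega>))))"] AE_I2)
      auto
  have "ennreal (expectation (\<lambda>\<omega>. exp (s * h \<omega>))) = (\<integral>\<^sup>+\<omega>. ennreal (exp (s * h \<omega>)) \<partial>M)"
    using int by (subst nn_integral_eq_integral) auto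
  also have "\<dots> = (\<integral>\<^sup>+x. ennreal (exp (s * (F x - (\<integral>x. F x \<partial>PiM I \<mu>)))) \<partial>PiM I \<mu>)"
    unfolding h_def E by (subst (2) eq[symmetric], subst nn_integral_distr[OF rr]) auto
  also have "\<dots> \<le> ennreal (exp (s\<^sup>2 * c\<^sup>2 / 2 * card I))"
  proof (rule bounded_differences_mgf_PiM[OF I(1) prob s])
    show "F \<in> borel_measurable (PiM I \<mu>)"
      using F by (simp add: measurable_cong_sets[OF sets])
    show "\<bar>F x\<bar> \<le> B" if "x \<in> space (PiM I \<mu>)" for x
      using bd that by (simp only: sp)
    show "\<bar>F (x(i := y)) - F x\<bar> \<le> c"
      if "x \<in> space (PiM I \<mu>)" "i \<in> I" "y \<in> space (\<mu> i)" for x i y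
      using that by (intro diff) (auto simp only: sp \<mu>_def space_distr if_True)
  qed
  finally show "expectation (\<lambda>\<omega>. exp (s * h \<omega>)) \<le> exp (s\<^sup>2 * c\<^sup>2 / 2 * card I)"
    by simp
qed

text \<open>The parameter \<open>s\<close> stays free because the two conclusions want different
  choices: of order 1 over the square root of the number of coordinates for the mean deviation, and
  proportional to the deviation rate for the tail.\<close>

lemma bounded_differences:
  fixes F :: "('i \<Rightarrow> 'b) \<Rightarrow> real"
  assumes I: "finite I" "I \<noteq> {}" and ind: "indep_vars S r I" and s: "s > 0"
    and F: "F \<in> borel_measurable (PiM I S)"
    and bd: "\<And>x. x \<in> space (PiM I S) \<Longrightarrow> \<bar>F x\<bar> \<le> B"
    and diff: "\<And>x i y. x \<in> space (PiM I S) \<Longrightarrow> i \<in> I \<Longrightarrow> y \<in> space (S i) \<Longrightarrow> \<bar>F (x(i := y)) - F x\<bar> \<le> c"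
  defines "h \<equiv> \<lambda>\<omega>. F (\<lambda>i\<in>I. r i \<omega>) - expectation (\<lambda>\<omega>. F (\<lambda>i\<in>I. r i \<omega>))"
  shows bounded_differences_abs_deviation:
      "expectation (\<lambda>\<omega>. \<bar>h \<omega>\<bar>) \<le> 2 / s * exp (s\<^sup>2 * c\<^sup>2 / 2 * card I)"
    and bounded_differences_tail:
      "measure M {\<omega> \<in> space M. \<bar>h \<omega>\<bar> \<ge> t} \<le> 2 * exp (s\<^sup>2 * c\<^sup>2 / 2 * card I - s * t)"
proof -
  define K where "K = exp (s\<^sup>2 * c\<^sup>2 / 2 * card I)"
  have r [measurable]: "\<And>i. i \<in> I \<Longrightarrow> r i \<in> measurable M (S i)"
    using ind by (auto simp: indep_vars_def)
  have rr: "(\<lambda>\<omega>. \<lambda>i\<in>I. r i \<omega>) \<in> measurable M (PiM I S)"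
    by measurable
  have h [measurable]: "h \<in> borel_measurable M"
    unfolding h_def using measurable_compose[OF rr F] by simp
  have int1: "integrable M (\<lambda>\<omega>. exp (s * h \<omega>))" and le1: "expectation (\<lambda>\<omega>. exp (s * h \<omega>)) \<le> K"
    using bounded_differences_mgf[OF I ind s F bd diff] unfolding h_def K_def by blast+
  have neg: "(\<lambda>x. - F x) \<in> borel_measurable (PiM I S)" using F by simp
  have "- F x - - F y = F y - F x" for x y by simp
  then have int2: "integrable M (\<lambda>\<omega>. exp (s * - h \<omega>))" and le2: "expectation (\<lambda>\<omega>. exp (s * - h \<omega>)) \<le> K"
    using bounded_differences_mgf[OF I ind s neg, of B c] bd diff
    by (simp_all add: h_def K_def abs_minus_commute)
  \<comment> \<open>A single variable dominating \<open>exp (s * |h|)\<close>: the first conclusion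
    uses \<open>s * |h| <= exp (s * |h|)\<close>, the second Markov's inequality.\<close>
  define u where "u \<omega> = exp (s * h \<omega>) + exp (s * - h \<omega>)" for \<omega>
  have intu: "integrable M u" and Eu: "expectation u \<le> 2 * K"
    unfolding u_def using int1 int2 le1 le2 by simp_all
  have u_nonneg: "0 \<le> u \<omega>" for \<omega>
    by (simp add: u_def add_nonneg_nonneg)
  have exp_ge: "exp (s * \<bar>x\<bar>) \<le> exp (s * x) + exp (s * - x)" for x :: real
    by (cases "x \<ge> 0") (auto simp: add_increasing add_increasing2)
  have "\<bar>h \<omega>\<bar> \<le> u \<omega> / s" for \<omega>
  proof -
    have "s * \<bar>h \<omega>\<bar> \<le> exp (s * \<bar>h \<omega>\<bar>)"
      using exp_ge_add_one_self[of "s * \<bar>h \<omega>\<bar>"] by linarith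
    then have "s * \<bar>h \<omega>\<bar> \<le> u \<omega>" using exp_ge[of "h \<omega>"] by (simp add: u_def)
    then show ?thesis using s by (simp add: field_simps)
  qed
  then have "expectation (\<lambda>\<omega>. \<bar>h \<omega>\<bar>) \<le> expectation (\<lambda>\<omega>. u \<omega> / s)"
    using intu by (intro integral_mono_AE' AE_I2) (auto simp: u_nonneg intro!: divide_nonneg_pos s)
  also have "\<dots> \<le> 2 / s * K"
    using Eu s by (simp add: field_simps)
  finally show "expectation (\<lambda>\<omega>. \<bar>h \<omega>\<bar>) \<le> 2 / s * exp (s\<^sup>2 * c\<^sup>2 / 2 * card I)"
    by (simp add: K_def)
  have "{\<omega> \<in> space M. \<bar>h \<omega>\<bar> \<ge> t} \<subseteq> {\<omega> \<in> space M. u \<omega> \<ge> exp (s * t)}"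
  proof safe
    fix \<omega> assume "t \<le> \<bar>h \<omega>\<bar>"
    then have "exp (s * t) \<le> exp (s * \<bar>h \<omega>\<bar>)" using s by simp
    then show "exp (s * t) \<le> u \<omega>"
      unfolding u_def using exp_ge[of "h \<omega>"] by (rule order.trans)
  qed
  then have "measure M {\<omega> \<in> space M. \<bar>h \<omega>\<bar> \<ge> t} \<le> measure M {\<omega> \<in> space M. u \<omega> \<ge> exp (s * t)}"
    using intu by (intro finite_measure_mono) auto
  also have "\<dots> \<le> expectation u / exp (s * t)"
    using intu unfolding u_def by (intro integral_Markov_inequality_measure[where A = "{}"] AE_I2)
      (auto simp: u_def intro!: add_nonneg_nonneg)
  also have "\<dots> \<le> 2 * K / exp (s * t)"
    using Eu by (intro divide_right_mono) auto
  also have "\<dots> = 2 * exp (s\<^sup>2 * c\<^sup>2 / 2 * card I - s * t)"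
    by (simp add: K_def exp_diff)
  finally show "measure M {\<omega> \<in> space M. \<bar>h \<omega>\<bar> \<ge> t} \<le> 2 * exp (s\<^sup>2 * c\<^sup>2 / 2 * card I - s * t)" .
qed

end

section \<open>Quadratic forms in independent variables\<close>

context prob_space
begin

lemma expectation_mult_indep_restrict:
  fixes X :: "'i \<Rightarrow> 'a \<Rightarrow> real" and f g :: "('i \<Rightarrow> real) \<Rightarrow> real"
  assumes ind: "indep_vars (\<lambda>_. borel) X I" and AB: "A \<inter> B = {}" "A \<subseteq> I" "B \<subseteq> I"
    and f: "f \<in> borel_measurable (PiM A (\<lambda>_. borel))" and g: "g \<in> borel_measurable (PiM B (\<lambda>_. borel))"
    and intf: "integrable M (\<lambda>\<omega>. f (\<lambda>i\<in>A. X i \<omega>))" and intg: "integrable M (\<lambda>\<omega>. g (\<lambda>i\<in>B. X i \<omega>))"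
  shows "integrable M (\<lambda>\<omega>. f (\<lambda>i\<in>A. X i \<omega>) * g (\<lambda>i\<in>B. X i \<omega>))"
    and "expectation (\<lambda>\<omega>. f (\<lambda>i\<in>A. X i \<omega>) * g (\<lambda>i\<in>B. X i \<omega>))
      = expectation (\<lambda>\<omega>. f (\<lambda>i\<in>A. X i \<omega>)) * expectation (\<lambda>\<omega>. g (\<lambda>i\<in>B. X i \<omega>))"
proof -
  have "indep_var borel (\<lambda>\<omega>. f (\<lambda>i\<in>A. X i \<omega>)) borel (\<lambda>\<omega>. g (\<lambda>i\<in>B. X i \<omega>))"
    using indep_var_compose[OF indep_var_restrict[OF ind AB] f g] by (simp add: comp_def)
  then show "integrable M (\<lambda>\<omega>. f (\<lambda>i\<in>A. X i \<omega>) * g (\<lambda>i\<in>B. X i \<omega>))"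
    "expectation (\<lambda>\<omega>. f (\<lambda>i\<in>A. X i \<omega>) * g (\<lambda>i\<in>B. X i \<omega>))
      = expectation (\<lambda>\<omega>. f (\<lambda>i\<in>A. X i \<omega>)) * expectation (\<lambda>\<omega>. g (\<lambda>i\<in>B. X i \<omega>))"
    using indep_var_integrable[OF _ intf intg] indep_var_lebesgue_integral[OF _ intf intg] by blast+
qed

lemma integrable_fourth_powerD:
  fixes x :: "'a \<Rightarrow> real"
  assumes x [measurable]: "x \<in> borel_measurable M" and 4: "integrable M (\<lambda>\<omega>. (x \<omega>) ^ 4)"
  shows "integrable M x" and "integrable M (\<lambda>\<omega>. (x \<omega>)\<^sup>2)"
proof -
  have le2: "y\<^sup>2 \<le> 1 + y ^ 4" for y :: real
  proof -
    have "0 \<le> (y\<^sup>2 - 1)\<^sup>2" by simp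
    also have "\<dots> = y ^ 4 - 2 * y\<^sup>2 + 1" by (simp add: power2_diff flip: power_mult)
    finally show ?thesis using zero_le_power2[of y] by linarith
  qed
  show i2: "integrable M (\<lambda>\<omega>. (x \<omega>)\<^sup>2)"
  proof (rule Bochner_Integration.integrable_bound[of M "\<lambda>\<omega>. 1 + (x \<omega>) ^ 4"])
    show "AE \<omega> in M. norm ((x \<omega>)\<^sup>2) \<le> norm (1 + (x \<omega>) ^ 4)"
      using le2 by (intro AE_I2) (simp add: abs_of_nonneg)
  qed (use 4 in auto)
  show "integrable M x"
    using square_integrable_imp_integrable[OF x i2] .
qed


lemma expectation_linear_combination_sq:
  fixes x :: "nat \<Rightarrow> 'a \<Rightarrow> real" and a :: "nat \<Rightarrow> real"
  assumes ind: "indep_vars (\<lambda>_. borel) x {..<P}"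
    and mean: "\<And>j. j < P \<Longrightarrow> expectation (x j) = 0"
    and int1: "\<And>j. j < P \<Longrightarrow> integrable M (x j)"
    and int2: "\<And>j. j < P \<Longrightarrow> integrable M (\<lambda>\<omega>. (x j \<omega>)\<^sup>2)"
  shows "integrable M (\<lambda>\<omega>. (\<Sum>j<P. a j * x j \<omega>)\<^sup>2)"
    and "expectation (\<lambda>\<omega>. (\<Sum>j<P. a j * x j \<omega>)\<^sup>2) = (\<Sum>j<P. (a j)\<^sup>2 * expectation (\<lambda>\<omega>. (x j \<omega>)\<^sup>2))"
proof -
  have prod: "integrable M (\<lambda>\<omega>. x j \<omega> * x k \<omega>)"
    "expectation (\<lambda>\<omega>. x j \<omega> * x k \<omega>) = (if j = k then expectation (\<lambda>\<omega>. (x j \<omega>)\<^sup>2) else 0)"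
    if jk: "j < P" "k < P" for j k
  proof -
    have "integrable M (\<lambda>\<omega>. x j \<omega> * x k \<omega>) \<and>
      expectation (\<lambda>\<omega>. x j \<omega> * x k \<omega>) = (if j = k then expectation (\<lambda>\<omega>. (x j \<omega>)\<^sup>2) else 0)"
    proof (cases "j = k")
      case True
      then show ?thesis using int2[OF jk(1)] by (simp add: power2_eq_square)
    next
      case False
      have "indep_var borel (x j) borel (x k)"
      proof -
        have "indep_var borel ((\<lambda>z. z j) \<circ> (\<lambda>\<omega>. \<lambda>i\<in>{j}. x i \<omega>)) borel ((\<lambda>z. z k) \<circ> (\<lambda>\<omega>. \<lambda>i\<in>{k}. x i \<omega>))"
          using jk False by (intro indep_var_compose[OF indep_var_restrict[OF ind]]) auto
        then show ?thesis by (simp add: comp_def)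
      qed
      then show ?thesis
        using indep_var_integrable[OF _ int1[OF jk(1)] int1[OF jk(2)]]
          indep_var_lebesgue_integral[OF _ int1[OF jk(1)] int1[OF jk(2)]] False jk mean by simp
    qed
    then show "integrable M (\<lambda>\<omega>. x j \<omega> * x k \<omega>)"
      "expectation (\<lambda>\<omega>. x j \<omega> * x k \<omega>) = (if j = k then expectation (\<lambda>\<omega>. (x j \<omega>)\<^sup>2) else 0)"
      by blast+
  qed
  have eq: "(\<Sum>j<P. a j * x j \<omega>)\<^sup>2 = (\<Sum>j<P. \<Sum>k<P. a j * a k * (x j \<omega> * x k \<omega>))" for \<omega>
    by (simp add: power2_eq_square sum_product algebra_simps)
  show "integrable M (\<lambda>\<omega>. (\<Sum>j<P. a j * x j \<omega>)\<^sup>2)"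
    unfolding eq using prod by (intro Bochner_Integration.integrable_sum integrable_mult_right) auto
  have "expectation (\<lambda>\<omega>. (\<Sum>j<P. a j * x j \<omega>)\<^sup>2)
      = (\<Sum>j<P. \<Sum>k<P. a j * a k * expectation (\<lambda>\<omega>. x j \<omega> * x k \<omega>))"
    unfolding eq using prod
    by (subst Bochner_Integration.integral_sum, fastforce intro!: Bochner_Integration.integrable_sum integrable_mult_right)
      (auto intro!: sum.cong simp: Bochner_Integration.integral_sum)
  also have "\<dots> = (\<Sum>j<P. \<Sum>k<P. if j = k then (a j)\<^sup>2 * expectation (\<lambda>\<omega>. (x j \<omega>)\<^sup>2) else 0)"
    by (intro sum.cong refl) (simp add: prod(2) power2_eq_square[of "a _"])
  finally show "expectation (\<lambda>\<omega>. (\<Sum>j<P. a j * x j \<omega>)\<^sup>2) = (\<Sum>j<P. (a j)\<^sup>2 * expectation (\<lambda>\<omega>. (x j \<omega>)\<^sup>2))"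
    by simp
qed

lemma integrable_mult_square_integrable:
  fixes f g :: "'a \<Rightarrow> real"
  assumes [measurable]: "f \<in> borel_measurable M" "g \<in> borel_measurable M"
    and f: "integrable M (\<lambda>\<omega>. (f \<omega>)\<^sup>2)" and g: "integrable M (\<lambda>\<omega>. (g \<omega>)\<^sup>2)"
  shows "integrable M (\<lambda>\<omega>. f \<omega> * g \<omega>)"
proof (rule Bochner_Integration.integrable_bound[of M "\<lambda>\<omega>. (f \<omega>)\<^sup>2 + (g \<omega>)\<^sup>2"])
  have "\<bar>a * b\<bar> \<le> a\<^sup>2 + b\<^sup>2" for a b :: real
  proof -
    have "2 * (\<bar>a\<bar> * \<bar>b\<bar>) \<le> a\<^sup>2 + b\<^sup>2" "0 \<le> \<bar>a\<bar> * \<bar>b\<bar>"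
      using sum_squares_bound[of "\<bar>a\<bar>" "\<bar>b\<bar>"] by simp_all
    then show ?thesis unfolding abs_mult by linarith
  qed
  then show "AE \<omega> in M. norm (f \<omega> * g \<omega>) \<le> norm ((f \<omega>)\<^sup>2 + (g \<omega>)\<^sup>2)"
    by (simp add: abs_mult)
qed (use f g in auto)

text \<open>Intended for a frozen resolvent \<open>q\<close>, whose squared Frobenius norm is at
  most \<open>P / l^2\<close>. In the constant, \<open>2 * \<kappa>\<close> comes from the diagonal
  and \<open>8 * b^2\<close> from the off-diagonal part of an increment. The size \<open>m\<close>
  varies for the induction only.\<close>

lemma quadratic_form_second_moment:
  fixes x :: "nat \<Rightarrow> 'a \<Rightarrow> real" and q :: "nat \<Rightarrow> nat \<Rightarrow> real" and v :: "nat \<Rightarrow> real"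
  assumes ind: "indep_vars (\<lambda>_. borel) x {..<P}"
    and mean: "\<And>j. j < P \<Longrightarrow> expectation (x j) = 0"
    and var: "\<And>j. j < P \<Longrightarrow> expectation (\<lambda>\<omega>. (x j \<omega>)\<^sup>2) = v j"
    and b: "\<And>j. j < P \<Longrightarrow> v j \<le> b"
    and int4: "\<And>j. j < P \<Longrightarrow> integrable M (\<lambda>\<omega>. (x j \<omega>) ^ 4)"
    and kappa: "\<And>j. j < P \<Longrightarrow> expectation (\<lambda>\<omega>. (x j \<omega>) ^ 4) \<le> \<kappa>"
    and sym: "\<And>j k. j < P \<Longrightarrow> k < P \<Longrightarrow> q j k = q k j"
  defines "W \<equiv> \<lambda>m \<omega>. (\<Sum>j<m. \<Sum>k<m. q j k * x j \<omega> * x k \<omega>) - (\<Sum>j<m. q j j * v j)"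
  assumes m: "m \<le> P"
  shows "integrable M (\<lambda>\<omega>. (W m \<omega>)\<^sup>2) \<and>
    expectation (\<lambda>\<omega>. (W m \<omega>)\<^sup>2) \<le> (2 * \<kappa> + 8 * b\<^sup>2) * (\<Sum>j<m. \<Sum>k<m. (q j k)\<^sup>2)"
  using m
  \<comment> \<open>The increments \<open>W (Suc m) - W m\<close> are martingale differences, so second moments add up.\<close>
proof (induction m)
  case 0
  show ?case by (simp add: W_def)
next
  case (Suc m)
  then have m: "m < P" and IHi: "integrable M (\<lambda>\<omega>. (W m \<omega>)\<^sup>2)"
    and IH: "expectation (\<lambda>\<omega>. (W m \<omega>)\<^sup>2) \<le> (2 * \<kappa> + 8 * b\<^sup>2) * (\<Sum>j<m. \<Sum>k<m. (q j k)\<^sup>2)"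
    by auto
  have [measurable]: "x j \<in> borel_measurable M" if "j < P" for j
    using ind that by (auto simp: indep_vars_def)
  have xm [measurable]: "x m \<in> borel_measurable M" using m by simp
  have x2: "integrable M (\<lambda>\<omega>. (x j \<omega>)\<^sup>2)" and x1: "integrable M (x j)" if "j < P" for j
    using integrable_fourth_powerD[OF _ int4[OF that]] that by auto
  have vnn: "0 \<le> v j" if "j < P" for j
    unfolding var[OF that, symmetric] by simp
  \<comment> \<open>The coefficient of the new variable in row \<open>m\<close>; by symmetry column
    \<open>m\<close> contributes the same, hence the factor 2 in \<open>d\<close>.\<close>
  define L where "L \<omega> = (\<Sum>k<m. q m k * x k \<omega>)" for \<omega>
  define d where "d \<omega> = q m m * ((x m \<omega>)\<^sup>2 - v m) + 2 * (L \<omega> * x m \<omega>)" for \<omega>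
  have W_Suc: "W (Suc m) \<omega> = W m \<omega> + d \<omega>" for \<omega>
  proof -
    have "(\<Sum>j<m. q j m * x j \<omega> * x m \<omega>) = L \<omega> * x m \<omega>"
      unfolding L_def sum_distrib_right using m sym by (intro sum.cong) auto
    moreover have "(\<Sum>k<m. q m k * x m \<omega> * x k \<omega>) = L \<omega> * x m \<omega>"
      unfolding L_def sum_distrib_right by (intro sum.cong) auto
    ultimately show ?thesis
      by (simp add: W_def d_def sum.distrib algebra_simps power2_eq_square)
  qed
  have indm: "indep_vars (\<lambda>_. borel) x {..<m}"
    using m by (intro indep_vars_subset[OF ind]) auto
  have L2: "integrable M (\<lambda>\<omega>. (L \<omega>)\<^sup>2)"
    and EL2: "expectation (\<lambda>\<omega>. (L \<omega>)\<^sup>2) = (\<Sum>k<m. (q m k)\<^sup>2 * v k)"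
    unfolding L_def using expectation_linear_combination_sq[OF indm mean x1 x2, of "q m"] m var by auto
  have L_meas [measurable]: "L \<in> borel_measurable M" and W_meas [measurable]: "W m \<in> borel_measurable M"
    unfolding L_def W_def using m by auto
  have W1: "integrable M (W m)"
    by (rule square_integrable_imp_integrable[OF W_meas IHi])
  have WL: "integrable M (\<lambda>\<omega>. W m \<omega> * L \<omega>)"
    by (rule integrable_mult_square_integrable[OF W_meas L_meas IHi L2])
  let ?A = "{..<m}" and ?B = "{m}"
  \<comment> \<open>\<open>W m\<close> and \<open>L\<close> are rewritten as functions of the first
    \<open>m\<close> coordinates, so that their independence from \<open>x m\<close> can be
    applied.\<close>
  define Wf where "Wf z = (\<Sum>j<m. \<Sum>k<m. q j k * z j * z k) - (\<Sum>j<m. q j j * v j)" for z :: "nat \<Rightarrow> real"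
  define Lf where "Lf z = (\<Sum>k<m. q m k * z k)" for z :: "nat \<Rightarrow> real"
  have comp: "(\<lambda>z. z j) \<in> borel_measurable (PiM {..<m} (\<lambda>_. borel :: real measure))" if "j < m" for j
    using that by (intro measurable_component_singleton) auto
  have Wf [measurable]: "Wf \<in> borel_measurable (PiM ?A (\<lambda>_. borel))"
    and Lf [measurable]: "Lf \<in> borel_measurable (PiM ?A (\<lambda>_. borel))"
    unfolding Wf_def Lf_def using comp
    by (auto intro!: borel_measurable_diff borel_measurable_sum borel_measurable_times)
  have zm [measurable]: "(\<lambda>z. z m) \<in> borel_measurable (PiM ?B (\<lambda>_. borel :: real measure))"
    by (intro measurable_component_singleton) auto
  have WfA: "Wf (\<lambda>i\<in>?A. x i \<omega>) = W m \<omega>" and LfA: "Lf (\<lambda>i\<in>?A. x i \<omega>) = L \<omega>" for \<omega>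
    unfolding Wf_def W_def Lf_def L_def by (auto intro!: sum.cong arg_cong2[where f = "(-)"])
  have xB: "(\<lambda>i\<in>?B. x i \<omega>) m = x m \<omega>" for \<omega> by simp
  note ind' = expectation_mult_indep_restrict[OF ind, of ?A ?B]
  have AB: "?A \<inter> ?B = {}" "?A \<subseteq> {..<P}" "?B \<subseteq> {..<P}" using m by auto
  have iW: "integrable M (\<lambda>\<omega>. Wf (\<lambda>i\<in>?A. x i \<omega>))" and iWL: "integrable M (\<lambda>\<omega>. Wf (\<lambda>i\<in>?A. x i \<omega>) * Lf (\<lambda>i\<in>?A. x i \<omega>))"
    and iL2: "integrable M (\<lambda>\<omega>. (Lf (\<lambda>i\<in>?A. x i \<omega>))\<^sup>2)"
    unfolding WfA LfA by (fact W1 WL L2)+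
  have ix: "integrable M (\<lambda>\<omega>. (\<lambda>i\<in>?B. x i \<omega>) m)" and ix2: "integrable M (\<lambda>\<omega>. ((\<lambda>i\<in>?B. x i \<omega>) m)\<^sup>2)"
    and ix2v: "integrable M (\<lambda>\<omega>. ((\<lambda>i\<in>?B. x i \<omega>) m)\<^sup>2 - v m)"
    unfolding xB using x1[OF m] x2[OF m] by auto
  have WLf: "(\<lambda>z. Wf z * Lf z) \<in> borel_measurable (PiM ?A (\<lambda>_. borel))"
    and Lf2: "(\<lambda>z. (Lf z)\<^sup>2) \<in> borel_measurable (PiM ?A (\<lambda>_. borel))"
    and zm2: "(\<lambda>z. (z m)\<^sup>2) \<in> borel_measurable (PiM ?B (\<lambda>_. borel :: real measure))"
    and zm2v: "(\<lambda>z. (z m)\<^sup>2 - v m) \<in> borel_measurable (PiM ?B (\<lambda>_. borel :: real measure))"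
    using Wf Lf zm by (auto intro: borel_measurable_times borel_measurable_power borel_measurable_diff)
  have "expectation (\<lambda>\<omega>. (x m \<omega>)\<^sup>2 - v m) = 0"
    using x2[OF m] var[OF m] by (simp add: prob_space)
  then have c1: "integrable M (\<lambda>\<omega>. W m \<omega> * ((x m \<omega>)\<^sup>2 - v m))"
    "expectation (\<lambda>\<omega>. W m \<omega> * ((x m \<omega>)\<^sup>2 - v m)) = 0"
    using ind'[OF AB Wf zm2v iW ix2v] unfolding WfA xB by auto
  have c2: "integrable M (\<lambda>\<omega>. W m \<omega> * L \<omega> * x m \<omega>)" "expectation (\<lambda>\<omega>. W m \<omega> * L \<omega> * x m \<omega>) = 0"
    using ind'[OF AB WLf zm iWL ix] mean[OF m] unfolding WfA LfA xB by auto
  have c3: "integrable M (\<lambda>\<omega>. (L \<omega>)\<^sup>2 * (x m \<omega>)\<^sup>2)"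
    "expectation (\<lambda>\<omega>. (L \<omega>)\<^sup>2 * (x m \<omega>)\<^sup>2) = (\<Sum>k<m. (q m k)\<^sup>2 * v k) * v m"
    using ind'[OF AB Lf2 zm2 iL2 ix2] var[OF m] EL2 unfolding LfA xB by auto
  have s2: "((x m \<omega>)\<^sup>2 - v m)\<^sup>2 = (x m \<omega>) ^ 4 - 2 * v m * (x m \<omega>)\<^sup>2 + (v m)\<^sup>2" for \<omega>
    by (simp add: power2_diff flip: power_mult)
  have c4: "integrable M (\<lambda>\<omega>. ((x m \<omega>)\<^sup>2 - v m)\<^sup>2)"
    "expectation (\<lambda>\<omega>. ((x m \<omega>)\<^sup>2 - v m)\<^sup>2) \<le> \<kappa>"
  proof -
    show "integrable M (\<lambda>\<omega>. ((x m \<omega>)\<^sup>2 - v m)\<^sup>2)"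
      unfolding s2 using int4[OF m] x2[OF m] by auto
    have "expectation (\<lambda>\<omega>. ((x m \<omega>)\<^sup>2 - v m)\<^sup>2) = expectation (\<lambda>\<omega>. (x m \<omega>) ^ 4) - (v m)\<^sup>2"
      unfolding s2 using int4[OF m] x2[OF m] var[OF m] by (simp add: prob_space power2_eq_square)
    then show "expectation (\<lambda>\<omega>. ((x m \<omega>)\<^sup>2 - v m)\<^sup>2) \<le> \<kappa>"
      using kappa[OF m] zero_le_power2[of "v m"] by linarith
  qed
  define D where "D \<omega> = 2 * (q m m)\<^sup>2 * ((x m \<omega>)\<^sup>2 - v m)\<^sup>2 + 8 * ((L \<omega>)\<^sup>2 * (x m \<omega>)\<^sup>2)" for \<omega>
  have intD: "integrable M D"
    unfolding D_def using c3 c4 by auto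
  have dD: "(d \<omega>)\<^sup>2 \<le> D \<omega>" for \<omega>
  proof -
    have "(r + 2 * t)\<^sup>2 \<le> 2 * r\<^sup>2 + 8 * t\<^sup>2" for r t :: real
      using zero_le_power2[of "r - 2 * t"] by (simp add: power2_eq_square algebra_simps)
    from this[of "q m m * ((x m \<omega>)\<^sup>2 - v m)" "L \<omega> * x m \<omega>"] show ?thesis
      by (simp add: d_def D_def power_mult_distrib mult.assoc)
  qed
  have [measurable]: "d \<in> borel_measurable M" unfolding d_def by measurable
  have d2: "integrable M (\<lambda>\<omega>. (d \<omega>)\<^sup>2)"
    by (intro Bochner_Integration.integrable_bound[OF intD] AE_I2) (auto intro: order.trans[OF dD])
  have nonneg: "0 \<le> (\<Sum>k<m. (q m k)\<^sup>2)" by (intro sum_nonneg) auto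
  have "0 \<le> expectation (\<lambda>\<omega>. (x m \<omega>) ^ 4)" by (intro integral_nonneg_AE AE_I2) auto
  then have k0: "0 \<le> \<kappa>" using kappa[OF m] by linarith
  have b0: "0 \<le> b" using vnn[OF m] b[OF m] by linarith
  have "expectation (\<lambda>\<omega>. (d \<omega>)\<^sup>2) \<le> expectation D"
    using d2 intD dD by (intro integral_mono) auto
  also have "\<dots> \<le> 2 * (q m m)\<^sup>2 * \<kappa> + 8 * ((\<Sum>k<m. (q m k)\<^sup>2 * v k) * v m)"
    unfolding D_def using c3 c4 by (auto intro!: mult_left_mono)
  also have "\<dots> \<le> 2 * (q m m)\<^sup>2 * \<kappa> + 8 * ((\<Sum>k<m. (q m k)\<^sup>2 * b) * b)"
    using b vnn m b0 by (intro add_left_mono mult_left_mono mult_mono sum_mono sum_nonneg) auto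
  also have "2 * (q m m)\<^sup>2 * \<kappa> + 8 * ((\<Sum>k<m. (q m k)\<^sup>2 * b) * b)
    = 2 * \<kappa> * (q m m)\<^sup>2 + 8 * b\<^sup>2 * (\<Sum>k<m. (q m k)\<^sup>2)"
    by (simp add: sum_distrib_right[symmetric] power2_eq_square)
  \<comment> \<open>Padding by nonnegative terms: the bracket is now exactly the growth of the
    double sum from \<open>m\<close> to \<open>Suc m\<close>.\<close>
  also have "\<dots> \<le> (2 * \<kappa> + 8 * b\<^sup>2) * ((q m m)\<^sup>2 + 2 * (\<Sum>k<m. (q m k)\<^sup>2))"
  proof -
    have "0 \<le> 8 * b\<^sup>2 * (q m m)\<^sup>2" "0 \<le> 4 * \<kappa> * (\<Sum>k<m. (q m k)\<^sup>2)" "0 \<le> 8 * b\<^sup>2 * (\<Sum>k<m. (q m k)\<^sup>2)"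
      using k0 nonneg by auto
    then show ?thesis by (simp add: algebra_simps)
  qed
  finally have d2le: "expectation (\<lambda>\<omega>. (d \<omega>)\<^sup>2) \<le> (2 * \<kappa> + 8 * b\<^sup>2) * ((q m m)\<^sup>2 + 2 * (\<Sum>k<m. (q m k)\<^sup>2))" .
  have Wd: "integrable M (\<lambda>\<omega>. W m \<omega> * d \<omega>)" "expectation (\<lambda>\<omega>. W m \<omega> * d \<omega>) = 0"
  proof -
    have eq: "W m \<omega> * d \<omega> = q m m * (W m \<omega> * ((x m \<omega>)\<^sup>2 - v m)) + 2 * (W m \<omega> * L \<omega> * x m \<omega>)" for \<omega>
      by (simp add: d_def algebra_simps)
    show "integrable M (\<lambda>\<omega>. W m \<omega> * d \<omega>)"
      unfolding eq using c1(1) c2(1) by auto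
    show "expectation (\<lambda>\<omega>. W m \<omega> * d \<omega>) = 0"
      unfolding eq by (subst Bochner_Integration.integral_add) (use c1 c2 in auto)
  qed
  have sq: "(W (Suc m) \<omega>)\<^sup>2 = (W m \<omega>)\<^sup>2 + (2 * (W m \<omega> * d \<omega>) + (d \<omega>)\<^sup>2)" for \<omega>
    by (simp add: W_Suc power2_sum)
  have sum_eq: "(\<Sum>j<Suc m. \<Sum>k<Suc m. (q j k)\<^sup>2)
    = (\<Sum>j<m. \<Sum>k<m. (q j k)\<^sup>2) + ((q m m)\<^sup>2 + 2 * (\<Sum>k<m. (q m k)\<^sup>2))"
  proof -
    have "(\<Sum>j<m. (q j m)\<^sup>2) = (\<Sum>k<m. (q m k)\<^sup>2)"
      using m sym by (intro sum.cong) auto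
    then show ?thesis by (simp add: sum.distrib)
  qed
  show ?case
  proof
    show "integrable M (\<lambda>\<omega>. (W (Suc m) \<omega>)\<^sup>2)"
      unfolding sq using IHi Wd(1) d2 by auto
    have "expectation (\<lambda>\<omega>. (W (Suc m) \<omega>)\<^sup>2) = expectation (\<lambda>\<omega>. (W m \<omega>)\<^sup>2) + expectation (\<lambda>\<omega>. (d \<omega>)\<^sup>2)"
      unfolding sq using IHi Wd d2 by simp
    also have "\<dots> \<le> (2 * \<kappa> + 8 * b\<^sup>2) * (\<Sum>j<Suc m. \<Sum>k<Suc m. (q j k)\<^sup>2)"
      unfolding sum_eq distrib_left[of "2 * \<kappa> + 8 * b\<^sup>2" "\<Sum>j<m. \<Sum>k<m. (q j k)\<^sup>2"] using IH d2le by linarith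
    finally show "expectation (\<lambda>\<omega>. (W (Suc m) \<omega>)\<^sup>2) \<le> (2 * \<kappa> + 8 * b\<^sup>2) * (\<Sum>j<Suc m. \<Sum>k<Suc m. (q j k)\<^sup>2)" .
  qed
qed

end

section \<open>Stability of the canonical equations\<close>

text \<open>The Thompson metric is what makes the system contractive without any smallness condition:
  \<open>R\<close> below is the largest ratio of corresponding entries, and each step of the system maps a ratio
  \<open>R\<close> to at most \<open>R (1 + U) / (R + U)\<close>.\<close>

lemma fixed_point_stability:
  fixes w :: "'i \<Rightarrow> 'i \<Rightarrow> real" and x y :: "'i \<Rightarrow> real"
  assumes fin: "finite I" and l: "l > 0"
    and w: "\<And>k m. k \<in> I \<Longrightarrow> m \<in> I \<Longrightarrow> 0 \<le> w k m" "\<And>k. k \<in> I \<Longrightarrow> (\<Sum>m\<in>I. w k m) \<le> C"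
    and x: "\<And>k. k \<in> I \<Longrightarrow> 0 \<le> x k" "\<And>k. k \<in> I \<Longrightarrow> x k \<le> 1 / l"
    and y: "\<And>k. k \<in> I \<Longrightarrow> 0 \<le> y k" "\<And>k. k \<in> I \<Longrightarrow> y k \<le> 1 / l"
    and y_eq: "\<And>k. k \<in> I \<Longrightarrow> y k = 1 / (l * (1 + (\<Sum>m\<in>I. w k m * y m)))"
    and x_eq: "\<And>k. k \<in> I \<Longrightarrow> \<bar>x k - 1 / (l * (1 + (\<Sum>m\<in>I. w k m * x m)))\<bar> \<le> \<eta>"
    and e: "\<eta> * (l + C) \<le> 1 / 2"
    and k: "k \<in> I"
  shows "\<bar>x k - y k\<bar> \<le> 2 * (\<eta> * (l + C)) * (1 + C / l) / l"
proof -
  \<comment> \<open>Since \<open>l (1 + U) = l + C\<close>, multiplying an equation by its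
    denominator turns the additive error \<open>\<eta>\<close> into a relative error of at most
    \<open>\<epsilon>\<close>, the kind of error that ratios can handle.\<close>
  define \<epsilon> where "\<epsilon> = \<eta> * (l + C)"
  define U where "U = C / l"
  define u where "u k = (\<Sum>m\<in>I. w k m * y m)" for k
  define u' where "u' k = (\<Sum>m\<in>I. w k m * x m)" for k
  have \<eta>: "0 \<le> \<eta>" using x_eq[OF k] by linarith
  have "0 \<le> (\<Sum>m\<in>I. w k m)" using w(1)[OF k] by (intro sum_nonneg) auto
  then have C: "0 \<le> C" using w(2)[OF k] by linarith
  then have U: "0 \<le> U" using l by (simp add: U_def)
  have \<epsilon>: "0 \<le> \<epsilon>" "\<epsilon> \<le> 1 / 2" using \<eta> C l e by (auto simp: \<epsilon>_def)
  have sum_bound: "0 \<le> (\<Sum>m\<in>I. w k m * z m) \<and> (\<Sum>m\<in>I. w k m * z m) \<le> U"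
    if "k \<in> I" "\<And>m. m \<in> I \<Longrightarrow> 0 \<le> z m \<and> z m \<le> 1 / l" for k z
  proof
    show "0 \<le> (\<Sum>m\<in>I. w k m * z m)" using that w(1) by (intro sum_nonneg) auto
    have "(\<Sum>m\<in>I. w k m * z m) \<le> (\<Sum>m\<in>I. w k m * (1 / l))"
      using that w(1) by (intro sum_mono mult_left_mono) auto
    also have "\<dots> = (\<Sum>m\<in>I. w k m) / l" by (simp add: sum_divide_distrib)
    also have "\<dots> \<le> U" unfolding U_def using w(2)[OF that(1)] l by (intro divide_right_mono) auto
    finally show "(\<Sum>m\<in>I. w k m * z m) \<le> U" .
  qed
  have u: "0 \<le> u k" "u k \<le> U" and u': "0 \<le> u' k" "u' k \<le> U" if "k \<in> I" for k
    using sum_bound[OF that, of y] sum_bound[OF that, of x] x y by (auto simp: u_def u'_def)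
  have yu: "y k * (l * (1 + u k)) = 1" if "k \<in> I" for k
    using y_eq[OF that] u(1)[OF that] l by (simp add: u_def[symmetric])
  have xu: "\<bar>x k * (l * (1 + u' k)) - 1\<bar> \<le> \<epsilon>" if "k \<in> I" for k
  proof -
    have pos: "0 < l * (1 + u' k)" using u'(1)[OF that] l by simp
    have "\<bar>a * c - 1\<bar> = \<bar>a - 1 / c\<bar> * c" if "0 < c" for a c :: real
    proof -
      have "a * c - 1 = (a - 1 / c) * c" using that by (simp add: left_diff_distrib)
      then show ?thesis using that by (simp only: abs_mult abs_of_pos)
    qed
    from this[OF pos] have "\<bar>x k * (l * (1 + u' k)) - 1\<bar> = \<bar>x k - 1 / (l * (1 + u' k))\<bar> * (l * (1 + u' k))" .
    also have "\<dots> \<le> \<eta> * (l * (1 + U))"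
      using x_eq[OF that] u'[OF that] \<eta> l pos by (intro mult_mono mult_left_mono add_mono) (auto simp: u'_def)
    also have "\<dots> = \<epsilon>" using l by (simp add: \<epsilon>_def U_def field_simps)
    finally show ?thesis .
  qed
  have ypos: "0 < y k" if "k \<in> I" for k
    using yu[OF that] y(1)[OF that] by (cases "y k = 0") auto
  have xpos: "0 < x k" if "k \<in> I" for k
    using xu[OF that] x(1)[OF that] \<epsilon> by (cases "x k = 0") auto
  \<comment> \<open>\<open>log R\<close> is the Thompson distance between \<open>x\<close> and
    \<open>y\<close>. The maximum of both quotients is taken so that neither vector has to dominate
    the other.\<close>
  define r where "r k = max (x k / y k) (y k / x k)" for k
  define R where "R = Max (r ` I)"
  have r_le: "r k \<le> R" if "k \<in> I" for k
    unfolding R_def using fin that by simp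
  have xR: "x k \<le> R * y k" and yR: "y k \<le> R * x k" if "k \<in> I" for k
  proof -
    have "x k / y k \<le> R" "y k / x k \<le> R" using r_le[OF that] by (auto simp: r_def)
    then show "x k \<le> R * y k" "y k \<le> R * x k"
      using xpos[OF that] ypos[OF that] by (auto simp: field_simps)
  qed
  have R1: "1 \<le> R"
  proof -
    have "1 \<le> x k / y k \<or> 1 \<le> y k / x k"
      using xpos[OF k] ypos[OF k] by (simp add: le_divide_eq) linarith
    then have "1 \<le> r k" by (auto simp: r_def max_def)
    then show ?thesis using r_le[OF k] by linarith
  qed
  have uR: "u' k \<le> R * u k" "u k \<le> R * u' k" if "k \<in> I" for k
    unfolding u_def u'_def sum_distrib_left using xR yR w(1) that
    by (auto intro!: sum_mono simp: mult.left_commute[of R] intro: mult_left_mono)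
  \<comment> \<open>The contraction: \<open>a <= R a'\<close> alone would allow
    \<open>(1 + a) / (1 + a')\<close> to approach \<open>R\<close>, but together with
    \<open>a <= U\<close> it is at most \<open>R (1 + U) / (R + U)\<close>. The summand 1 in the
    denominators provides the gain.\<close>
  have key: "(R + U) * (1 + a) \<le> R * (1 + U) * (1 + a')"
    if "0 \<le> a" "a \<le> U" "a \<le> R * a'" for a a' :: real
  proof -
    have "0 \<le> (U - a) * (R - 1)" using that R1 by simp
    then have "(R + U) * (1 + a) \<le> (1 + U) * (R + a)" by (simp add: algebra_simps)
    also have "\<dots> \<le> (1 + U) * (R + R * a')" using that U by (intro mult_left_mono) auto
    finally show ?thesis by (simp add: algebra_simps)
  qed
  have main: "(1 - \<epsilon>) * (R + U) \<le> 1 + U"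
  proof -
    have "R \<in> r ` I" unfolding R_def using fin k by (intro Max_in) auto
    then obtain m where m: "m \<in> I" "R = r m" by auto
    \<comment> \<open>Formulated for abstract numbers since it is applied twice, with
      \<open>x\<close> and \<open>y\<close> exchanged according to which quotient attains the
      maximum \<open>R\<close>.\<close>
    have claim: "a * (1 - \<epsilon>) * (R + U) \<le> a' * (R * (1 + U))"
      if "a * (1 - \<epsilon>) * (1 + b') \<le> a' * (1 + b)" "0 < a'" "0 \<le> b" "b \<le> U" "b \<le> R * b'" "0 \<le> b'"
      for a a' b b' :: real
    proof -
      have "a * (1 - \<epsilon>) * (R + U) * (1 + b') = a * (1 - \<epsilon>) * (1 + b') * (R + U)" by simp
      also have "\<dots> \<le> a' * (1 + b) * (R + U)"
        using that R1 U by (intro mult_right_mono) auto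
      also have "\<dots> = a' * ((R + U) * (1 + b))" by simp
      also have "\<dots> \<le> a' * (R * (1 + U) * (1 + b'))"
        using that key by (intro mult_left_mono) auto
      finally have "a * (1 - \<epsilon>) * (R + U) * (1 + b') \<le> a' * (R * (1 + U)) * (1 + b')"
        by (simp add: mult.assoc)
      then show ?thesis using that by simp
    qed
    have X: "x m * (l * (1 + u' m)) \<le> 1 + \<epsilon>" "1 - \<epsilon> \<le> x m * (l * (1 + u' m))"
      using xu[OF m(1)] by linarith+
    have "R = x m / y m \<or> R = y m / x m" using m by (auto simp: r_def max_def)
    then show ?thesis
    proof
      assume R: "R = x m / y m"
      have "x m * (1 - \<epsilon>) * (1 + u' m) * l = (x m * (l * (1 + u' m))) * (1 - \<epsilon>)" by simp
      also have "\<dots> \<le> (1 + \<epsilon>) * (1 - \<epsilon>)" using X \<epsilon> by (intro mult_right_mono) auto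
      \<comment> \<open>\<open>(1 + \<epsilon>) (1 - \<epsilon>) <= 1\<close> lets the factor
        \<open>1 - \<epsilon>\<close> serve in this case as well as in the opposite one.\<close>
      also have "\<dots> \<le> 1" by (simp add: algebra_simps)
      also have "1 = y m * (1 + u m) * l" using yu[OF m(1)] by (simp add: mult_ac)
      finally have "x m * (1 - \<epsilon>) * (1 + u' m) \<le> y m * (1 + u m)" using l by simp
      from claim[OF this ypos[OF m(1)] u[OF m(1)] uR(2)[OF m(1)] u'(1)[OF m(1)]]
      have "x m * (1 - \<epsilon>) * (R + U) \<le> y m * (R * (1 + U))" .
      also have "y m * (R * (1 + U)) = x m * (1 + U)" using R ypos[OF m(1)] by simp
      finally show ?thesis using xpos[OF m(1)] by (simp add: mult.assoc)
    next
      assume R: "R = y m / x m"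
      have "y m * (1 - \<epsilon>) * (1 + u m) * l = (y m * (l * (1 + u m))) * (1 - \<epsilon>)" by simp
      also have "\<dots> = 1 - \<epsilon>" using yu[OF m(1)] by simp
      also have "\<dots> \<le> x m * (1 + u' m) * l" using X by (simp add: mult_ac)
      finally have "y m * (1 - \<epsilon>) * (1 + u m) \<le> x m * (1 + u' m)" using l by simp
      from claim[OF this xpos[OF m(1)] u'[OF m(1)] uR(1)[OF m(1)] u(1)[OF m(1)]]
      have "y m * (1 - \<epsilon>) * (R + U) \<le> x m * (R * (1 + U))" .
      also have "x m * (R * (1 + U)) = y m * (1 + U)" using R xpos[OF m(1)] by simp
      finally show ?thesis using ypos[OF m(1)] by (simp add: mult.assoc)
    qed
  qed
  have "R - 1 \<le> 2 * \<epsilon> * (1 + U)"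
  proof -
    have "(1 - \<epsilon>) * (R - 1) \<le> \<epsilon> * (1 + U)" using main by (simp add: algebra_simps)
    \<comment> \<open>The smallness assumption enters here: \<open>\<epsilon> <= 1/2\<close> costs
      the factor 2 of the conclusion.\<close>
    moreover have "1 / 2 * (R - 1) \<le> (1 - \<epsilon>) * (R - 1)" using \<epsilon> R1 by (intro mult_right_mono) auto
    ultimately have "1 / 2 * (R - 1) \<le> \<epsilon> * (1 + U)" by (rule order.trans[rotated])
    then have "2 * (1 / 2 * (R - 1)) \<le> 2 * (\<epsilon> * (1 + U))" by (rule mult_left_mono) simp
    then have "R - 1 \<le> 2 * (\<epsilon> * (1 + U))" by simp
    then show ?thesis by (simp only: mult.assoc)
  qed
  then have R_le: "(R - 1) / l \<le> 2 * \<epsilon> * (1 + U) / l" using l by (intro divide_right_mono) auto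
  have bd: "(R - 1) * a \<le> (R - 1) / l" if "a \<le> 1 / l" for a
    using mult_left_mono[OF that, of "R - 1"] R1 by simp
  have "x k - y k \<le> (R - 1) * y k" "y k - x k \<le> (R - 1) * x k"
    using xR[OF k] yR[OF k] by (simp_all add: algebra_simps)
  then have "\<bar>x k - y k\<bar> \<le> (R - 1) / l"
    using bd[OF x(2)[OF k]] bd[OF y(2)[OF k]] by (simp add: abs_le_iff)
  then show ?thesis using R_le by (simp add: \<epsilon>_def U_def)
qed

section \<open>Stieltjes transforms on the negative half-line\<close>

lemma integral_norm_bound_AE:
  fixes f :: "'a \<Rightarrow> 'b :: {banach, second_countable_topology}"
  assumes f: "integrable M f" and g: "integrable M g" and le: "AE x in M. norm (f x) \<le> g x"
  shows "norm (integral\<^sup>L M f) \<le> integral\<^sup>L M g"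
  using integral_norm_bound[of M f] integral_mono_AE[OF integrable_norm[OF f] g le] by linarith

text \<open>At \<open>z = -a\<close> the kernel is \<open>1 / (t + a)\<close>, real and at most
  \<open>1 / a\<close>. \<open>F'\<close> is the integral of its square, the complex derivative in
  \<open>z\<close> and hence minus the derivative of \<open>F\<close> in \<open>a\<close>. The
  quotient bound has the same form as in \<open>resolvent_diff_quotient\<close>, so the two can be
  compared term by term.\<close>

lemma stieltjes_class_negative_axis:
  assumes "stieltjes_class f"
  obtains F F' :: "real \<Rightarrow> real"
  where "\<And>a. a > 0 \<Longrightarrow> f (- complex_of_real a) = complex_of_real (F a)"
    and "\<And>a. a > 0 \<Longrightarrow> 0 \<le> F a" and "\<And>a. a > 0 \<Longrightarrow> F a \<le> 1 / a"
    and "\<And>a. a > 0 \<Longrightarrow> deriv f (- complex_of_real a) = complex_of_real (F' a)"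
    and "\<And>a b. 0 < a \<Longrightarrow> a < b \<Longrightarrow> \<bar>(F a - F b) / (b - a) - F' a\<bar> \<le> (b - a) / a ^ 3"
proof -
  obtain \<mu> :: "real measure" where \<mu>: "prob_space \<mu>" "sets \<mu> = sets borel" "AE t in \<mu>. 0 \<le> t"
    and f: "\<And>z. z \<notin> \<real>\<^sub>\<ge>\<^sub>0 \<Longrightarrow> f z = (\<integral>t. 1 / (complex_of_real t - z) \<partial>\<mu>)"
    using assms unfolding stieltjes_class_def by blast
  interpret prob_space \<mu> by (rule \<mu>(1))
  have meas [measurable_cong]: "sets \<mu> = sets borel" by (rule \<mu>(2))
  define F where "F a = (\<integral>t. 1 / (t + a) \<partial>\<mu>)" for a
  define F' where "F' a = (\<integral>t. 1 / (t + a)\<^sup>2 \<partial>\<mu>)" for a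
  have int1: "integrable \<mu> (\<lambda>t. 1 / (t + a))" if a: "a > 0" for a
  proof (rule integrable_const_bound[of _ "1 / a"])
    show "AE t in \<mu>. norm (1 / (t + a)) \<le> 1 / a"
      using \<mu>(3) by eventually_elim (use a in \<open>auto intro!: divide_left_mono\<close>)
  qed measurable
  have int2: "integrable \<mu> (\<lambda>t. 1 / (t + a)\<^sup>2)" if a: "a > 0" for a
  proof (rule integrable_const_bound[of _ "1 / a\<^sup>2"])
    show "AE t in \<mu>. norm (1 / (t + a)\<^sup>2) \<le> 1 / a\<^sup>2"
      using \<mu>(3) by eventually_elim (use a in \<open>auto intro!: divide_left_mono power_mono\<close>)
  qed measurable
  have neg: "- complex_of_real a \<notin> \<real>\<^sub>\<ge>\<^sub>0" if "a > 0" for a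
    using that by (auto simp: complex_nonneg_Reals_iff)
  have f_eq: "f (- complex_of_real a) = complex_of_real (F a)" if "a > 0" for a
  proof -
    have "f (- complex_of_real a) = (\<integral>t. complex_of_real (1 / (t + a)) \<partial>\<mu>)"
      unfolding f[OF neg[OF that]] by simp
    then show ?thesis by (simp only: integral_complex_of_real F_def)
  qed
  have deriv: "deriv f (- complex_of_real a) = complex_of_real (F' a)" if a: "a > 0" for a
  proof -
    let ?z = "- complex_of_real a"
    \<comment> \<open>Differentiation under the integral by an explicit quadratic remainder: for
      \<open>|h| <= a/2\<close> the shifted denominator stays above \<open>a/2\<close> and the other
      factors above \<open>a\<close>, whence \<open>2 / a ^ 3\<close>.\<close>
    have bound: "norm (f (?z + h) - f ?z - h * complex_of_real (F' a)) \<le> norm h * (norm h * (2 / a ^ 3))"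
      if h: "norm h \<le> a / 2" for h
    proof -
      have re: "Re (?z + h) \<le> - (a / 2)"
        using h abs_Re_le_cmod[of h] by (simp add: abs_le_iff)
      then have zh: "?z + h \<notin> \<real>\<^sub>\<ge>\<^sub>0" using a by (auto simp: complex_nonneg_Reals_iff)
      have low: "a / 2 \<le> norm (complex_of_real t - (?z + h))" if "0 \<le> t" for t
      proof -
        have "a / 2 \<le> Re (complex_of_real t - (?z + h))" using re that by simp
        then show ?thesis using complex_Re_le_cmod order.trans by blast
      qed
      have inth: "integrable \<mu> (\<lambda>t. 1 / (complex_of_real t - (?z + h)))"
      proof (rule integrable_const_bound[of _ "2 / a"])
        show "AE t in \<mu>. norm (1 / (complex_of_real t - (?z + h))) \<le> 2 / a"
          using \<mu>(3)
        proof eventually_elim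
          fix t :: real assume t: "0 \<le> t"
          have "norm (1 / (complex_of_real t - (?z + h))) = 1 / norm (complex_of_real t - (?z + h))"
            by (simp add: norm_divide)
          also have "\<dots> \<le> 1 / (a / 2)"
          proof (intro divide_left_mono low[OF t] mult_pos_pos)
            show "0 < norm (complex_of_real t - (?z + h))" using low[OF t] a by linarith
          qed (use a in auto)
          finally show "norm (1 / (complex_of_real t - (?z + h))) \<le> 2 / a" by simp
        qed
      qed measurable
      have int1c: "integrable \<mu> (\<lambda>t. complex_of_real (1 / (t + a)))"
        and int2c: "integrable \<mu> (\<lambda>t. complex_of_real (1 / (t + a)\<^sup>2))"
        using int1[OF a] int2[OF a] by (simp_all only: complex_of_real_integrable_eq)
      have "f (?z + h) - f ?z - h * complex_of_real (F' a)
        = (\<integral>t. 1 / (complex_of_real t - (?z + h)) - complex_of_real (1 / (t + a))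
            - h * complex_of_real (1 / (t + a)\<^sup>2) \<partial>\<mu>)"
      proof -
        have "integral\<^sup>L \<mu> g1 - integral\<^sup>L \<mu> g2 - h * integral\<^sup>L \<mu> g3 = (\<integral>t. g1 t - g2 t - h * g3 t \<partial>\<mu>)"
          if "integrable \<mu> g1" "integrable \<mu> g2" "integrable \<mu> g3" for g1 g2 g3 :: "real \<Rightarrow> complex"
          using that by simp
        from this[OF inth int1c int2c] show ?thesis
          unfolding f[OF zh] f_eq[OF a] F_def F'_def integral_complex_of_real[symmetric] .
      qed
      also have "norm \<dots> \<le> (\<integral>t. norm h * (norm h * (2 / a ^ 3)) \<partial>\<mu>)"
      proof (rule integral_norm_bound_AE)
        show "AE t in \<mu>. norm (1 / (complex_of_real t - (?z + h)) - complex_of_real (1 / (t + a))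
            - h * complex_of_real (1 / (t + a)\<^sup>2)) \<le> norm h * (norm h * (2 / a ^ 3))"
          using \<mu>(3)
        proof eventually_elim
          fix t :: real assume t: "0 \<le> t"
          let ?d = "complex_of_real t - (?z + h)" and ?c = "complex_of_real (t + a)"
          have d0: "?d \<noteq> 0" using low[OF t] a by auto
          have c0: "?c \<noteq> 0" using t a by (metis add_nonneg_pos of_real_eq_0_iff less_irrefl)
          have cd: "?d = ?c - h" by simp
          \<comment> \<open>The first-order Taylor remainder of the kernel in closed form.\<close>
          have "1 / ?d - 1 / ?c - h * (1 / ?c\<^sup>2) = h * h / (?d * ?c\<^sup>2)"
          proof -
            have "1 / (c - h) - 1 / c - h * (1 / c\<^sup>2) = h * h / ((c - h) * c\<^sup>2)"
              if "c - h \<noteq> 0" "c \<noteq> 0" for c :: complex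
              using that by (simp add: divide_simps power2_eq_square) (simp add: algebra_simps)
            then show ?thesis using d0 c0 unfolding cd by blast
          qed
          then have "norm (1 / ?d - complex_of_real (1 / (t + a)) - h * complex_of_real (1 / (t + a)\<^sup>2))
            = norm h * norm h / (norm ?d * (t + a)\<^sup>2)"
            using t a by (simp add: norm_mult norm_divide norm_power del: of_real_add)
          also have "\<dots> \<le> norm h * norm h / (a / 2 * a\<^sup>2)"
            using low[OF t] t a by (intro divide_left_mono mult_mono power_mono mult_pos_pos) (auto simp: d0)
          also have "\<dots> = norm h * (norm h * (2 / a ^ 3))"
            using a by (simp add: power2_eq_square power3_eq_cube)
          finally show "norm (1 / ?d - complex_of_real (1 / (t + a)) - h * complex_of_real (1 / (t + a)\<^sup>2))
            \<le> norm h * (norm h * (2 / a ^ 3))" .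
        qed
      qed (intro Bochner_Integration.integrable_diff integrable_mult_right inth int1c int2c, simp)
      finally show ?thesis by (simp add: prob_space)
    qed
    have "(f has_field_derivative complex_of_real (F' a)) (at ?z)"
      unfolding DERIV_def
    proof (rule LIM_zero_cancel, rule Lim_null_comparison)
      show "\<forall>\<^sub>F h in at 0. norm ((f (?z + h) - f ?z) / h - complex_of_real (F' a)) \<le> norm h * (2 / a ^ 3)"
        unfolding eventually_at
      proof (intro exI[of _ "a / 2"] conjI ballI impI)
        fix h :: complex assume h: "h \<noteq> 0 \<and> dist h 0 < a / 2"
        have "norm ((f (?z + h) - f ?z) / h - complex_of_real (F' a))
          = norm (f (?z + h) - f ?z - h * complex_of_real (F' a)) / norm h"
          using h by (simp add: norm_divide[symmetric] diff_divide_distrib)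
        also have "\<dots> \<le> norm h * (norm h * (2 / a ^ 3)) / norm h"
          using h by (intro divide_right_mono bound) auto
        also have "\<dots> = norm h * (2 / a ^ 3)" using h by simp
        finally show "norm ((f (?z + h) - f ?z) / h - complex_of_real (F' a)) \<le> norm h * (2 / a ^ 3)" .
      qed (use a in auto)
      show "((\<lambda>h. norm h * (2 / a ^ 3)) \<longlongrightarrow> 0) (at (0 :: complex))"
        by (rule tendsto_eq_intros refl | simp)+
    qed
    then show ?thesis by (rule DERIV_imp_deriv)
  qed
  have nonneg: "0 \<le> F a" if "a > 0" for a
    unfolding F_def using \<mu>(3) by (intro integral_nonneg_AE) (auto elim!: eventually_mono simp: that add_nonneg_pos less_imp_le)
  have le: "F a \<le> 1 / a" if a: "a > 0" for a
  proof -
    have "F a \<le> (\<integral>t. 1 / a \<partial>\<mu>)"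
      unfolding F_def using \<mu>(3) int1[OF a]
      by (intro integral_mono_AE) (auto elim!: eventually_mono intro!: divide_left_mono simp: a add_nonneg_pos)
    then show ?thesis by (simp add: prob_space)
  qed
  have quot: "\<bar>(F a - F b) / (b - a) - F' a\<bar> \<le> (b - a) / a ^ 3" if a: "0 < a" "a < b" for a b
  proof -
    have b: "0 < b" using a by simp
    have "(F a - F b) / (b - a) - F' a = (\<integral>t. (1 / (t + a) - 1 / (t + b)) / (b - a) - 1 / (t + a)\<^sup>2 \<partial>\<mu>)"
      unfolding F_def F'_def using int1[OF a(1)] int1[OF b] int2[OF a(1)] by simp
    also have "\<bar>\<dots>\<bar> \<le> (\<integral>t. (b - a) / a ^ 3 \<partial>\<mu>)"
    proof (rule integral_norm_bound_AE[where 'b = real, unfolded real_norm_def])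
      show "AE t in \<mu>. \<bar>(1 / (t + a) - 1 / (t + b)) / (b - a) - 1 / (t + a)\<^sup>2\<bar> \<le> (b - a) / a ^ 3"
        using \<mu>(3)
      proof eventually_elim
        fix t :: real assume t: "0 \<le> t"
        have *: "(1 / u - 1 / w) / (w - u) - 1 / u\<^sup>2 = - ((w - u) / (u\<^sup>2 * w))"
          if "0 < u" "u < w" for u w :: real
          using that by (simp add: field_simps power2_eq_square)
        have "(1 / (t + a) - 1 / (t + b)) / (b - a) - 1 / (t + a)\<^sup>2 = - ((b - a) / ((t + a)\<^sup>2 * (t + b)))"
          using *[of "t + a" "t + b"] t a by simp
        moreover have "0 \<le> (b - a) / ((t + a)\<^sup>2 * (t + b))" using t a by simp
        moreover have "(b - a) / ((t + a)\<^sup>2 * (t + b)) \<le> (b - a) / (a\<^sup>2 * a)"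
          using t a by (intro divide_left_mono mult_mono power_mono mult_pos_pos) auto
        moreover have "a\<^sup>2 * a = a ^ 3" by (simp add: power2_eq_square power3_eq_cube)
        ultimately show "\<bar>(1 / (t + a) - 1 / (t + b)) / (b - a) - 1 / (t + a)\<^sup>2\<bar> \<le> (b - a) / a ^ 3"
          by (simp only: abs_minus_cancel abs_of_nonneg)
      qed
    qed (use int1[OF a(1)] int1[OF b] int2[OF a(1)] in auto)
    finally show ?thesis by (simp add: prob_space)
  qed
  show thesis
    by (rule that[of F F']) (use f_eq deriv nonneg le quot in auto)
qed

section \<open>Resolvents of matrices with independent entries\<close>

lemma det_measurable:
  fixes B :: "'a \<Rightarrow> real mat"
  assumes c: "\<And>\<omega>. B \<omega> \<in> carrier_mat n n"
    and m: "\<And>i j. i < n \<Longrightarrow> j < n \<Longrightarrow> (\<lambda>\<omega>. B \<omega> $$ (i, j)) \<in> borel_measurable M"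
  shows "(\<lambda>\<omega>. Determinant.det (B \<omega>)) \<in> borel_measurable M"
proof -
  have "Determinant.det (B \<omega>) = (\<Sum>p\<in>{p. p permutes {0..<n}}. signof p * (\<Prod>i = 0..<n. B \<omega> $$ (i, p i)))" for \<omega>
    by (rule det_def'[OF c])
  moreover have "(\<lambda>\<omega>. \<Sum>p\<in>{p. p permutes {0..<n}}. signof p * (\<Prod>i = 0..<n. B \<omega> $$ (i, p i)))
    \<in> borel_measurable M"
  proof (intro borel_measurable_sum borel_measurable_times borel_measurable_const borel_measurable_prod)
    fix p i assume "p \<in> {p. p permutes {0..<n}}" "i \<in> {0..<n}"
    then have "p i < n" "i < n"
      using permutes_in_image[of p "{0..<n}" i] by auto
    then show "(\<lambda>\<omega>. B \<omega> $$ (i, p i)) \<in> borel_measurable M"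
      by (intro m)
  qed
  ultimately show ?thesis by presburger
qed

text \<open>By Cramer's rule each entry is a quotient of polynomials in the entries of the matrix,
  with a determinant that never vanishes.\<close>

lemma resolvent_measurable:
  fixes A :: "'a \<Rightarrow> real mat"
  assumes c: "\<And>\<omega>. A \<omega> \<in> carrier_mat N P" and l: "l > 0"
    and m: "\<And>i j. i < N \<Longrightarrow> j < P \<Longrightarrow> (\<lambda>\<omega>. A \<omega> $$ (i, j)) \<in> borel_measurable M"
    and jk: "j < P" "k < P"
  shows "(\<lambda>\<omega>. resolvent l (A \<omega>) $$ (j, k)) \<in> borel_measurable M"
proof -
  define G where "G \<omega> = gram_reg l (A \<omega>)" for \<omega>
  have Gc: "G \<omega> \<in> carrier_mat P P" for \<omega>
    unfolding G_def by (rule gram_reg_carrier[OF c l])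
  have G_index: "G \<omega> $$ (i, i') = (\<Sum>r<N. A \<omega> $$ (r, i) * A \<omega> $$ (r, i')) + l * (if i = i' then 1 else 0)"
    if "i < P" "i' < P" for i i' \<omega>
    using that c[of \<omega>] unfolding G_def gram_reg_def
    by (auto simp: scalar_prod_def atLeast0LessThan)
  have G_meas: "(\<lambda>\<omega>. G \<omega> $$ (i, i')) \<in> borel_measurable M" if "i < P" "i' < P" for i i'
    unfolding G_index[OF that] using that m
    by (intro borel_measurable_add borel_measurable_sum borel_measurable_times) auto
  have det0: "Determinant.det (G \<omega>) \<noteq> 0" for \<omega>
    unfolding G_def by (rule gram_reg_det[OF c l])
  have "G \<omega> * ((1 / Determinant.det (G \<omega>)) \<cdot>\<^sub>m adj_mat (G \<omega>)) = 1\<^sub>m P" for \<omega>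
    using adj_mat(2)[OF Gc[of \<omega>]] det0[of \<omega>]
    by (subst mult_smult_distrib[OF Gc adj_mat(1)[OF Gc]]) (auto intro!: eq_matI)
  then have "resolvent l (A \<omega>) = (1 / Determinant.det (G \<omega>)) \<cdot>\<^sub>m adj_mat (G \<omega>)" for \<omega>
    unfolding resolvent_def G_def[symmetric]
    by (intro minv_eqI[OF Gc] smult_carrier_mat adj_mat(1)[OF Gc])
  then have "resolvent l (A \<omega>) $$ (j, k)
      = 1 / Determinant.det (G \<omega>) * ((-1) ^ (k + j) * Determinant.det (mat_delete (G \<omega>) k j))" for \<omega>
    using jk Gc[of \<omega>] by (simp add: adj_mat_def cofactor_def)
  moreover have "(\<lambda>\<omega>. Determinant.det (mat_delete (G \<omega>) k j)) \<in> borel_measurable M"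
  proof (rule det_measurable)
    show "mat_delete (G \<omega>) k j \<in> carrier_mat (P - 1) (P - 1)" for \<omega>
      using Gc[of \<omega>] by (simp add: mat_delete_def)
    fix i i' assume "i < P - 1" "i' < P - 1"
    then show "(\<lambda>\<omega>. mat_delete (G \<omega>) k j $$ (i, i')) \<in> borel_measurable M"
      by (auto simp: mat_delete_def carrier_matD[OF Gc] intro!: G_meas)
  qed
  ultimately show ?thesis
    using det_measurable[OF Gc G_meas] by (simp add: borel_measurable_divide)
qed

lemma (in prob_space) indep_vars_reindex_inj:
  assumes ind: "indep_vars M' X I" and f: "inj_on f J" "f ` J \<subseteq> I"
  shows "indep_vars (\<lambda>j. M' (f j)) (\<lambda>j. X (f j)) J"
proof -
  have "indep_vars (\<lambda>j. PiM {f j} M') (\<lambda>j \<omega>. \<lambda>i\<in>{f j}. X i \<omega>) J"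
    using f by (intro indep_vars_restrict[OF ind]) (auto simp: disjoint_family_on_def inj_on_def)
  then have "indep_vars (\<lambda>j. M' (f j)) (\<lambda>j \<omega>. (\<lambda>z. z (f j)) (\<lambda>i\<in>{f j}. X i \<omega>)) J"
    by (rule indep_vars_compose2) (intro measurable_component_singleton, auto)
  then show ?thesis by simp
qed

text \<open>The entries are meant to be already divided by the square root of the sample size, so
  \<open>b\<close> is of order 1/n and \<open>\<kappa>\<close> of order n^-2. All assumptions are
  symmetric in rows and columns; \<open>transpose\<close> exploits this.\<close>

locale independent_entries = prob_space M for M :: "'a measure" +
  fixes y :: "nat \<Rightarrow> nat \<Rightarrow> 'a \<Rightarrow> real" and N P :: nat and v :: "nat \<Rightarrow> nat \<Rightarrow> real" and b \<kappa> l :: real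
  assumes indep: "indep_vars (\<lambda>_. borel) (\<lambda>(i, j). y i j) ({..<N} \<times> {..<P})"
    and mean: "\<And>i j. i < N \<Longrightarrow> j < P \<Longrightarrow> expectation (y i j) = 0"
    and var: "\<And>i j. i < N \<Longrightarrow> j < P \<Longrightarrow> expectation (\<lambda>\<omega>. (y i j \<omega>)\<^sup>2) = v i j"
    and var_le: "\<And>i j. i < N \<Longrightarrow> j < P \<Longrightarrow> v i j \<le> b"
    and int4: "\<And>i j. i < N \<Longrightarrow> j < P \<Longrightarrow> integrable M (\<lambda>\<omega>. (y i j \<omega>) ^ 4)"
    and kappa: "\<And>i j. i < N \<Longrightarrow> j < P \<Longrightarrow> expectation (\<lambda>\<omega>. (y i j \<omega>) ^ 4) \<le> \<kappa>"
    and b: "0 < b" and kappa_nonneg: "0 \<le> \<kappa>" and l: "0 < l"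
begin

definition Y :: "'a \<Rightarrow> real mat" where
  "Y \<omega> = Matrix.mat N P (\<lambda>(i, j). y i j \<omega>)"

lemma Y_carrier [simp]: "Y \<omega> \<in> carrier_mat N P"
  by (simp add: Y_def)

lemma transpose: "independent_entries M (\<lambda>j i. y i j) P N (\<lambda>j i. v i j) b \<kappa> l"
proof -
  have "indep_vars (\<lambda>_. borel) (\<lambda>p. (\<lambda>(i, j). y i j) (prod.swap p)) ({..<P} \<times> {..<N})"
    by (rule indep_vars_reindex_inj[OF indep]) auto
  moreover have "(\<lambda>p. (\<lambda>(i, j). y i j) (prod.swap p)) = (\<lambda>(j, i). y i j)"
    by auto
  ultimately show ?thesis
    using mean var var_le int4 kappa b kappa_nonneg l by unfold_locales auto
qed

lemma entry_measurable [measurable]: "i < N \<Longrightarrow> j < P \<Longrightarrow> y i j \<in> borel_measurable M"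
  using indep unfolding indep_vars_def by force

lemma var_nonneg: "i < N \<Longrightarrow> j < P \<Longrightarrow> 0 \<le> v i j"
  by (subst var[symmetric]) auto

lemma resolvent_Y_measurable [measurable]:
  "j < P \<Longrightarrow> k < P \<Longrightarrow> (\<lambda>\<omega>. resolvent l (Y \<omega>) $$ (j, k)) \<in> borel_measurable M"
  by (rule resolvent_measurable[OF Y_carrier l]) (auto simp: Y_def)

lemma resolvent_Y_diag_integrable: "j < P \<Longrightarrow> integrable M (\<lambda>\<omega>. resolvent l (Y \<omega>) $$ (j, j))"
  using resolvent_diag_bounds[OF Y_carrier l]
  by (intro integrable_const_bound[of _ "1 / l"] AE_I2) auto

text \<open>Whole rows serve as the coordinates for the bounded differences inequality: a full row
  moves a weighted trace by at most \<open>D / l\<close>, so there are \<open>N\<close> steps rather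
  than \<open>N * P\<close>.\<close>

lemma rows_indep:
  "indep_vars (\<lambda>i. PiM ({i} \<times> {..<P}) (\<lambda>_. borel))
    (\<lambda>i \<omega>. \<lambda>ij\<in>{i} \<times> {..<P}. (\<lambda>(i, j). y i j) ij \<omega>) {..<N}"
  by (rule indep_vars_restrict[OF indep]) (auto simp: disjoint_family_on_def)

lemma weighted_trace_concentration:
  assumes N: "N > 0" and s: "s > 0"
    and d: "\<And>j. j < P \<Longrightarrow> 0 \<le> d j" "\<And>j. j < P \<Longrightarrow> d j \<le> D" and D: "0 \<le> D"
  defines "h \<equiv> \<lambda>\<omega>. (\<Sum>j<P. d j * resolvent l (Y \<omega>) $$ (j, j))
    - expectation (\<lambda>\<omega>. \<Sum>j<P. d j * resolvent l (Y \<omega>) $$ (j, j))"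
  shows weighted_trace_abs_deviation:
      "expectation (\<lambda>\<omega>. \<bar>h \<omega>\<bar>) \<le> 2 / s * exp (s\<^sup>2 * (D / l)\<^sup>2 / 2 * N)"
    and weighted_trace_tail:
      "measure M {\<omega> \<in> space M. \<bar>h \<omega>\<bar> \<ge> t} \<le> 2 * exp (s\<^sup>2 * (D / l)\<^sup>2 / 2 * N - s * t)"
proof -
  let ?S = "\<lambda>i. PiM ({i} \<times> {..<P}) (\<lambda>_. borel :: real measure)"
  let ?r = "\<lambda>i \<omega>. \<lambda>ij\<in>{i} \<times> {..<P}. (\<lambda>(i, j). y i j) ij \<omega>"
  \<comment> \<open>Reassembles a matrix from row blocks; block \<open>i\<close> is itself a
    function on index pairs with first component \<open>i\<close>.\<close>
  define mat_of where "mat_of r = Matrix.mat N P (\<lambda>(i, j). r i (i, j))" for r :: "nat \<Rightarrow> nat \<times> nat \<Rightarrow> real"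
  define F where "F r = (\<Sum>j<P. d j * resolvent l (mat_of r) $$ (j, j))" for r
  have mc: "mat_of r \<in> carrier_mat N P" for r by (simp add: mat_of_def)
  have F_meas: "F \<in> borel_measurable (PiM {..<N} ?S)"
  proof -
    have "(\<lambda>r. mat_of r $$ (i, j)) \<in> borel_measurable (PiM {..<N} ?S)" if ij: "i < N" "j < P" for i j
    proof -
      have "(\<lambda>r. (r i) (i, j)) \<in> borel_measurable (PiM {..<N} ?S)"
        using ij by (intro measurable_compose[OF measurable_component_singleton[of i "{..<N}" ?S]]
            measurable_component_singleton) auto
      then show ?thesis using ij by (simp add: mat_of_def)
    qed
    then show ?thesis
      unfolding F_def
      by (intro borel_measurable_sum borel_measurable_times borel_measurable_const
          resolvent_measurable[OF mc l]) auto
  qed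
  have F_bd: "\<bar>F r\<bar> \<le> (\<Sum>j<P. d j * (1 / l))" for r
  proof -
    have "0 \<le> F r" "F r \<le> (\<Sum>j<P. d j * (1 / l))"
      unfolding F_def using d resolvent_diag_bounds[OF mc l]
      by (auto intro!: sum_nonneg sum_mono mult_left_mono simp del: mult_1_right times_divide_eq_right)
    then show ?thesis by simp
  qed
  have F_diff: "\<bar>F (r(i := z)) - F r\<bar> \<le> D / l" if i: "i \<in> {..<N}" for r i z
    unfolding F_def using i d D
    by (intro resolvent_weighted_trace_row_change[OF mc mc l, of i]) (auto simp: mat_of_def)
  have F_eq: "F (\<lambda>i\<in>{..<N}. ?r i \<omega>) = (\<Sum>j<P. d j * resolvent l (Y \<omega>) $$ (j, j))" for \<omega>
  proof -
    have "mat_of (\<lambda>i\<in>{..<N}. ?r i \<omega>) = Y \<omega>"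
      unfolding mat_of_def Y_def by (rule eq_matI) auto
    then show ?thesis by (simp only: F_def)
  qed
  have I: "finite {..<N}" "{..<N} \<noteq> {}" using N by auto
  note * = bounded_differences_abs_deviation[OF I rows_indep s F_meas, of _ "D / l", OF F_bd F_diff]
    bounded_differences_tail[OF I rows_indep s F_meas, of _ "D / l", OF F_bd F_diff]
  show "expectation (\<lambda>\<omega>. \<bar>h \<omega>\<bar>) \<le> 2 / s * exp (s\<^sup>2 * (D / l)\<^sup>2 / 2 * N)"
    using *(1) unfolding F_eq h_def by simp
  show "measure M {\<omega> \<in> space M. \<bar>h \<omega>\<bar> \<ge> t} \<le> 2 * exp (s\<^sup>2 * (D / l)\<^sup>2 / 2 * N - s * t)"
    using *(2) unfolding F_eq h_def by simp
qed

lemma weighted_trace_abs_deviation_sqrt: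
  assumes N: "N > 0" and d: "\<And>j. j < P \<Longrightarrow> 0 \<le> d j" "\<And>j. j < P \<Longrightarrow> d j \<le> b"
  shows "expectation (\<lambda>\<omega>. \<bar>(\<Sum>j<P. d j * resolvent l (Y \<omega>) $$ (j, j))
    - expectation (\<lambda>\<omega>. \<Sum>j<P. d j * resolvent l (Y \<omega>) $$ (j, j))\<bar>) \<le> 4 * b * sqrt N / l"
proof -
  \<comment> \<open>Chosen to make the exponent equal to 1/2; then \<open>exp (1/2) <= 2\<close>
    follows from \<open>e <= 3\<close>.\<close>
  define s where "s = l / (b * sqrt N)"
  have s: "s > 0" using b l N by (simp add: s_def)
  have "s\<^sup>2 * (b / l)\<^sup>2 / 2 * N = 1 / 2"
    using b l N by (simp add: s_def power_divide power_mult_distrib)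
  then have "2 / s * exp (s\<^sup>2 * (b / l)\<^sup>2 / 2 * N) = 2 / s * exp (1 / 2)" by simp
  also have "\<dots> \<le> 2 / s * 2"
  proof (intro mult_left_mono)
    have "exp (1 / 2 :: real) * exp (1 / 2) = exp 1" by (simp flip: exp_add)
    also have "\<dots> \<le> 3" by (rule exp_le)
    also have "\<dots> \<le> 2 * 2" by simp
    finally show "exp (1 / 2 :: real) \<le> 2"
      using mult_strict_mono[of 2 "exp (1 / 2 :: real)" 2 "exp (1 / 2 :: real)"] by linarith
  qed (use s in auto)
  also have "\<dots> = 4 * b * sqrt N / l" using b l N by (simp add: s_def)
  finally show ?thesis
    using weighted_trace_abs_deviation[OF N s, where d = d and D = b, OF d less_imp_le[OF b]] by linarith
qed


lemma zero_row_Y: "zero_row i (Y \<omega>) = Matrix.mat N P (\<lambda>(k, j). if k = i then 0 else y k j \<omega>)"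
  unfolding zero_row_def Y_def by (rule eq_matI) auto

text \<open>The resolvent with row \<open>i\<close> zeroed depends on the other rows only. Fubini on
  the product of the two laws freezes it, and \<open>quadratic_form_second_moment\<close> applies to
  the remaining row. With \<open>b\<close> of order 1/n, \<open>\<kappa>\<close> of order n^-2 and
  \<open>P\<close> of order n, the bound is O(n^-1/2).\<close>

lemma row_quadratic_form_deviation:
  assumes i: "i < N"
  defines "W \<equiv> \<lambda>\<omega>. (\<Sum>j<P. \<Sum>k<P. resolvent l (zero_row i (Y \<omega>)) $$ (j, k) * y i j \<omega> * y i k \<omega>)
    - (\<Sum>j<P. resolvent l (zero_row i (Y \<omega>)) $$ (j, j) * v i j)"
  shows "integrable M (\<lambda>\<omega>. \<bar>W \<omega>\<bar>)"
    and "expectation (\<lambda>\<omega>. \<bar>W \<omega>\<bar>) \<le> sqrt ((2 * \<kappa> + 8 * b\<^sup>2) * P) / l"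
proof -
  let ?A = "({..<N} - {i}) \<times> {..<P}" and ?B = "{i} \<times> {..<P}"
  let ?SA = "PiM ?A (\<lambda>_. borel :: real measure)" and ?SB = "PiM ?B (\<lambda>_. borel :: real measure)"
  define \<tau> where "\<tau> \<omega> = (\<lambda>ij\<in>?A. (\<lambda>(i, j). y i j) ij \<omega>)" for \<omega>
  define \<rho> where "\<rho> \<omega> = (\<lambda>ij\<in>?B. (\<lambda>(i, j). y i j) ij \<omega>)" for \<omega>
  have ind: "indep_var ?SA \<tau> ?SB \<rho>"
    unfolding \<tau>_def \<rho>_def using i by (intro indep_var_restrict[OF indep]) auto
  have \<tau> [measurable]: "\<tau> \<in> measurable M ?SA" and \<rho> [measurable]: "\<rho> \<in> measurable M ?SB"
    using indep_var_rv1[OF ind] indep_var_rv2[OF ind] by auto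
  have joint: "distr M (?SA \<Otimes>\<^sub>M ?SB) (\<lambda>\<omega>. (\<tau> \<omega>, \<rho> \<omega>)) = distr M ?SA \<tau> \<Otimes>\<^sub>M distr M ?SB \<rho>"
    using ind by (simp add: indep_var_distribution_eq)
  define A0 where "A0 z = Matrix.mat N P (\<lambda>(k, j). if k = i then 0 else z (k, j))" for z :: "nat \<times> nat \<Rightarrow> real"
  have A0c: "A0 z \<in> carrier_mat N P" for z by (simp add: A0_def)
  have A0_tau: "A0 (\<tau> \<omega>) = zero_row i (Y \<omega>)" for \<omega>
    unfolding zero_row_Y A0_def \<tau>_def by (rule eq_matI) auto
  have rho: "\<rho> \<omega> (i, j) = y i j \<omega>" if "j < P" for j \<omega>
    using that by (simp add: \<rho>_def)
  define q where "q z j k = resolvent l (A0 z) $$ (j, k)" for z j k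
  have q_meas [measurable]: "(\<lambda>z. q z j k) \<in> borel_measurable ?SA" if "j < P" "k < P" for j k
    unfolding q_def
  proof (rule resolvent_measurable[OF A0c l _ that])
    fix k' j' assume *: "k' < N" "j' < P"
    show "(\<lambda>z. A0 z $$ (k', j')) \<in> borel_measurable ?SA"
    proof (cases "k' = i")
      case False
      then have "(\<lambda>z. z (k', j')) \<in> borel_measurable ?SA"
        using * by (intro measurable_component_singleton) auto
      then show ?thesis using * False by (simp add: A0_def)
    qed (use * in \<open>simp add: A0_def\<close>)
  qed
  define \<phi> where "\<phi> z a = (\<Sum>j<P. \<Sum>k<P. q z j k * a (i, j) * a (i, k)) - (\<Sum>j<P. q z j j * v i j)"
    for z a :: "nat \<times> nat \<Rightarrow> real"
  have a_meas: "(\<lambda>a. a (i, j)) \<in> borel_measurable ?SB" if "j < P" for j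
    using that by (intro measurable_component_singleton) auto
  have \<phi>_meas [measurable]: "(\<lambda>(z, a). \<phi> z a) \<in> borel_measurable (?SA \<Otimes>\<^sub>M ?SB)"
  proof -
    have 1: "(\<lambda>za. q (fst za) j k) \<in> borel_measurable (?SA \<Otimes>\<^sub>M ?SB)" if "j < P" "k < P" for j k
      by (rule measurable_compose[OF measurable_fst q_meas[OF that]])
    have 2: "(\<lambda>za. snd za (i, j)) \<in> borel_measurable (?SA \<Otimes>\<^sub>M ?SB)" if "j < P" for j
      by (rule measurable_compose[OF measurable_snd a_meas[OF that]])
    show ?thesis
      unfolding \<phi>_def case_prod_beta
      by (intro borel_measurable_diff borel_measurable_sum borel_measurable_times borel_measurable_const 1 2) auto
  qed
  have W_eq: "W \<omega> = \<phi> (\<tau> \<omega>) (\<rho> \<omega>)" for \<omega>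
    unfolding W_def \<phi>_def q_def A0_tau using rho by (auto intro!: sum.cong arg_cong2[where f = "(-)"])
  define C where "C = (2 * \<kappa> + 8 * b\<^sup>2) * (P / l\<^sup>2)"
  have C0: "0 \<le> C" using kappa_nonneg by (simp add: C_def)
  \<comment> \<open>The second moment for a frozen \<open>z\<close>, bounded uniformly in
    \<open>z\<close>, so that the outer integration is trivial.\<close>
  have inner: "(\<integral>\<^sup>+\<omega>. ennreal ((\<phi> z (\<rho> \<omega>))\<^sup>2) \<partial>M) \<le> ennreal C" for z
  proof -
    define Wz where "Wz \<omega> = (\<Sum>j<P. \<Sum>k<P. q z j k * y i j \<omega> * y i k \<omega>) - (\<Sum>j<P. q z j j * v i j)" for \<omega>
    have eq: "\<phi> z (\<rho> \<omega>) = Wz \<omega>" for \<omega>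
      unfolding \<phi>_def Wz_def using rho by (auto intro!: sum.cong arg_cong2[where f = "(-)"])
    have "indep_vars (\<lambda>_. borel) (\<lambda>j. (\<lambda>(i, j). y i j) (i, j)) {..<P}"
      by (rule indep_vars_reindex_inj[OF indep]) (use i in \<open>auto simp: inj_on_def\<close>)
    then have "indep_vars (\<lambda>_. borel) (y i) {..<P}" by simp
    from quadratic_form_second_moment[OF this mean[OF i] var[OF i] var_le[OF i] int4[OF i] kappa[OF i],
        where q = "q z" and m = P]
    have *: "integrable M (\<lambda>\<omega>. (Wz \<omega>)\<^sup>2)"
      "expectation (\<lambda>\<omega>. (Wz \<omega>)\<^sup>2) \<le> (2 * \<kappa> + 8 * b\<^sup>2) * (\<Sum>j<P. \<Sum>k<P. (q z j k)\<^sup>2)"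
      using resolvent_index_sym[OF A0c l] unfolding q_def Wz_def by auto
    have "(\<Sum>j<P. \<Sum>k<P. (q z j k)\<^sup>2) = (\<Sum>j<P. \<Sum>k<P. (q z k j)\<^sup>2)"
      using resolvent_index_sym[OF A0c l] unfolding q_def by (intro sum.cong) auto
    also have "\<dots> \<le> (\<Sum>j<P. 1 / l\<^sup>2)"
      unfolding q_def using resolvent_col_sq_bound[OF A0c l] by (intro sum_mono) auto
    finally have "(\<Sum>j<P. \<Sum>k<P. (q z j k)\<^sup>2) \<le> P / l\<^sup>2" by simp
    then have "(2 * \<kappa> + 8 * b\<^sup>2) * (\<Sum>j<P. \<Sum>k<P. (q z j k)\<^sup>2) \<le> C"
      unfolding C_def using kappa_nonneg by (intro mult_left_mono) auto
    then have "expectation (\<lambda>\<omega>. (Wz \<omega>)\<^sup>2) \<le> C" using *(2) by linarith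
    then show ?thesis
      unfolding eq using *(1) by (subst nn_integral_eq_integral) (auto intro: ennreal_leI)
  qed
  interpret B: prob_space "distr M ?SB \<rho>" by (rule prob_space_distr) simp
  interpret A: prob_space "distr M ?SA \<tau>" by (rule prob_space_distr) simp
  have W_meas [measurable]: "W \<in> borel_measurable M"
    unfolding W_eq[abs_def] using measurable_compose[OF measurable_Pair[OF \<tau> \<rho>] \<phi>_meas] by simp
  have "(\<integral>\<^sup>+\<omega>. ennreal ((W \<omega>)\<^sup>2) \<partial>M)
      = (\<integral>\<^sup>+za. ennreal ((case_prod \<phi> za)\<^sup>2) \<partial>distr M (?SA \<Otimes>\<^sub>M ?SB) (\<lambda>\<omega>. (\<tau> \<omega>, \<rho> \<omega>)))"
    unfolding W_eq by (subst nn_integral_distr) auto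
  also have "\<dots> = (\<integral>\<^sup>+z. \<integral>\<^sup>+a. ennreal ((\<phi> z a)\<^sup>2) \<partial>distr M ?SB \<rho> \<partial>distr M ?SA \<tau>)"
    unfolding joint by (subst B.nn_integral_fst[symmetric]) auto
  also have "\<dots> \<le> (\<integral>\<^sup>+z. ennreal C \<partial>distr M ?SA \<tau>)"
  proof (intro nn_integral_mono)
    fix z assume z: "z \<in> space (distr M ?SA \<tau>)"
    have [measurable]: "\<phi> z \<in> borel_measurable ?SB"
      using measurable_compose_Pair1[OF _ \<phi>_meas, of z] z by simp
    have "(\<integral>\<^sup>+a. ennreal ((\<phi> z a)\<^sup>2) \<partial>distr M ?SB \<rho>) = (\<integral>\<^sup>+\<omega>. ennreal ((\<phi> z (\<rho> \<omega>))\<^sup>2) \<partial>M)"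
      by (subst nn_integral_distr) auto
    then show "(\<integral>\<^sup>+a. ennreal ((\<phi> z a)\<^sup>2) \<partial>distr M ?SB \<rho>) \<le> ennreal C"
      using inner by simp
  qed
  also have "\<dots> = ennreal C" using A.emeasure_space_1 by simp
  finally have nn: "(\<integral>\<^sup>+\<omega>. ennreal ((W \<omega>)\<^sup>2) \<partial>M) \<le> ennreal C" .
  then have W2: "integrable M (\<lambda>\<omega>. (W \<omega>)\<^sup>2)"
    by (intro integrableI_bounded) (auto simp: abs_of_nonneg intro: le_less_trans)
  have EW2: "expectation (\<lambda>\<omega>. (W \<omega>)\<^sup>2) \<le> C"
    using nn W2 C0 by (subst (asm) nn_integral_eq_integral) auto
  have W1: "integrable M W"
    by (rule square_integrable_imp_integrable[OF W_meas W2])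
  then show intW: "integrable M (\<lambda>\<omega>. \<bar>W \<omega>\<bar>)" by simp
  \<comment> \<open>Nonnegativity of the variance stands in for the Cauchy-Schwarz
    inequality.\<close>
  have "0 \<le> variance (\<lambda>\<omega>. \<bar>W \<omega>\<bar>)" by (rule variance_positive)
  also have "\<dots> = expectation (\<lambda>\<omega>. \<bar>W \<omega>\<bar>\<^sup>2) - (expectation (\<lambda>\<omega>. \<bar>W \<omega>\<bar>))\<^sup>2"
    using W1 W2 by (intro variance_eq) auto
  finally have "(expectation (\<lambda>\<omega>. \<bar>W \<omega>\<bar>))\<^sup>2 \<le> C" using EW2 by simp
  then have "expectation (\<lambda>\<omega>. \<bar>W \<omega>\<bar>) \<le> sqrt C" by (rule real_le_rsqrt)
  also have "sqrt C = sqrt ((2 * \<kappa> + 8 * b\<^sup>2) * P) / l"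
    using l by (simp add: C_def real_sqrt_divide flip: times_divide_eq_right) (simp add: real_sqrt_divide)
  finally show "expectation (\<lambda>\<omega>. \<bar>W \<omega>\<bar>) \<le> sqrt ((2 * \<kappa> + 8 * b\<^sup>2) * P) / l" .
qed

text \<open>The exact formula for the diagonal entry has \<open>q0\<close> in the denominator.
  Passing to the mean weighted trace costs three errors, in the order of the bound: the row form
  against its trace, restoring row \<open>i\<close>, and the fluctuation of the trace. The outer
  \<open>1 / l\<close> is the Lipschitz constant of \<open>x -> 1 / (l * (1 + x))\<close> on
  nonnegative reals.\<close>

lemma expected_resolvent_fixed_point:
  assumes i: "i < N"
  shows "\<bar>expectation (\<lambda>\<omega>. resolvent l (transpose_mat (Y \<omega>)) $$ (i, i))
      - 1 / (l * (1 + (\<Sum>j<P. v i j * expectation (\<lambda>\<omega>. resolvent l (Y \<omega>) $$ (j, j)))))\<bar>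
    \<le> (sqrt ((2 * \<kappa> + 8 * b\<^sup>2) * P) / l + b / l + 4 * b * sqrt N / l) / l"
proof -
  let ?Z = "\<lambda>\<omega>. resolvent l (zero_row i (Y \<omega>))" and ?R = "\<lambda>\<omega>. resolvent l (Y \<omega>)"
  let ?Rt = "\<lambda>\<omega>. resolvent l (transpose_mat (Y \<omega>))"
  let ?q = "\<lambda>\<omega>. scalar_prod (row (Y \<omega>) i) (?Z \<omega> *\<^sub>v row (Y \<omega>) i)"
  define W where "W \<omega> = (\<Sum>j<P. \<Sum>k<P. ?Z \<omega> $$ (j, k) * y i j \<omega> * y i k \<omega>)
    - (\<Sum>j<P. ?Z \<omega> $$ (j, j) * v i j)" for \<omega>
  note W = row_quadratic_form_deviation[OF i, folded W_def]
  define t where "t \<omega> = (\<Sum>j<P. v i j * ?R \<omega> $$ (j, j))" for \<omega>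
  define m where "m = expectation t"
  have N: "N > 0" using i by simp
  have t_int: "integrable M t"
    unfolding t_def using resolvent_Y_diag_integrable
    by (intro Bochner_Integration.integrable_sum integrable_mult_right) auto
  have m_eq: "m = (\<Sum>j<P. v i j * expectation (\<lambda>\<omega>. ?R \<omega> $$ (j, j)))"
    unfolding m_def t_def using resolvent_Y_diag_integrable
    by (subst Bochner_Integration.integral_sum) (auto intro!: sum.cong)
  have t_nonneg: "0 \<le> t \<omega>" for \<omega>
    unfolding t_def using resolvent_diag_bounds[OF Y_carrier l] var_nonneg[OF i]
    by (intro sum_nonneg mult_nonneg_nonneg) auto
  have m_nonneg: "0 \<le> m"
    unfolding m_def using t_nonneg by (intro integral_nonneg_AE AE_I2) auto
  have t_dev: "expectation (\<lambda>\<omega>. \<bar>t \<omega> - m\<bar>) \<le> 4 * b * sqrt N / l"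
    unfolding m_def t_def
    by (rule weighted_trace_abs_deviation_sqrt[OF N, of "v i"]) (use var_nonneg[OF i] var_le[OF i] in auto)
  have q_eq: "?q \<omega> = (\<Sum>j<P. \<Sum>k<P. ?Z \<omega> $$ (j, k) * y i j \<omega> * y i k \<omega>)" for \<omega>
  proof -
    have R0c: "?Z \<omega> \<in> carrier_mat P P"
      by (rule resolvent_carrier[OF zero_row_carrier[OF Y_carrier] l])
    have rw: "row (Y \<omega>) i \<in> carrier_vec P" using Y_carrier i by (intro row_carrier_vec) auto
    have ry: "row (Y \<omega>) i $ j = y i j \<omega>" if "j < P" for j
      using that i by (simp add: Y_def)
    have "?q \<omega> = (\<Sum>j<P. row (Y \<omega>) i $ j * (\<Sum>k<P. ?Z \<omega> $$ (j, k) * row (Y \<omega>) i $ k))"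
    proof -
      have "scalar_prod x (R *\<^sub>v x) = (\<Sum>j<P. x $ j * (\<Sum>k<P. R $$ (j, k) * x $ k))"
        if "R \<in> carrier_mat P P" "x \<in> carrier_vec P" for R :: "real mat" and x
        using that by (auto simp: scalar_prod_def atLeast0LessThan intro!: sum.cong)
      then show ?thesis using R0c rw .
    qed
    also have "\<dots> = (\<Sum>j<P. y i j \<omega> * (\<Sum>k<P. ?Z \<omega> $$ (j, k) * y i k \<omega>))"
      using ry by (intro sum.cong refl arg_cong2[where f = "(*)"]) auto
    finally show ?thesis by (simp add: sum_distrib_left mult_ac)
  qed
  have q_nonneg: "0 \<le> ?q \<omega>" for \<omega>
    by (rule loo_quad_nonneg[OF Y_carrier l i])
  have Rt_eq: "?Rt \<omega> $$ (i, i) = 1 / (l * (1 + ?q \<omega>))" for \<omega>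
    by (rule resolvent_transpose_diag[OF Y_carrier l i])
  have Rt_int: "integrable M (\<lambda>\<omega>. ?Rt \<omega> $$ (i, i))"
  proof -
    interpret tr: independent_entries M "\<lambda>j i. y i j" P N "\<lambda>j i. v i j" b \<kappa> l by (rule transpose)
    have "transpose_mat (Y \<omega>) = tr.Y \<omega>" for \<omega>
      unfolding Y_def tr.Y_def by (rule eq_matI) auto
    then show ?thesis using tr.resolvent_Y_diag_integrable[OF i] by simp
  qed
  have lip: "\<bar>1 / (l * (1 + x)) - 1 / (l * (1 + x'))\<bar> \<le> \<bar>x - x'\<bar> / l" if "0 \<le> x" "0 \<le> x'" for x x' :: real
  proof -
    have "1 / (l * u) - 1 / (l * w) = (w - u) / l / (u * w)" if "0 < u" "0 < w" for u w :: real
      using that l by (simp add: field_simps)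
    from this[of "1 + x" "1 + x'"] have "1 / (l * (1 + x)) - 1 / (l * (1 + x')) = (x' - x) / l / ((1 + x) * (1 + x'))"
      using that by simp
    then have "\<bar>1 / (l * (1 + x)) - 1 / (l * (1 + x'))\<bar> = (\<bar>x - x'\<bar> / l) / ((1 + x) * (1 + x'))"
      using that l by (simp add: abs_mult abs_minus_commute)
    also have "\<dots> \<le> (\<bar>x - x'\<bar> / l) / 1"
      using that l mult_mono[of 1 "1 + x" 1 "1 + x'"] by (intro divide_left_mono) auto
    finally show ?thesis by simp
  qed
  have ptw: "\<bar>?Rt \<omega> $$ (i, i) - 1 / (l * (1 + m))\<bar> \<le> (\<bar>W \<omega>\<bar> + b / l + \<bar>t \<omega> - m\<bar>) / l" for \<omega>
  proof -
    have "\<bar>?q \<omega> - m\<bar> \<le> \<bar>W \<omega>\<bar> + b / l + \<bar>t \<omega> - m\<bar>"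
    proof -
      have "?q \<omega> - W \<omega> = (\<Sum>j<P. v i j * ?Z \<omega> $$ (j, j))"
        unfolding W_def q_eq by (simp add: mult.commute)
      moreover have "t \<omega> \<le> (\<Sum>j<P. v i j * ?Z \<omega> $$ (j, j))"
        "(\<Sum>j<P. v i j * ?Z \<omega> $$ (j, j)) \<le> t \<omega> + b / l"
        unfolding t_def using resolvent_weighted_trace_loo[OF Y_carrier l i, of "v i" b]
          var_nonneg[OF i] var_le[OF i] b by auto
      ultimately show ?thesis by linarith
    qed
    then have "\<bar>?q \<omega> - m\<bar> / l \<le> (\<bar>W \<omega>\<bar> + b / l + \<bar>t \<omega> - m\<bar>) / l"
      using l by (intro divide_right_mono) auto
    then show ?thesis
      unfolding Rt_eq using lip[OF q_nonneg m_nonneg, of \<omega>] by linarith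
  qed
  have "\<bar>expectation (\<lambda>\<omega>. ?Rt \<omega> $$ (i, i)) - 1 / (l * (1 + m))\<bar>
      = \<bar>expectation (\<lambda>\<omega>. ?Rt \<omega> $$ (i, i) - 1 / (l * (1 + m)))\<bar>"
    using Rt_int by (simp add: prob_space)
  also have "\<dots> \<le> expectation (\<lambda>\<omega>. \<bar>?Rt \<omega> $$ (i, i) - 1 / (l * (1 + m))\<bar>)"
    by (rule integral_abs_bound)
  also have "\<dots> \<le> expectation (\<lambda>\<omega>. (\<bar>W \<omega>\<bar> + b / l + \<bar>t \<omega> - m\<bar>) / l)"
    using ptw Rt_int W(1) t_int by (intro integral_mono) auto
  also have "\<dots> = (expectation (\<lambda>\<omega>. \<bar>W \<omega>\<bar>) + b / l + expectation (\<lambda>\<omega>. \<bar>t \<omega> - m\<bar>)) / l"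
    using W(1) t_int by (simp add: prob_space)
  also have "\<dots> \<le> (sqrt ((2 * \<kappa> + 8 * b\<^sup>2) * P) / l + b / l + 4 * b * sqrt N / l) / l"
    using W(2) t_dev l by (intro divide_right_mono add_mono) auto
  finally show ?thesis
    unfolding m_eq .
qed

end

section \<open>Convergence of normalized traces\<close>

text \<open>A common bound \<open>m\<close> on both dimensions lets one error \<open>\<eta>\<close>
  cover the row and the column equations, and \<open>b * m\<close> bounds the row sums and column
  sums of the variances alike.\<close>

lemma (in independent_entries) expected_resolvent_close:
  fixes T Tt :: "nat \<Rightarrow> real"
  assumes T: "\<And>j. j < P \<Longrightarrow> 0 \<le> T j" "\<And>j. j < P \<Longrightarrow> T j \<le> 1 / l"
    and Tt: "\<And>i. i < N \<Longrightarrow> 0 \<le> Tt i" "\<And>i. i < N \<Longrightarrow> Tt i \<le> 1 / l"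
    and T_eq: "\<And>j. j < P \<Longrightarrow> T j = 1 / (l * (1 + (\<Sum>i<N. v i j * Tt i)))"
    and Tt_eq: "\<And>i. i < N \<Longrightarrow> Tt i = 1 / (l * (1 + (\<Sum>j<P. v i j * T j)))"
    and m: "real N \<le> m" "real P \<le> m"
  defines "\<eta> \<equiv> (sqrt ((2 * \<kappa> + 8 * b\<^sup>2) * m) / l + b / l + 4 * b * sqrt m / l) / l"
  assumes small: "\<eta> * (l + b * m) \<le> 1 / 2" and j: "j < P"
  shows "\<bar>expectation (\<lambda>\<omega>. resolvent l (Y \<omega>) $$ (j, j)) - T j\<bar>
    \<le> 2 * (\<eta> * (l + b * m)) * (1 + b * m / l) / l"
proof -
  interpret tr: independent_entries M "\<lambda>j i. y i j" P N "\<lambda>j i. v i j" b \<kappa> l by (rule transpose)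
  have tY: "transpose_mat (Y \<omega>) = tr.Y \<omega>" and tY': "transpose_mat (tr.Y \<omega>) = Y \<omega>" for \<omega>
    unfolding Y_def tr.Y_def by (auto intro!: eq_matI)
  \<comment> \<open>On the disjoint union of the row and column indices the two coupled families of equations
    become a single system.\<close>
  define w :: "nat + nat \<Rightarrow> nat + nat \<Rightarrow> real" where
    "w k k' = (case k of Inl i \<Rightarrow> (case k' of Inl _ \<Rightarrow> 0 | Inr j \<Rightarrow> v i j)
      | Inr j \<Rightarrow> (case k' of Inl i \<Rightarrow> v i j | Inr _ \<Rightarrow> 0))" for k k'
  define x where "x k = (case k of Inl i \<Rightarrow> expectation (\<lambda>\<omega>. resolvent l (tr.Y \<omega>) $$ (i, i))
    | Inr j \<Rightarrow> expectation (\<lambda>\<omega>. resolvent l (Y \<omega>) $$ (j, j)))" for k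
  define z where "z k = (case k of Inl i \<Rightarrow> Tt i | Inr j \<Rightarrow> T j)" for k
  let ?I = "{..<N} <+> {..<P}"
  have sums: "(\<Sum>m\<in>?I. w (Inl i) m * h m) = (\<Sum>j<P. v i j * h (Inr j))"
    "(\<Sum>m\<in>?I. w (Inr j) m * h m) = (\<Sum>i<N. v i j * h (Inl i))" for i j and h :: "nat + nat \<Rightarrow> real"
    by (simp_all add: sum.Plus w_def)
  have m0: "0 \<le> m" using m(1) by linarith
  have eta_mono: "(sqrt ((2 * \<kappa> + 8 * b\<^sup>2) * r) / l + b / l + 4 * b * sqrt s / l) / l \<le> \<eta>"
    if "r \<le> m" "s \<le> m" for r s
    unfolding \<eta>_def using that l b kappa_nonneg m0
    by (intro divide_right_mono add_mono mult_left_mono real_sqrt_le_mono) auto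
  have E_bounds: "0 \<le> expectation f \<and> expectation f \<le> 1 / l"
    if "integrable M f" "\<And>\<omega>. 0 \<le> f \<omega>" "\<And>\<omega>. f \<omega> \<le> 1 / l" for f
  proof
    show "0 \<le> expectation f" using that by (intro integral_nonneg_AE AE_I2) auto
    have "expectation f \<le> expectation (\<lambda>_. 1 / l)" using that by (intro integral_mono) auto
    then show "expectation f \<le> 1 / l" by (simp add: prob_space)
  qed
  have "\<bar>x (Inr j) - z (Inr j)\<bar> \<le> 2 * (\<eta> * (l + b * m)) * (1 + b * m / l) / l"
  proof (rule fixed_point_stability[where I = ?I and w = w])
    show "finite ?I" by simp
    show "0 < l" by (rule l)
    fix k assume k: "k \<in> ?I"
    show "0 \<le> w k k'" if "k' \<in> ?I" for k'
      using k that var_nonneg by (auto simp: w_def)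
    show "(\<Sum>m\<in>?I. w k m) \<le> b * m"
    proof (cases k)
      case (Inl i)
      then have i: "i < N" using k by auto
      have "(\<Sum>m\<in>?I. w k m) = (\<Sum>j<P. v i j)" using sums(1)[of i "\<lambda>_. 1"] by (simp add: Inl)
      also have "\<dots> \<le> (\<Sum>j<P. b)" using var_le[OF i] by (intro sum_mono) auto
      also have "\<dots> \<le> b * m" using m b by (simp add: mult.commute)
      finally show ?thesis .
    next
      case (Inr j)
      then have j: "j < P" using k by auto
      have "(\<Sum>m\<in>?I. w k m) = (\<Sum>i<N. v i j)" using sums(2)[of j "\<lambda>_. 1"] by (simp add: Inr)
      also have "\<dots> \<le> (\<Sum>i<N. b)" using var_le j by (intro sum_mono) auto
      also have "\<dots> \<le> b * m" using m b by (simp add: mult.commute)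
      finally show ?thesis .
    qed
    show "0 \<le> x k" "x k \<le> 1 / l"
      using k E_bounds[OF resolvent_Y_diag_integrable resolvent_diag_bounds[OF Y_carrier l]]
        E_bounds[OF tr.resolvent_Y_diag_integrable resolvent_diag_bounds[OF tr.Y_carrier l]]
      by (auto simp: x_def)
    show "0 \<le> z k" "z k \<le> 1 / l"
      using k T Tt by (auto simp: z_def)
    show "z k = 1 / (l * (1 + (\<Sum>m\<in>?I. w k m * z m)))"
    proof (cases k)
      case (Inl i)
      then show ?thesis using k Tt_eq[of i] sums(1)[of i z] by (auto simp: z_def)
    next
      case (Inr j)
      then show ?thesis using k T_eq[of j] sums(2)[of j z] by (auto simp: z_def)
    qed
    show "\<bar>x k - 1 / (l * (1 + (\<Sum>m\<in>?I. w k m * x m)))\<bar> \<le> \<eta>"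
    proof (cases k)
      case (Inl i)
      then have i: "i < N" using k by auto
      show ?thesis
        unfolding Inl sums(1) using expected_resolvent_fixed_point[OF i] eta_mono[OF m(2) m(1)]
        by (simp add: x_def tY)
    next
      case (Inr j)
      then have j: "j < P" using k by auto
      show ?thesis
        unfolding Inr sums(2) using tr.expected_resolvent_fixed_point[OF j] eta_mono[OF m(1) m(2)]
        by (simp add: x_def tY')
    qed
  qed (use small j in auto)
  then show ?thesis by (simp add: x_def z_def)
qed

text \<open>First Borel-Cantelli lemma for each tolerance, then a countable intersection over the
  tolerances \<open>1 / Suc k\<close>. No joint information on different \<open>n\<close>
  enters.\<close>

lemma (in prob_space) AE_tendsto_zero_exponential_tail:
  fixes h :: "nat \<Rightarrow> 'a \<Rightarrow> real"
  assumes meas: "\<forall>\<^sub>F n in sequentially. h n \<in> borel_measurable M"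
    and tail: "\<And>\<epsilon>. \<epsilon> > 0 \<Longrightarrow> \<exists>a>0. \<forall>\<^sub>F n in sequentially.
      measure M {\<omega> \<in> space M. \<epsilon> \<le> \<bar>h n \<omega>\<bar>} \<le> 2 * exp (- a * real n)"
  shows "AE \<omega> in M. (\<lambda>n. h n \<omega>) \<longlonglongrightarrow> 0"
proof -
  have "AE \<omega> in M. \<forall>\<^sub>F n in sequentially. \<bar>h n \<omega>\<bar> < \<epsilon>" if \<epsilon>: "\<epsilon> > 0" for \<epsilon>
  proof -
    obtain a where a: "a > 0" and ev: "\<forall>\<^sub>F n in sequentially.
      measure M {\<omega> \<in> space M. \<epsilon> \<le> \<bar>h n \<omega>\<bar>} \<le> 2 * exp (- a * real n)"
      using tail[OF \<epsilon>] by blast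
    obtain N0 where N0: "\<And>n. n \<ge> N0 \<Longrightarrow> h n \<in> borel_measurable M"
      "\<And>n. n \<ge> N0 \<Longrightarrow> measure M {\<omega> \<in> space M. \<epsilon> \<le> \<bar>h n \<omega>\<bar>} \<le> 2 * exp (- a * real n)"
      using eventually_conj[OF meas ev] unfolding eventually_sequentially by blast
    \<comment> \<open>Empty below \<open>N0\<close>, because measurability and the tail bound are
      only available eventually.\<close>
    define A where "A n = (if n \<ge> N0 then {\<omega> \<in> space M. \<epsilon> \<le> \<bar>h n \<omega>\<bar>} else {})" for n
    have A: "A n \<in> events" for n
      unfolding A_def using N0(1)[of n] by auto
    have "summable (\<lambda>n. 2 * exp (- a) ^ n)"
      using a by (intro summable_mult summable_geometric) auto
    then have "summable (\<lambda>n. measure M (A n))"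
    proof (rule summable_comparison_test[rotated])
      have "norm (measure M (A n)) \<le> 2 * exp (- a) ^ n" if "n \<ge> N0" for n
        using N0(2)[OF that] that by (simp add: A_def exp_of_nat_mult[symmetric] mult.commute)
      then show "\<exists>N. \<forall>n\<ge>N. norm (measure M (A n)) \<le> 2 * exp (- a) ^ n" by blast
    qed
    then have "AE \<omega> in M. \<forall>\<^sub>F n in sequentially. \<omega> \<in> space M - A n"
      using A by (intro borel_cantelli_AE1) (auto simp: emeasure_eq_measure)
    then show ?thesis
    proof eventually_elim
      case (elim \<omega>)
      then show ?case
        using eventually_ge_at_top[of N0] by eventually_elim (auto simp: A_def)
    qed
  qed
  then have "AE \<omega> in M. \<forall>k. \<forall>\<^sub>F n in sequentially. \<bar>h n \<omega>\<bar> < 1 / real (Suc k)"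
    by (subst AE_all_countable) auto
  then show ?thesis
  proof eventually_elim
    case (elim \<omega>)
    show ?case
      unfolding tendsto_iff
    proof safe
      fix e :: real assume "0 < e"
      then obtain k where k: "1 / real (Suc k) < e"
        using nat_approx_posE by (metis of_nat_Suc)
      show "\<forall>\<^sub>F n in sequentially. dist (h n \<omega>) 0 < e"
        using elim[rule_format, of k] by eventually_elim (use k in auto)
    qed
  qed
qed

text \<open>\<open>n\<close> is only the scale; both dimensions are free functions of it, so that
  the result covers the design as well as its transpose.\<close>

lemma (in prob_space) normalized_resolvent_trace_convergence:
  fixes y :: "nat \<Rightarrow> nat \<Rightarrow> nat \<Rightarrow> 'a \<Rightarrow> real" and N P :: "nat \<Rightarrow> nat"
    and v :: "nat \<Rightarrow> nat \<Rightarrow> nat \<Rightarrow> real" and T Tt :: "nat \<Rightarrow> nat \<Rightarrow> real"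
  assumes IE: "\<forall>\<^sub>F n in sequentially. independent_entries M (y n) (N n) (P n) (v n) (B / real n) (K / (real n)\<^sup>2) l"
    and dims: "\<forall>\<^sub>F n in sequentially. 0 < N n \<and> real (N n) \<le> C * real n \<and> real (P n) \<le> C * real n"
    and T: "\<forall>\<^sub>F n in sequentially. \<forall>j<P n. 0 \<le> T n j \<and> T n j \<le> 1 / l
      \<and> T n j = 1 / (l * (1 + (\<Sum>i<N n. v n i j * Tt n i)))"
    and Tt: "\<forall>\<^sub>F n in sequentially. \<forall>i<N n. 0 \<le> Tt n i \<and> Tt n i \<le> 1 / l
      \<and> Tt n i = 1 / (l * (1 + (\<Sum>j<P n. v n i j * T n j)))"
    and B: "0 < B" and K: "0 \<le> K" and l: "0 < l" and C: "1 \<le> C"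
  shows "AE \<omega> in M. (\<lambda>n. ((\<Sum>j<P n. resolvent l (Matrix.mat (N n) (P n) (\<lambda>(i, j). y n i j \<omega>)) $$ (j, j))
    - (\<Sum>j<P n. T n j)) / real n) \<longlonglongrightarrow> 0"
proof -
  define t where "t n \<omega> = (\<Sum>j<P n. resolvent l (Matrix.mat (N n) (P n) (\<lambda>(i, j). y n i j \<omega>)) $$ (j, j))" for n \<omega>
  define h where "h n \<omega> = (t n \<omega> - expectation (t n)) / real n" for n \<omega>
  have n1: "\<forall>\<^sub>F n in sequentially. 0 < (n :: nat)" by (rule eventually_gt_at_top)
  have h: "AE \<omega> in M. (\<lambda>n. h n \<omega>) \<longlonglongrightarrow> 0"
  proof (rule AE_tendsto_zero_exponential_tail)
    show "\<forall>\<^sub>F n in sequentially. h n \<in> borel_measurable M"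
      using IE
    proof eventually_elim
      case (elim n)
      interpret ie: independent_entries M "y n" "N n" "P n" "v n" "B / real n" "K / (real n)\<^sup>2" l by (rule elim)
      have "t n = (\<lambda>\<omega>. \<Sum>j<P n. resolvent l (ie.Y \<omega>) $$ (j, j))"
        by (simp add: t_def ie.Y_def fun_eq_iff)
      then have "t n \<in> borel_measurable M" by simp
      then show ?case unfolding h_def by measurable
    qed
    fix \<epsilon> :: real assume \<epsilon>: "\<epsilon> > 0"
    \<comment> \<open>Minimizer of \<open>s^2 C / (2 l^2) - s \<epsilon>\<close>, the exponent per
      unit of \<open>n\<close>; the minimum is \<open>-a\<close> for the \<open>a\<close> defined
      next.\<close>
    define s where "s = \<epsilon> * l\<^sup>2 / C"
    have s: "s > 0" using \<epsilon> l C by (simp add: s_def)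
    define a where "a = \<epsilon>\<^sup>2 * l\<^sup>2 / (2 * C)"
    have a: "a > 0" using \<epsilon> l C by (simp add: a_def)
    have "\<forall>\<^sub>F n in sequentially. measure M {\<omega> \<in> space M. \<epsilon> \<le> \<bar>h n \<omega>\<bar>} \<le> 2 * exp (- a * real n)"
      using IE dims n1
    proof eventually_elim
      case (elim n)
      interpret ie: independent_entries M "y n" "N n" "P n" "v n" "B / real n" "K / (real n)\<^sup>2" l by (rule elim)
      have t_eq: "t n = (\<lambda>\<omega>. \<Sum>j<P n. 1 * resolvent l (ie.Y \<omega>) $$ (j, j))"
        by (simp add: t_def ie.Y_def fun_eq_iff)
      have "measure M {\<omega> \<in> space M. \<epsilon> * real n \<le> \<bar>t n \<omega> - expectation (t n)\<bar>}
        \<le> 2 * exp (s\<^sup>2 * (1 / l)\<^sup>2 / 2 * N n - s * (\<epsilon> * real n))"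
        unfolding t_eq using elim s by (intro ie.weighted_trace_tail) auto
      also have "{\<omega> \<in> space M. \<epsilon> * real n \<le> \<bar>t n \<omega> - expectation (t n)\<bar>} = {\<omega> \<in> space M. \<epsilon> \<le> \<bar>h n \<omega>\<bar>}"
        using elim by (simp add: h_def le_divide_eq)
      also have "s\<^sup>2 * (1 / l)\<^sup>2 / 2 * N n - s * (\<epsilon> * real n) \<le> - a * real n"
      proof -
        have "s\<^sup>2 * (1 / l)\<^sup>2 / 2 * N n \<le> s\<^sup>2 * (1 / l)\<^sup>2 / 2 * (C * real n)"
          using elim by (intro mult_left_mono) auto
        also have "\<dots> = a * real n"
          using l C by (simp add: s_def a_def power2_eq_square field_simps)
        also have "\<dots> = s * (\<epsilon> * real n) - a * real n"
          using l C by (simp add: s_def a_def power2_eq_square field_simps)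
        finally show ?thesis by simp
      qed
      finally show ?case by simp
    qed
    with a show "\<exists>a>0. \<forall>\<^sub>F n in sequentially. measure M {\<omega> \<in> space M. \<epsilon> \<le> \<bar>h n \<omega>\<bar>} \<le> 2 * exp (- a * real n)"
      by blast
  qed
  \<comment> \<open>The error of \<open>expected_resolvent_close\<close> at \<open>m = C * n\<close>
    with the scaled bounds inserted; its terms are O(n^-1/2) or O(1/n).\<close>
  define \<eta> where "\<eta> n = (sqrt ((2 * (K / (real n)\<^sup>2) + 8 * (B / real n)\<^sup>2) * (C * real n)) / l + (B / real n) / l
    + 4 * (B / real n) * sqrt (C * real n) / l) / l" for n
  have \<eta>_lim: "\<eta> \<longlonglongrightarrow> 0"
  proof -
    have "\<forall>\<^sub>F n in sequentially. \<eta> n = (sqrt ((2 * K + 8 * B\<^sup>2) * C) / l * (1 / sqrt (real n)) + B / l * (1 / real n)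
      + 4 * B * sqrt C / l * (1 / sqrt (real n))) / l"
      using n1
    proof eventually_elim
      case (elim n)
      have "(2 * (K / (real n)\<^sup>2) + 8 * (B / real n)\<^sup>2) * (C * real n) = (2 * K + 8 * B\<^sup>2) * C / real n"
        using elim by (simp add: field_simps power2_eq_square)
      moreover have "4 * (B / real n) * sqrt (C * real n) / l = 4 * B * sqrt C / l * (1 / sqrt (real n))"
      proof -
        have e: "sqrt (C * real n) / real n = sqrt C * (1 / sqrt (real n))"
          using elim by (simp add: real_sqrt_mult field_simps)
        have "4 * (B / real n) * sqrt (C * real n) / l = 4 * B / l * (sqrt (C * real n) / real n)" by simp
        then show ?thesis unfolding e by simp
      qed
      ultimately show ?case by (simp add: \<eta>_def real_sqrt_divide mult.commute)
    qed
    moreover have s0: "(\<lambda>n. 1 / sqrt (real n)) \<longlonglongrightarrow> 0"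
      using tendsto_real_sqrt[OF lim_1_over_n] by (simp add: real_sqrt_divide)
    have "(\<lambda>n. (sqrt ((2 * K + 8 * B\<^sup>2) * C) / l * (1 / sqrt (real n)) + B / l * (1 / real n)
      + 4 * B * sqrt C / l * (1 / sqrt (real n))) / l) \<longlonglongrightarrow>
      (sqrt ((2 * K + 8 * B\<^sup>2) * C) / l * 0 + B / l * 0 + 4 * B * sqrt C / l * 0) / l"
      using l by (intro tendsto_intros s0 lim_1_over_n) auto
    ultimately show ?thesis by (simp add: tendsto_cong)
  qed
  \<comment> \<open>The entrywise error times \<open>C\<close>, since at most \<open>C * n\<close>
    entries are summed and the sum is divided by \<open>n\<close>.\<close>
  define \<delta> where "\<delta> n = C * (2 * (\<eta> n * (l + B * C)) * (1 + B * C / l) / l)" for n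
  have \<delta>_lim: "\<delta> \<longlonglongrightarrow> 0"
  proof -
    have "\<delta> \<longlonglongrightarrow> C * (2 * (0 * (l + B * C)) * (1 + B * C / l) / l)"
      unfolding \<delta>_def using l by (intro tendsto_intros \<eta>_lim) auto
    then show ?thesis by simp
  qed
  have "(\<lambda>n. \<eta> n * (l + B * C)) \<longlonglongrightarrow> 0 * (l + B * C)"
    by (intro tendsto_intros \<eta>_lim)
  then have small: "\<forall>\<^sub>F n in sequentially. \<eta> n * (l + B * C) < 1 / 2"
    by (intro order_tendstoD(2)[of _ 0]) auto
  have close: "\<forall>\<^sub>F n in sequentially. \<bar>(expectation (t n) - (\<Sum>j<P n. T n j)) / real n\<bar> \<le> \<delta> n"
    using IE dims T Tt small n1
  proof eventually_elim
    case (elim n)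
    interpret ie: independent_entries M "y n" "N n" "P n" "v n" "B / real n" "K / (real n)\<^sup>2" l by (rule elim)
    have t_eq: "t n = (\<lambda>\<omega>. \<Sum>j<P n. resolvent l (ie.Y \<omega>) $$ (j, j))"
      by (simp add: t_def ie.Y_def fun_eq_iff)
    have bm: "B / real n * (C * real n) = B * C" using elim(6) by simp
    have each: "\<bar>expectation (\<lambda>\<omega>. resolvent l (ie.Y \<omega>) $$ (j, j)) - T n j\<bar> \<le> \<delta> n / C" if j: "j < P n" for j
    proof -
      have sm: "\<eta> n * (l + B / real n * (C * real n)) \<le> 1 / 2" using elim(5) unfolding bm by simp
      have "\<bar>expectation (\<lambda>\<omega>. resolvent l (ie.Y \<omega>) $$ (j, j)) - T n j\<bar>
        \<le> 2 * (\<eta> n * (l + B / real n * (C * real n))) * (1 + B / real n * (C * real n) / l) / l"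
        unfolding \<eta>_def
      proof (rule ie.expected_resolvent_close[of "T n" "Tt n", OF _ _ _ _ _ _ _ _ sm[unfolded \<eta>_def] j])
        fix j assume "j < P n"
        with elim(3) show "0 \<le> T n j" "T n j \<le> 1 / l" "T n j = 1 / (l * (1 + (\<Sum>i<N n. v n i j * Tt n i)))"
          by blast+
      next
        fix i assume "i < N n"
        with elim(4) show "0 \<le> Tt n i" "Tt n i \<le> 1 / l" "Tt n i = 1 / (l * (1 + (\<Sum>j<P n. v n i j * T n j)))"
          by blast+
      qed (use elim(2) in auto)
      then show ?thesis using C unfolding bm by (simp add: \<delta>_def)
    qed
    have "expectation (t n) = (\<Sum>j<P n. expectation (\<lambda>\<omega>. resolvent l (ie.Y \<omega>) $$ (j, j)))"
      unfolding t_eq by (intro Bochner_Integration.integral_sum ie.resolvent_Y_diag_integrable) auto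
    then have "\<bar>expectation (t n) - (\<Sum>j<P n. T n j)\<bar>
      = \<bar>\<Sum>j<P n. expectation (\<lambda>\<omega>. resolvent l (ie.Y \<omega>) $$ (j, j)) - T n j\<bar>"
      by (simp add: sum_subtractf)
    also have "\<dots> \<le> (\<Sum>j<P n. \<delta> n / C)"
      using each by (intro order.trans[OF sum_abs] sum_mono) auto
    also have "\<dots> = real (P n) * (\<delta> n / C)" by simp
    also have "\<dots> \<le> (C * real n) * (\<delta> n / C)"
    proof (cases "P n = 0")
      case True
      have "0 \<le> \<eta> n" unfolding \<eta>_def using B K C l elim(6) by (intro divide_nonneg_pos add_nonneg_nonneg) auto
      then have "0 \<le> \<delta> n" unfolding \<delta>_def using B C l by (intro mult_nonneg_nonneg divide_nonneg_pos) auto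
      then show ?thesis using True C by simp
    next
      case False
      then have "0 \<le> \<delta> n / C" using each[of 0] by linarith
      then show ?thesis using elim(2) by (intro mult_right_mono) auto
    qed
    also have "\<dots> = \<delta> n * real n" using C by simp
    finally show ?case using elim(6) by (simp add: abs_divide divide_le_eq)
  qed
  have det: "(\<lambda>n. (expectation (t n) - (\<Sum>j<P n. T n j)) / real n) \<longlonglongrightarrow> 0"
    by (rule Lim_null_comparison[OF _ \<delta>_lim]) (use close in simp)
  show ?thesis
    using h
  proof eventually_elim
    case (elim \<omega>)
    have "(\<lambda>n. h n \<omega> + (expectation (t n) - (\<Sum>j<P n. T n j)) / real n) \<longlonglongrightarrow> 0 + 0"
      by (intro tendsto_add elim det)
    then show ?case
      by (simp add: h_def t_def add_divide_distrib[symmetric])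
  qed
qed

section \<open>Training risk and degrees of freedom\<close>

text \<open>With this factor the Gram matrix is the sample covariance, and the ridge parameter is
  the spectral parameter of the resolvent.\<close>

definition scaled :: "nat \<Rightarrow> real mat \<Rightarrow> real mat" where
  "scaled n X = (1 / sqrt (real n)) \<cdot>\<^sub>m X"

lemma scaled_carrier [simp]: "X \<in> carrier_mat N P \<Longrightarrow> scaled n X \<in> carrier_mat N P"
  by (simp add: scaled_def)

context
  fixes X :: "real mat" and n p :: nat and lam :: real
  assumes X: "X \<in> carrier_mat n p" and n: "n > 0" and lam: "lam > 0"
begin

lemma scaled_transpose_mult: "transpose_mat (scaled n X) * scaled n X = sample_cov n X"
proof -
  have "transpose_mat (scaled n X) = (1 / sqrt (real n)) \<cdot>\<^sub>m transpose_mat X"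
    unfolding scaled_def by (intro eq_matI) auto
  then have "transpose_mat (scaled n X) * scaled n X
      = (1 / sqrt (real n)) \<cdot>\<^sub>m ((1 / sqrt (real n)) \<cdot>\<^sub>m (transpose_mat X * X))"
    unfolding scaled_def using X
    by (simp add: mult_smult_distrib[of _ p n _ p] mult_smult_assoc_mat[of _ p n _ p])
  also have "\<dots> = sample_cov n X"
    unfolding sample_cov_def using X n by (intro eq_matI) auto
  finally show ?thesis .
qed

lemma gram_reg_scaled: "gram_reg lam (scaled n X) = sample_cov n X + lam \<cdot>\<^sub>m 1\<^sub>m p"
  unfolding gram_reg_def scaled_transpose_mult using X by (simp add: scaled_def)

text \<open>Diagonal entries of the identity \<open>S R + lam R = 1\<close>, where \<open>S\<close>
  is the sample covariance and \<open>R\<close> its resolvent.\<close>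

lemma df1_hat_eq:
  assumes p: "p > 0"
  shows "df1_hat n p lam X = 1 - lam / real p * (\<Sum>j<p. resolvent lam (scaled n X) $$ (j, j))"
proof -
  let ?R = "resolvent lam (scaled n X)"
  note R = resolvent_carrier[OF scaled_carrier[OF X, of n] lam]
  have S: "sample_cov n X \<in> carrier_mat p p" using X by (simp add: sample_cov_def)
  have R_eq: "minv (sample_cov n X + lam \<cdot>\<^sub>m 1\<^sub>m p) = ?R"
    unfolding resolvent_def gram_reg_scaled ..
  have "(sample_cov n X + lam \<cdot>\<^sub>m 1\<^sub>m p) * ?R = sample_cov n X * ?R + lam \<cdot>\<^sub>m ?R"
    using S R by (simp add: add_mult_distrib_mat[of _ p p _ _ p] mult_smult_assoc_mat[of _ p p _ p])
  then have one: "sample_cov n X * ?R + lam \<cdot>\<^sub>m ?R = 1\<^sub>m p"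
    using gram_reg_mult_resolvent[OF scaled_carrier[OF X, of n] lam] by (simp add: gram_reg_scaled)
  have diag: "(sample_cov n X * ?R) $$ (j, j) = 1 - lam * ?R $$ (j, j)" if "j < p" for j
  proof -
    have "(sample_cov n X * ?R + lam \<cdot>\<^sub>m ?R) $$ (j, j) = 1"
      unfolding one using that by simp
    moreover have "(sample_cov n X * ?R + lam \<cdot>\<^sub>m ?R) $$ (j, j) = (sample_cov n X * ?R) $$ (j, j) + lam * ?R $$ (j, j)"
      using R that by (subst index_add_mat) auto
    ultimately show ?thesis by linarith
  qed
  have "mtrace (sample_cov n X * ?R) = (\<Sum>j<p. 1 - lam * ?R $$ (j, j))"
    unfolding mtrace_def using S diag by (auto intro!: sum.cong)
  also have "\<dots> = real p - lam * (\<Sum>j<p. ?R $$ (j, j))"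
    by (simp add: sum_subtractf sum_distrib_left)
  finally show ?thesis
    using p unfolding df1_hat_def R_eq by (simp add: field_simps)
qed

text \<open>The fitted vector is \<open>A R A^T y\<close>, because the penalty
  \<open>n * lam\<close> becomes \<open>lam\<close> after scaling; the push-through identity then
  turns the residual into \<open>lam\<close> times the companion resolvent applied to
  \<open>y\<close>.\<close>

lemma residual_sq_eq:
  assumes y: "y \<in> carrier_vec n"
  shows "residual_sq n lam X y
    = lam\<^sup>2 * scalar_prod (resolvent lam (transpose_mat (scaled n X)) *\<^sub>v y)
        (resolvent lam (transpose_mat (scaled n X)) *\<^sub>v y)"
proof -
  let ?A = "scaled n X"
  let ?R = "resolvent lam ?A" and ?Q = "resolvent lam (transpose_mat ?A)"
  note A = scaled_carrier[OF X, of n]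
  note R = resolvent_carrier[OF A lam]
  have At: "transpose_mat ?A \<in> carrier_mat p n" using A by simp
  note Q = resolvent_carrier[OF At lam]
  have XtX: "transpose_mat X * X + (real n * lam) \<cdot>\<^sub>m 1\<^sub>m (dim_col X) = real n \<cdot>\<^sub>m gram_reg lam ?A"
    unfolding gram_reg_scaled sample_cov_def using X n by (intro eq_matI) (auto simp: algebra_simps)
  have "minv (real n \<cdot>\<^sub>m gram_reg lam ?A) = (1 / real n) \<cdot>\<^sub>m ?R"
  proof (rule minv_eqI)
    note G = gram_reg_carrier[OF A lam]
    show "real n \<cdot>\<^sub>m gram_reg lam ?A * (1 / real n \<cdot>\<^sub>m ?R) = 1\<^sub>m p"
      using G R n gram_reg_mult_resolvent[OF A lam]
      by (subst mult_smult_distrib[of _ p p _ p], simp, simp,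
          subst mult_smult_assoc_mat[of _ p p _ p]) (auto intro!: eq_matI)
  qed (use gram_reg_carrier[OF A lam] R in auto)
  then have "X *\<^sub>v ridge n lam X y = X *\<^sub>v (((1 / real n) \<cdot>\<^sub>m ?R) *\<^sub>v (transpose_mat X *\<^sub>v y))"
    unfolding ridge_def XtX by simp
  also have "\<dots> = (?A * ?R * transpose_mat ?A) *\<^sub>v y"
  proof -
    have Xy: "transpose_mat X *\<^sub>v y \<in> carrier_vec p" using X y by auto
    have tA: "transpose_mat ?A = (1 / sqrt (real n)) \<cdot>\<^sub>m transpose_mat X"
      unfolding scaled_def by (intro eq_matI) auto
    have sm: "(c \<cdot>\<^sub>m B) *\<^sub>v v = c \<cdot>\<^sub>v (B *\<^sub>v v)" if "B \<in> carrier_mat r s" "v \<in> carrier_vec s"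
      for c :: real and B r s v
      using that by (intro eq_vecI) auto
    have RXy: "?R *\<^sub>v (transpose_mat X *\<^sub>v y) \<in> carrier_vec p" using R Xy by auto
    have "(?A * ?R * transpose_mat ?A) *\<^sub>v y = ?A *\<^sub>v (?R *\<^sub>v (transpose_mat ?A *\<^sub>v y))"
    proof -
      have "(?A * ?R * transpose_mat ?A) *\<^sub>v y = (?A * ?R) *\<^sub>v (transpose_mat ?A *\<^sub>v y)"
        using A R y by (intro assoc_mult_mat_vec[of _ n p]) auto
      also have "\<dots> = ?A *\<^sub>v (?R *\<^sub>v (transpose_mat ?A *\<^sub>v y))"
        using A R y by (intro assoc_mult_mat_vec[of _ n p]) auto
      finally show ?thesis .
    qed
    also have "\<dots> = (1 / sqrt (real n)) \<cdot>\<^sub>v (X *\<^sub>v ((1 / sqrt (real n)) \<cdot>\<^sub>v (?R *\<^sub>v (transpose_mat X *\<^sub>v y))))"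
      using X R Xy RXy y unfolding tA
      by (simp add: sm[of "transpose_mat X" p n] mult_mat_vec[of ?R p p])
        (simp add: scaled_def sm[of X n p])
    also have "\<dots> = (1 / real n) \<cdot>\<^sub>v (X *\<^sub>v (?R *\<^sub>v (transpose_mat X *\<^sub>v y)))"
      using mult_mat_vec[OF X RXy] n by (simp add: smult_smult_assoc)
    also have "\<dots> = X *\<^sub>v (((1 / real n) \<cdot>\<^sub>m ?R) *\<^sub>v (transpose_mat X *\<^sub>v y))"
      using mult_mat_vec[OF X RXy] sm[OF R Xy] by simp
    finally show ?thesis ..
  qed
  finally have XR: "X *\<^sub>v ridge n lam X y = (?A * ?R * transpose_mat ?A) *\<^sub>v y" .
  have B: "?A * ?R * transpose_mat ?A \<in> carrier_mat n n" using A R by auto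
  have "lam \<cdot>\<^sub>m ?Q = 1\<^sub>m n - ?A * ?R * transpose_mat ?A"
    unfolding resolvent_transpose[OF A lam] using B lam by (intro eq_matI) auto
  then have "y - X *\<^sub>v ridge n lam X y = (lam \<cdot>\<^sub>m ?Q) *\<^sub>v y"
    unfolding XR using y minus_mult_distrib_mat_vec[OF one_carrier_mat B y] by simp
  also have "\<dots> = lam \<cdot>\<^sub>v (?Q *\<^sub>v y)"
    using Q y by (intro eq_vecI) auto
  finally have r: "y - X *\<^sub>v ridge n lam X y = lam \<cdot>\<^sub>v (?Q *\<^sub>v y)" .
  have "?Q *\<^sub>v y \<in> carrier_vec n" using Q y by auto
  then show ?thesis
    unfolding residual_sq_def Let_def r by (simp add: power2_eq_square)
qed

text \<open>With \<open>w\<close> the column \<open>i\<close> of \<open>Q\<close>, row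
  \<open>i\<close> of \<open>Q X\<close> is \<open>sqrt n\<close> times \<open>A^T w\<close>, and
  \<open>|A^T w|^2 = w . e_i - lam |w|^2\<close> by \<open>gram_reg_quad\<close>, as
  \<open>w\<close> solves \<open>(A A^T + lam) w = e_i\<close>. Averaging over the signal produces
  exactly these row norms.\<close>

lemma resolvent_mult_design_row_sq:
  assumes i: "i < n"
  defines "Q \<equiv> resolvent lam (transpose_mat (scaled n X))"
  shows "(\<Sum>j<p. ((Q * X) $$ (i, j))\<^sup>2) = real n * (Q $$ (i, i) - lam * (\<Sum>k<n. (Q $$ (k, i))\<^sup>2))"
proof -
  let ?A = "scaled n X"
  have A: "?A \<in> carrier_mat n p" and At: "transpose_mat ?A \<in> carrier_mat p n" using X by simp_all
  note Q = resolvent_carrier[OF At lam, folded Q_def]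
  define w where "w = Q *\<^sub>v unit_vec n i"
  have w: "w \<in> carrier_vec n" using Q by (simp add: w_def)
  have wi: "w $ k = Q $$ (k, i)" if "k < n" for k
    unfolding w_def Q_def by (rule resolvent_unit_vec_index[OF At lam i that])
  have AQ: "(Q * X) $$ (i, j) = sqrt (real n) * (transpose_mat ?A *\<^sub>v w) $ j" if j: "j < p" for j
  proof -
    have "(Q * X) $$ (i, j) = (\<Sum>k<n. Q $$ (i, k) * X $$ (k, j))"
      using Q X i j by (simp add: scalar_prod_def atLeast0LessThan)
    also have "\<dots> = (\<Sum>k<n. X $$ (k, j) * w $ k)"
      using resolvent_index_sym[OF At lam] i wi unfolding Q_def by (intro sum.cong) auto
    also have "\<dots> = sqrt (real n) * (\<Sum>k<n. ?A $$ (k, j) * w $ k)"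
      unfolding sum_distrib_left scaled_def using X j n by (intro sum.cong) auto
    also have "(\<Sum>k<n. ?A $$ (k, j) * w $ k) = (transpose_mat ?A *\<^sub>v w) $ j"
      using A w j by (simp add: scalar_prod_def atLeast0LessThan)
    finally show ?thesis .
  qed
  have "(\<Sum>j<p. ((Q * X) $$ (i, j))\<^sup>2) = real n * (\<Sum>j<p. ((transpose_mat ?A *\<^sub>v w) $ j)\<^sup>2)"
    unfolding sum_distrib_left using AQ by (intro sum.cong) (auto simp: power_mult_distrib simp del: index_mult_mat_vec)
  also have "(\<Sum>j<p. ((transpose_mat ?A *\<^sub>v w) $ j)\<^sup>2)
      = scalar_prod (transpose_mat ?A *\<^sub>v w) (transpose_mat ?A *\<^sub>v w)"
  proof -
    have "dim_vec (transpose_mat ?A *\<^sub>v w) = p" using A by simp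
    then show ?thesis unfolding scalar_prod_def by (simp add: atLeast0LessThan power2_eq_square del: index_mult_mat_vec)
  qed
  also have "\<dots> = scalar_prod w (unit_vec n i) - lam * scalar_prod w w"
  proof -
    have "gram_reg lam (transpose_mat ?A) *\<^sub>v w = unit_vec n i"
      unfolding w_def Q_def by (rule resolvent_gram_reg_vec(2)[OF At lam unit_vec_carrier])
    then show ?thesis using gram_reg_quad[OF At lam w] by (simp only: transpose_transpose)
  qed
  also have "scalar_prod w (unit_vec n i) = Q $$ (i, i)"
    unfolding w_def Q_def by (rule resolvent_diag_scalar_prod[OF At lam i])
  also have "scalar_prod w w = (\<Sum>k<n. (Q $$ (k, i))\<^sup>2)"
    unfolding w_def Q_def by (rule resolvent_col_scalar_prod[OF At lam i])
  finally show ?thesis .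
qed

end

text \<open>The candidate is verified by integrating over sets of \<open>F\<close>. The hypothesis
  \<open>cross\<close> combines independence of the \<open>\<xi>\<close> from \<open>F\<close> with
  their being uncorrelated; since the coefficients are bounded, second moments of the
  \<open>\<xi>\<close> suffice for integrability.\<close>

lemma (in finite_measure_subalgebra)
  fixes c :: "'i \<Rightarrow> 'j \<Rightarrow> 'a \<Rightarrow> real" and \<xi> :: "'j \<Rightarrow> 'a \<Rightarrow> real" and \<tau> :: "'j \<Rightarrow> real"
  assumes fin: "finite I" "finite J"
    and c [measurable]: "\<And>i a. i \<in> I \<Longrightarrow> a \<in> J \<Longrightarrow> c i a \<in> borel_measurable F"
    and bd: "\<And>i a \<omega>. i \<in> I \<Longrightarrow> a \<in> J \<Longrightarrow> \<bar>c i a \<omega>\<bar> \<le> K"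
    and cross: "\<And>f a b. f \<in> borel_measurable F \<Longrightarrow> bounded (range f) \<Longrightarrow> a \<in> J \<Longrightarrow> b \<in> J \<Longrightarrow>
      integrable M (\<lambda>\<omega>. f \<omega> * (\<xi> a \<omega> * \<xi> b \<omega>)) \<and>
      (\<integral>\<omega>. f \<omega> * (\<xi> a \<omega> * \<xi> b \<omega>) \<partial>M) = (\<integral>\<omega>. f \<omega> \<partial>M) * (if a = b then \<tau> a else 0)"
  shows integrable_quadratic: "integrable M (\<lambda>\<omega>. \<Sum>i\<in>I. (\<Sum>a\<in>J. c i a \<omega> * \<xi> a \<omega>)\<^sup>2)"
    and real_cond_exp_quadratic: "AE \<omega> in M. real_cond_exp M F (\<lambda>\<omega>. \<Sum>i\<in>I. (\<Sum>a\<in>J. c i a \<omega> * \<xi> a \<omega>)\<^sup>2) \<omega>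
      = (\<Sum>i\<in>I. \<Sum>a\<in>J. (c i a \<omega>)\<^sup>2 * \<tau> a)"
proof -
  have eq: "(\<Sum>a\<in>J. c i a \<omega> * \<xi> a \<omega>)\<^sup>2 = (\<Sum>a\<in>J. \<Sum>b\<in>J. c i a \<omega> * c i b \<omega> * (\<xi> a \<omega> * \<xi> b \<omega>))" for i \<omega>
    by (simp add: power2_eq_square sum_product mult_ac)
  have bd2: "\<bar>c i a \<omega> * c i b \<omega>\<bar> \<le> K * K" if "i \<in> I" "a \<in> J" "b \<in> J" for i a b \<omega>
    unfolding abs_mult using bd that order.trans[OF abs_ge_zero bd[OF that(1,2), of \<omega>]]
    by (intro mult_mono) auto
  \<comment> \<open>The indicator is absorbed into the coefficients, giving a bounded
    \<open>F\<close>-measurable factor to which \<open>cross\<close> applies.\<close>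
  have ind: "(\<lambda>\<omega>. indicator A \<omega> * (c i a \<omega> * c i b \<omega>)) \<in> borel_measurable F"
    "bounded (range (\<lambda>\<omega>. indicator A \<omega> * (c i a \<omega> * c i b \<omega>) :: real))"
    if "i \<in> I" "a \<in> J" "b \<in> J" "A \<in> sets F" for i a b A
  proof -
    show "(\<lambda>\<omega>. indicator A \<omega> * (c i a \<omega> * c i b \<omega>)) \<in> borel_measurable F"
      using that by measurable
    show "bounded (range (\<lambda>\<omega>. indicator A \<omega> * (c i a \<omega> * c i b \<omega>) :: real))"
      unfolding bounded_iff using bd2[OF that(1-3)] order.trans[OF abs_ge_zero bd2[OF that(1-3)]]
      by (auto intro!: exI[of _ "K * K"] simp: indicator_def)
  qed
  have sp: "space F = space M" using subalg by (simp add: subalgebra_def)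
  have top: "space M \<in> sets F" unfolding sp[symmetric] by simp
  have int: "integrable M (\<lambda>\<omega>. c i a \<omega> * c i b \<omega> * (\<xi> a \<omega> * \<xi> b \<omega>))"
    if "i \<in> I" "a \<in> J" "b \<in> J" for i a b
  proof -
    have "integrable M (\<lambda>\<omega>. indicator (space M) \<omega> * (c i a \<omega> * c i b \<omega>) * (\<xi> a \<omega> * \<xi> b \<omega>))"
      using cross[OF ind[OF that top] that(2,3)] by blast
    then show ?thesis by (subst (asm) Bochner_Integration.integrable_cong[OF refl]) auto
  qed
  have intA: "integrable M (\<lambda>\<omega>. indicator A \<omega> * (c i a \<omega> * c i b \<omega>))"
    if "i \<in> I" "a \<in> J" "b \<in> J" "A \<in> sets F" for i a b A
    using bd2[OF that(1-3)] order.trans[OF abs_ge_zero bd2[OF that(1-3)]]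
    by (intro integrable_const_bound[of _ "K * K"] AE_I2 measurable_from_subalg[OF subalg ind(1)[OF that]])
      (auto simp: indicator_def)
  show quad: "integrable M (\<lambda>\<omega>. \<Sum>i\<in>I. (\<Sum>a\<in>J. c i a \<omega> * \<xi> a \<omega>)\<^sup>2)"
    unfolding eq using int by (intro Bochner_Integration.integrable_sum) auto
  have intc: "integrable M (\<lambda>\<omega>. (c i a \<omega>)\<^sup>2)" if "i \<in> I" "a \<in> J" for i a
    using bd2[OF that that(2)] c[OF that]
    by (intro integrable_const_bound[of _ "K * K"] AE_I2 borel_measurable_power measurable_from_subalg[OF subalg])
      (auto simp: power2_eq_square)
  have diag: "integrable M (\<lambda>\<omega>. \<Sum>i\<in>I. \<Sum>a\<in>J. (c i a \<omega>)\<^sup>2 * \<tau> a)"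
    using intc by (intro Bochner_Integration.integrable_sum integrable_mult_left) auto
  show "AE \<omega> in M. real_cond_exp M F (\<lambda>\<omega>. \<Sum>i\<in>I. (\<Sum>a\<in>J. c i a \<omega> * \<xi> a \<omega>)\<^sup>2) \<omega>
      = (\<Sum>i\<in>I. \<Sum>a\<in>J. (c i a \<omega>)\<^sup>2 * \<tau> a)"
  proof (rule real_cond_exp_charact[OF _ quad diag])
    show "(\<lambda>\<omega>. \<Sum>i\<in>I. \<Sum>a\<in>J. (c i a \<omega>)\<^sup>2 * \<tau> a) \<in> borel_measurable F"
      by measurable
    fix A assume A: "A \<in> sets F"
    have "(\<integral>\<omega>\<in>A. (\<Sum>i\<in>I. (\<Sum>a\<in>J. c i a \<omega> * \<xi> a \<omega>)\<^sup>2) \<partial>M)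
      = (\<integral>\<omega>. (\<Sum>i\<in>I. \<Sum>a\<in>J. \<Sum>b\<in>J. indicator A \<omega> * (c i a \<omega> * c i b \<omega>) * (\<xi> a \<omega> * \<xi> b \<omega>)) \<partial>M)"
      unfolding set_lebesgue_integral_def eq
      by (intro Bochner_Integration.integral_cong) (auto simp: sum_distrib_left mult_ac)
    also have "\<dots> = (\<Sum>i\<in>I. \<Sum>a\<in>J. \<Sum>b\<in>J.
        (\<integral>\<omega>. indicator A \<omega> * (c i a \<omega> * c i b \<omega>) * (\<xi> a \<omega> * \<xi> b \<omega>) \<partial>M))"
      using cross[OF ind[OF _ _ _ A]]
      by (simp add: Bochner_Integration.integral_sum Bochner_Integration.integrable_sum)
    also have "\<dots> = (\<Sum>i\<in>I. \<Sum>a\<in>J. \<Sum>b\<in>J.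
        (\<integral>\<omega>. indicator A \<omega> * (c i a \<omega> * c i b \<omega>) \<partial>M) * (if a = b then \<tau> a else 0))"
      using cross[OF ind[OF _ _ _ A]] by (intro sum.cong refl) blast
    also have "\<dots> = (\<Sum>i\<in>I. \<Sum>a\<in>J. (\<integral>\<omega>. indicator A \<omega> * (c i a \<omega> * c i a \<omega>) \<partial>M) * \<tau> a)"
      using fin by (intro sum.cong refl) (simp add: if_distrib[of "(*) _"] cong: if_cong)
    also have "\<dots> = (\<integral>\<omega>. (\<Sum>i\<in>I. \<Sum>a\<in>J. indicator A \<omega> * (c i a \<omega> * c i a \<omega>) * \<tau> a) \<partial>M)"
      using intA[OF _ _ _ A]
      by (simp add: Bochner_Integration.integral_sum Bochner_Integration.integrable_sum)
    also have "\<dots> = (\<integral>\<omega>\<in>A. (\<Sum>i\<in>I. \<Sum>a\<in>J. (c i a \<omega>)\<^sup>2 * \<tau> a) \<partial>M)"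
      unfolding set_lebesgue_integral_def
      by (intro Bochner_Integration.integral_cong) (auto simp: sum_distrib_left power2_eq_square mult_ac)
    finally show "(\<integral>\<omega>\<in>A. (\<Sum>i\<in>I. (\<Sum>a\<in>J. c i a \<omega> * \<xi> a \<omega>)\<^sup>2) \<partial>M)
      = (\<integral>\<omega>\<in>A. (\<Sum>i\<in>I. \<Sum>a\<in>J. (c i a \<omega>)\<^sup>2 * \<tau> a) \<partial>M)" .
  qed
qed

text \<open>Functions measurable for the three generated sigma-algebras are independent real
  variables, since their preimages lie in the independent families; the product rule for
  expectations follows.\<close>

lemma (in prob_space) model_indep_expectation:
  fixes f0 f1 f2 :: "'a \<Rightarrow> real"
  assumes ind: "model_indep M n p \<beta> X \<epsilon>"
    and f0: "f0 \<in> borel_measurable (generated M {..<p} \<beta>)" "integrable M f0"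
    and f1: "f1 \<in> borel_measurable (design_sigma M n p X)" "integrable M f1"
    and f2: "f2 \<in> borel_measurable (generated M {..<n} \<epsilon>)" "integrable M f2"
  shows "integrable M (\<lambda>\<omega>. f0 \<omega> * f1 \<omega> * f2 \<omega>)"
    and "expectation (\<lambda>\<omega>. f0 \<omega> * f1 \<omega> * f2 \<omega>) = expectation f0 * expectation f1 * expectation f2"
proof -
  define V where "V k = [f0, f1, f2] ! k" for k :: nat
  define G where "G k = [generated M {..<p} \<beta>, design_sigma M n p X, generated M {..<n} \<epsilon>] ! k" for k :: nat
  have cases: "k = 0 \<or> k = 1 \<or> k = 2" if "k \<in> {..<3}" for k :: nat using that by auto
  have VG: "V k \<in> borel_measurable (G k)" and Vi: "integrable M (V k)" and Gs: "space (G k) = space M"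
    if "k \<in> {..<3}" for k
    using cases[OF that] f0 f1 f2
    by (auto simp: V_def G_def generated_def design_sigma_def numeral_2_eq_2)
  have G_ind: "indep_sets (\<lambda>k. sets (G k)) {..<3}"
  proof -
    have "[sets (generated M {..<p} \<beta>), sets (design_sigma M n p X), sets (generated M {..<n} \<epsilon>)] ! k
      = sets (G k)" if "k \<in> {..<3}" for k
      using cases[OF that] by (auto simp: G_def numeral_2_eq_2)
    then have "indep_sets (\<lambda>k. [sets (generated M {..<p} \<beta>), sets (design_sigma M n p X), sets (generated M {..<n} \<epsilon>)] ! k) {..<3}
      \<longleftrightarrow> indep_sets (\<lambda>k. sets (G k)) {..<3}"
      by (intro indep_sets_cong refl)
    then show ?thesis using ind by (simp add: model_indep_def)
  qed
  have V_ind: "indep_vars (\<lambda>_. borel) V {..<3}"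
    unfolding indep_vars_def2
  proof
    show "\<forall>k\<in>{..<3}. random_variable borel (V k)" using Vi by auto
    show "indep_sets (\<lambda>k. {V k -` A \<inter> space M |A. A \<in> sets borel}) {..<3}"
    proof (rule indep_sets_mono_sets[OF G_ind])
      fix k :: nat assume k: "k \<in> {..<3}"
      show "{V k -` A \<inter> space M |A. A \<in> sets borel} \<subseteq> sets (G k)"
        using measurable_sets[OF VG[OF k]] Gs[OF k] by auto
    qed
  qed
  have *: "integrable M (\<lambda>\<omega>. \<Prod>k<3. V k \<omega>)"
    "expectation (\<lambda>\<omega>. \<Prod>k<3. V k \<omega>) = (\<Prod>k<3. expectation (V k))"
    using Vi by (auto intro!: indep_vars_integrable indep_vars_lebesgue_integral V_ind)
  have prod3: "(\<Prod>k<3. h k) = h 0 * h 1 * h 2" for h :: "nat \<Rightarrow> real"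
    by (simp add: numeral_3_eq_3 numeral_2_eq_2)
  show "integrable M (\<lambda>\<omega>. f0 \<omega> * f1 \<omega> * f2 \<omega>)"
    "expectation (\<lambda>\<omega>. f0 \<omega> * f1 \<omega> * f2 \<omega>) = expectation f0 * expectation f1 * expectation f2"
    using * unfolding prod3 by (auto simp: V_def)
qed

lemma generated_measurable:
  assumes "i \<in> I"
  shows "V i \<in> borel_measurable (generated M I V)"
proof -
  have "(\<lambda>\<omega>. \<lambda>i\<in>I. V i \<omega>) \<in> measurable (generated M I V) (PiM I (\<lambda>_. borel))"
    unfolding generated_def by (intro measurable_vimage_algebra1) (auto simp: space_PiM)
  then have "(\<lambda>\<omega>. (\<lambda>i\<in>I. V i \<omega>) i) \<in> borel_measurable (generated M I V)"
    using assms by (rule measurable_compose[OF _ measurable_component_singleton])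
  then show ?thesis using assms by simp
qed


text \<open>The residual is \<open>lam * Q (X \<beta> + \<epsilon>)\<close>, linear in signal and
  noise with coefficients determined by the design. Conditionally on the design only squared
  coefficients times variances survive, and the row norms of \<open>Q X\<close> and of
  \<open>Q\<close> are known.\<close>

lemma (in prob_space) train_risk_hat_eq:
  fixes X :: "'a \<Rightarrow> real mat" and \<beta> \<epsilon> :: "nat \<Rightarrow> 'a \<Rightarrow> real"
  assumes X: "\<And>\<omega>. X \<omega> \<in> carrier_mat n p" and n: "n > 0" and lam: "lam > 0"
    and ind: "model_indep M n p \<beta> X \<epsilon>"
    and eps_indep: "indep_vars (\<lambda>_. borel) \<epsilon> {..<n}"
    and eps_int: "\<And>i. i < n \<Longrightarrow> integrable M (\<lambda>\<omega>. (\<epsilon> i \<omega>)\<^sup>2)"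
    and eps_mean: "\<And>i. i < n \<Longrightarrow> expectation (\<epsilon> i) = 0"
    and eps_sq: "\<And>i. i < n \<Longrightarrow> expectation (\<lambda>\<omega>. (\<epsilon> i \<omega>)\<^sup>2) = \<sigma>\<^sup>2"
    and beta_int: "\<And>j. j < p \<Longrightarrow> integrable M (\<lambda>\<omega>. (\<beta> j \<omega>)\<^sup>2)"
    and beta_mean: "\<And>j. j < p \<Longrightarrow> expectation (\<beta> j) = 0"
    and beta_cov: "\<And>j k. j < p \<Longrightarrow> k < p \<Longrightarrow>
        expectation (\<lambda>\<omega>. \<beta> j \<omega> * \<beta> k \<omega>) = (if j = k then \<alpha>\<^sup>2 / real p else 0)"
  defines "Q \<equiv> \<lambda>\<omega>. resolvent lam (transpose_mat (scaled n (X \<omega>)))"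
  shows "AE \<omega> in M. train_risk_hat M n p \<beta> X \<epsilon> lam \<omega>
    = lam\<^sup>2 * \<alpha>\<^sup>2 / real p * ((\<Sum>i<n. Q \<omega> $$ (i, i)) - lam * (\<Sum>i<n. \<Sum>k<n. (Q \<omega> $$ (k, i))\<^sup>2))
      + lam\<^sup>2 * \<sigma>\<^sup>2 / real n * (\<Sum>i<n. \<Sum>k<n. (Q \<omega> $$ (k, i))\<^sup>2)"
proof -
  define F where "F = design_sigma M n p X"
  have F_eq: "F = generated M ({..<n} \<times> {..<p}) (\<lambda>ij \<omega>. X \<omega> $$ ij)"
    by (simp add: F_def design_sigma_def)
  have sub: "sets (generated M {..<p} \<beta>) \<subseteq> events" "sets F \<subseteq> events" "sets (generated M {..<n} \<epsilon>) \<subseteq> events"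
  proof -
    have "[sets (generated M {..<p} \<beta>), sets F, sets (generated M {..<n} \<epsilon>)] ! k \<subseteq> events" if "k < 3" for k
      using ind that unfolding model_indep_def indep_sets_def F_def by blast
    from this[of 0] this[of 1] this[of 2]
    show "sets (generated M {..<p} \<beta>) \<subseteq> events" "sets F \<subseteq> events" "sets (generated M {..<n} \<epsilon>) \<subseteq> events"
      by (simp_all add: numeral_2_eq_2)
  qed
  have sp: "space (generated M I V) = space M" for I :: "'i set" and V :: "'i \<Rightarrow> 'a \<Rightarrow> real"
    by (simp add: generated_def)
  have subalg: "subalgebra M F" "subalgebra M (generated M {..<p} \<beta>)" "subalgebra M (generated M {..<n} \<epsilon>)"
    using sub by (auto simp: subalgebra_def F_eq sp)
  interpret sa: finite_measure_subalgebra M F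
    by unfold_locales (rule subalg(1))
  have X_meas: "(\<lambda>\<omega>. X \<omega> $$ (i, j)) \<in> borel_measurable F" if "i < n" "j < p" for i j
    unfolding F_eq using that by (intro generated_measurable[where V = "\<lambda>ij \<omega>. X \<omega> $$ ij"]) auto
  have beta_gen: "\<beta> j \<in> borel_measurable (generated M {..<p} \<beta>)" if "j < p" for j
    using that by (intro generated_measurable) auto
  have eps_gen: "\<epsilon> i \<in> borel_measurable (generated M {..<n} \<epsilon>)" if "i < n" for i
    using that by (intro generated_measurable) auto
  have beta_M: "\<beta> j \<in> borel_measurable M" if "j < p" for j
    by (rule measurable_from_subalg[OF subalg(2) beta_gen[OF that]])
  have eps_M: "\<epsilon> i \<in> borel_measurable M" if "i < n" for i
    by (rule measurable_from_subalg[OF subalg(3) eps_gen[OF that]])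
  have beta1: "integrable M (\<beta> j)" if "j < p" for j
    by (rule square_integrable_imp_integrable[OF beta_M[OF that] beta_int[OF that]])
  have eps1: "integrable M (\<epsilon> i)" if "i < n" for i
    by (rule square_integrable_imp_integrable[OF eps_M[OF that] eps_int[OF that]])
  have St: "transpose_mat (scaled n (X \<omega>)) \<in> carrier_mat p n" for \<omega>
    using X by simp
  have Qc: "Q \<omega> \<in> carrier_mat n n" for \<omega>
    unfolding Q_def by (rule resolvent_carrier[OF St lam])
  have Q_meas: "(\<lambda>\<omega>. Q \<omega> $$ (i, k)) \<in> borel_measurable F" if "i < n" "k < n" for i k
    unfolding Q_def
  proof (rule resolvent_measurable[OF St lam _ that])
    fix j i assume *: "j < p" "i < n"
    have "transpose_mat (scaled n (X \<omega>)) $$ (j, i) = 1 / sqrt (real n) * X \<omega> $$ (i, j)" for \<omega>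
      using X[of \<omega>] * by (simp add: scaled_def)
    then show "(\<lambda>\<omega>. transpose_mat (scaled n (X \<omega>)) $$ (j, i)) \<in> borel_measurable F"
      using X_meas[OF *(2,1)] by simp
  qed
  have QX: "(Q \<omega> * X \<omega>) $$ (i, j) = (\<Sum>k<n. Q \<omega> $$ (i, k) * X \<omega> $$ (k, j))" if "i < n" "j < p" for i j \<omega>
    using Qc[of \<omega>] X[of \<omega>] that by (simp add: scalar_prod_def atLeast0LessThan)
  have Q_col: "(\<Sum>k<n. (Q \<omega> $$ (k, i))\<^sup>2) \<le> 1 / lam\<^sup>2" if "i < n" for i \<omega>
    unfolding Q_def by (rule resolvent_col_sq_bound[OF St lam that])
  have Q_diag: "Q \<omega> $$ (i, i) \<le> 1 / lam" if "i < n" for i \<omega>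
    unfolding Q_def by (rule resolvent_diag_bounds[OF St lam that])
  have QX_sq: "(\<Sum>j<p. ((Q \<omega> * X \<omega>) $$ (i, j))\<^sup>2)
    = real n * (Q \<omega> $$ (i, i) - lam * (\<Sum>k<n. (Q \<omega> $$ (k, i))\<^sup>2))" if "i < n" for i \<omega>
    unfolding Q_def by (rule resolvent_mult_design_row_sq[OF X n lam that])
  \<comment> \<open>A sum type merges signal and noise into one vector \<open>\<xi>\<close> with
    coefficients \<open>c\<close> and variances \<open>\<tau>\<close>, so that mixed terms need no
    separate quadratic expansion.\<close>
  define c where "c i a \<omega> = (case a of Inl j \<Rightarrow> (Q \<omega> * X \<omega>) $$ (i, j) | Inr k \<Rightarrow> Q \<omega> $$ (i, k))"
    for i and a :: "nat + nat" and \<omega>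
  define \<xi> where "\<xi> a = (case a of Inl j \<Rightarrow> \<beta> j | Inr k \<Rightarrow> \<epsilon> k)" for a :: "nat + nat"
  define \<tau> where "\<tau> a = (case a of Inl j \<Rightarrow> \<alpha>\<^sup>2 / real p | Inr k \<Rightarrow> \<sigma>\<^sup>2)" for a :: "nat + nat"
  define J where "J = {..<p} <+> {..<n}"
  \<comment> \<open>The first entry bounds \<open>Q X\<close> through its row norms and
    \<open>Q_ii <= 1 / lam\<close>, the second bounds \<open>Q\<close> through its column norms.
    Thus the coefficients are bounded although the design is not.\<close>
  define K where "K = max (sqrt (real n * (1 / lam))) (1 / lam)"
  have residual: "residual_sq n lam (X \<omega>) (response n p \<beta> X \<epsilon> \<omega>)
    = lam\<^sup>2 * (\<Sum>i<n. (\<Sum>a\<in>J. c i a \<omega> * \<xi> a \<omega>)\<^sup>2)" for \<omega>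
  proof -
    let ?b = "Matrix.vec p (\<lambda>j. \<beta> j \<omega>)" and ?e = "Matrix.vec n (\<lambda>i. \<epsilon> i \<omega>)"
    have y: "response n p \<beta> X \<epsilon> \<omega> \<in> carrier_vec n"
      using X[of \<omega>] by (auto simp: response_def)
    have "Q \<omega> *\<^sub>v response n p \<beta> X \<epsilon> \<omega> = (Q \<omega> * X \<omega>) *\<^sub>v ?b + Q \<omega> *\<^sub>v ?e"
      unfolding response_def using Qc[of \<omega>] X[of \<omega>]
      by (simp add: mult_add_distrib_mat_vec[of _ n n])
    moreover have "((Q \<omega> * X \<omega>) *\<^sub>v ?b + Q \<omega> *\<^sub>v ?e) $ i = (\<Sum>a\<in>J. c i a \<omega> * \<xi> a \<omega>)" if i: "i < n" for i
    proof -
      have "((Q \<omega> * X \<omega>) *\<^sub>v ?b + Q \<omega> *\<^sub>v ?e) $ i = ((Q \<omega> * X \<omega>) *\<^sub>v ?b) $ i + (Q \<omega> *\<^sub>v ?e) $ i"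
        using Qc[of \<omega>] i by (intro index_add_vec) simp
      also have "((Q \<omega> * X \<omega>) *\<^sub>v ?b) $ i = (\<Sum>j<p. (Q \<omega> * X \<omega>) $$ (i, j) * \<beta> j \<omega>)"
      proof -
        have QXc: "Q \<omega> * X \<omega> \<in> carrier_mat n p" using Qc X by (rule mult_carrier_mat)
        have "(B *\<^sub>v ?b) $ i = (\<Sum>j<p. B $$ (i, j) * \<beta> j \<omega>)" if "B \<in> carrier_mat n p" for B
          using that i by (auto simp: scalar_prod_def atLeast0LessThan intro!: sum.cong)
        from this[OF QXc] show ?thesis .
      qed
      also have "(Q \<omega> *\<^sub>v ?e) $ i = (\<Sum>k<n. Q \<omega> $$ (i, k) * \<epsilon> k \<omega>)"
        using Qc[of \<omega>] i by (auto simp: scalar_prod_def atLeast0LessThan intro!: sum.cong)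
      finally show ?thesis
        by (simp add: J_def c_def \<xi>_def sum.Plus)
    qed
    moreover have "dim_vec ((Q \<omega> * X \<omega>) *\<^sub>v ?b + Q \<omega> *\<^sub>v ?e) = n"
      using Qc[of \<omega>] by simp
    ultimately have "scalar_prod (Q \<omega> *\<^sub>v response n p \<beta> X \<epsilon> \<omega>) (Q \<omega> *\<^sub>v response n p \<beta> X \<epsilon> \<omega>)
        = (\<Sum>i<n. (\<Sum>a\<in>J. c i a \<omega> * \<xi> a \<omega>)\<^sup>2)"
      unfolding scalar_prod_def by (auto simp: power2_eq_square atLeast0LessThan intro!: sum.cong)
    then show ?thesis
      using residual_sq_eq[OF X n lam y] by (simp add: Q_def)
  qed
  have c_meas: "c i a \<in> borel_measurable F" if "i \<in> {..<n}" "a \<in> J" for i a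
  proof (cases a)
    case (Inl j)
    then have j: "j < p" using that by (auto simp: J_def)
    have "c i a = (\<lambda>\<omega>. \<Sum>k<n. Q \<omega> $$ (i, k) * X \<omega> $$ (k, j))"
      using QX[of i j] that j by (auto simp: c_def Inl)
    then show ?thesis
      using that j Q_meas X_meas by (auto intro!: borel_measurable_sum borel_measurable_times)
  next
    case (Inr k)
    then have "c i a = (\<lambda>\<omega>. Q \<omega> $$ (i, k))" "k < n" using that by (auto simp: c_def J_def)
    then show ?thesis using that Q_meas by auto
  qed
  have c_bd: "\<bar>c i a \<omega>\<bar> \<le> K" if "i \<in> {..<n}" "a \<in> J" for i a \<omega>
  proof (cases a)
    case (Inl j)
    then have j: "j < p" using that by (auto simp: J_def)
    have i: "i < n" using that by simp
    have "((Q \<omega> * X \<omega>) $$ (i, j))\<^sup>2 \<le> (\<Sum>j<p. ((Q \<omega> * X \<omega>) $$ (i, j))\<^sup>2)"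
      using j by (intro member_le_sum[where f = "\<lambda>j. ((Q \<omega> * X \<omega>) $$ (i, j))\<^sup>2"]) auto
    also have "\<dots> \<le> real n * (1 / lam)"
    proof -
      have "0 \<le> lam * (\<Sum>k<n. (Q \<omega> $$ (k, i))\<^sup>2)" using lam by (intro mult_nonneg_nonneg sum_nonneg) auto
      then show ?thesis
        unfolding QX_sq[OF i] using Q_diag[OF i, of \<omega>] by (intro mult_left_mono) linarith+
    qed
    finally have "\<bar>(Q \<omega> * X \<omega>) $$ (i, j)\<bar> \<le> sqrt (real n * (1 / lam))"
      by (metis power2_abs real_le_rsqrt)
    then show ?thesis by (simp only: c_def Inl sum.case K_def max.coboundedI1)
  next
    case (Inr k)
    then have k: "k < n" and i: "i < n" using that by (auto simp: J_def)
    have "(Q \<omega> $$ (i, k))\<^sup>2 \<le> (\<Sum>i<n. (Q \<omega> $$ (i, k))\<^sup>2)"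
      using i by (intro member_le_sum[where f = "\<lambda>i. (Q \<omega> $$ (i, k))\<^sup>2"]) auto
    also have "\<dots> \<le> (1 / lam)\<^sup>2" using Q_col[OF k] by (simp add: power_divide)
    finally have "\<bar>Q \<omega> $$ (i, k)\<bar>\<^sup>2 \<le> (1 / lam)\<^sup>2" by (simp only: power2_abs)
    then have "\<bar>Q \<omega> $$ (i, k)\<bar> \<le> 1 / lam" using lam by (intro power2_le_imp_le[of "\<bar>Q \<omega> $$ (i, k)\<bar>"]) auto
    then show ?thesis by (simp only: c_def Inr sum.case K_def max.coboundedI2)
  qed
  \<comment> \<open>The constant 1 fills the slot of the signal or of the noise in the three-factor
    product rule when that factor is absent.\<close>
  have const_gen: "(\<lambda>_. 1) \<in> borel_measurable (generated M I V)" for I :: "nat set" and V :: "nat \<Rightarrow> 'a \<Rightarrow> real"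
    by simp
  have cross: "integrable M (\<lambda>\<omega>. f \<omega> * (\<xi> a \<omega> * \<xi> b \<omega>)) \<and>
      (\<integral>\<omega>. f \<omega> * (\<xi> a \<omega> * \<xi> b \<omega>) \<partial>M) = (\<integral>\<omega>. f \<omega> \<partial>M) * (if a = b then \<tau> a else 0)"
    if f: "f \<in> borel_measurable F" "bounded (range f)" and ab: "a \<in> J" "b \<in> J" for f a b
  proof -
    obtain B where "\<bar>f \<omega>\<bar> \<le> B" for \<omega> using f(2) by (auto simp: bounded_iff)
    then have f_int: "integrable M f"
      using f(1) by (intro integrable_const_bound[of _ B] AE_I2 measurable_from_subalg[OF subalg(1)]) auto
    note triple = model_indep_expectation[OF ind _ _ f(1)[unfolded F_def] f_int]
    have one: "integrable M (\<lambda>_. 1 :: real)" by simp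
    have mixed: "integrable M (\<lambda>\<omega>. f \<omega> * (\<beta> j \<omega> * \<epsilon> k \<omega>)) \<and> (\<integral>\<omega>. f \<omega> * (\<beta> j \<omega> * \<epsilon> k \<omega>) \<partial>M) = 0"
      if "j < p" "k < n" for j k
      using triple[OF beta_gen[OF that(1)] beta1[OF that(1)] eps_gen[OF that(2)] eps1[OF that(2)]] beta_mean[OF that(1)]
      by (simp add: mult_ac)
    show ?thesis
    proof (cases a)
      case a: (Inl j)
      then have j: "j < p" using ab by (auto simp: J_def)
      show ?thesis
      proof (cases b)
        case b: (Inl k)
        then have k: "k < p" using ab by (auto simp: J_def)
        have bb: "(\<lambda>\<omega>. \<beta> j \<omega> * \<beta> k \<omega>) \<in> borel_measurable (generated M {..<p} \<beta>)"
          using beta_gen[OF j] beta_gen[OF k] by (rule borel_measurable_times)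
        have bi: "integrable M (\<lambda>\<omega>. \<beta> j \<omega> * \<beta> k \<omega>)"
          by (rule integrable_mult_square_integrable[OF beta_M[OF j] beta_M[OF k] beta_int[OF j] beta_int[OF k]])
        show ?thesis
          using triple[OF bb bi const_gen one] beta_cov[OF j k]
          by (auto simp: a b \<xi>_def \<tau>_def mult_ac prob_space)
      next
        case b: (Inr k)
        then have k: "k < n" using ab by (auto simp: J_def)
        show ?thesis using mixed[OF j k] by (simp add: a b \<xi>_def)
      qed
    next
      case a: (Inr j)
      then have j: "j < n" using ab by (auto simp: J_def)
      show ?thesis
      proof (cases b)
        case b: (Inl k)
        then have k: "k < p" using ab by (auto simp: J_def)
        show ?thesis using mixed[OF k j] by (simp add: a b \<xi>_def mult.commute)
      next
        case b: (Inr k)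
        then have k: "k < n" using ab by (auto simp: J_def)
        have bb: "(\<lambda>\<omega>. \<epsilon> j \<omega> * \<epsilon> k \<omega>) \<in> borel_measurable (generated M {..<n} \<epsilon>)"
          using eps_gen[OF j] eps_gen[OF k] by (rule borel_measurable_times)
        have bi: "integrable M (\<lambda>\<omega>. \<epsilon> j \<omega> * \<epsilon> k \<omega>)"
          by (rule integrable_mult_square_integrable[OF eps_M[OF j] eps_M[OF k] eps_int[OF j] eps_int[OF k]])
        have "expectation (\<lambda>\<omega>. \<epsilon> j \<omega> * \<epsilon> k \<omega>) = (if j = k then \<sigma>\<^sup>2 else 0)"
        proof (cases "j = k")
          case True
          then show ?thesis using eps_sq[OF j] by (simp add: power2_eq_square)
        next
          case False
          have "indep_var borel ((\<lambda>z. z j) \<circ> (\<lambda>\<omega>. \<lambda>i\<in>{j}. \<epsilon> i \<omega>)) borel ((\<lambda>z. z k) \<circ> (\<lambda>\<omega>. \<lambda>i\<in>{k}. \<epsilon> i \<omega>))"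
            using j k False by (intro indep_var_compose[OF indep_var_restrict[OF eps_indep]]) auto
          then have "indep_var borel (\<epsilon> j) borel (\<epsilon> k)" by (simp add: comp_def)
          from indep_var_lebesgue_integral[OF this eps1[OF j] eps1[OF k]] show ?thesis
            using eps_mean[OF j] False by simp
        qed
        then show ?thesis
          using triple[OF const_gen one bb bi] by (auto simp: a b \<xi>_def \<tau>_def mult_ac prob_space)
      qed
    qed
  qed
  have "finite {..<n}" "finite J" by (simp_all add: J_def)
  note quadratic = sa.integrable_quadratic[OF this c_meas c_bd cross] sa.real_cond_exp_quadratic[OF this c_meas c_bd cross]
  have "AE \<omega> in M. real_cond_exp M F (\<lambda>\<omega>. \<Sum>i<n. (\<Sum>a\<in>J. c i a \<omega> * \<xi> a \<omega>)\<^sup>2) \<omega>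
    = (\<Sum>i<n. \<Sum>a\<in>J. (c i a \<omega>)\<^sup>2 * \<tau> a)"
    by (rule quadratic(2))
  moreover have "AE \<omega> in M. real_cond_exp M F (\<lambda>\<omega>. lam\<^sup>2 * (\<Sum>i<n. (\<Sum>a\<in>J. c i a \<omega> * \<xi> a \<omega>)\<^sup>2)) \<omega>
    = lam\<^sup>2 * real_cond_exp M F (\<lambda>\<omega>. \<Sum>i<n. (\<Sum>a\<in>J. c i a \<omega> * \<xi> a \<omega>)\<^sup>2) \<omega>"
    by (rule sa.real_cond_exp_cmult[OF quadratic(1)])
  ultimately show ?thesis
  proof eventually_elim
    case (elim \<omega>)
    have Qs: "(\<Sum>k<n. (Q \<omega> $$ (i, k))\<^sup>2) = (\<Sum>k<n. (Q \<omega> $$ (k, i))\<^sup>2)" if "i < n" for i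
      unfolding Q_def using resolvent_index_sym[OF St lam] that by (intro sum.cong) auto
    have row: "(\<Sum>a\<in>J. (c i a \<omega>)\<^sup>2 * \<tau> a)
      = \<alpha>\<^sup>2 / real p * (real n * (Q \<omega> $$ (i, i) - lam * (\<Sum>k<n. (Q \<omega> $$ (k, i))\<^sup>2)))
        + \<sigma>\<^sup>2 * (\<Sum>k<n. (Q \<omega> $$ (k, i))\<^sup>2)" if "i < n" for i
      unfolding QX_sq[OF that, symmetric] unfolding Qs[OF that, symmetric]
      by (simp add: J_def c_def \<tau>_def sum.Plus sum_distrib_left mult_ac del: index_mult_mat)
    have "(\<Sum>i<n. \<Sum>a\<in>J. (c i a \<omega>)\<^sup>2 * \<tau> a)
      = \<alpha>\<^sup>2 / real p * (real n * ((\<Sum>i<n. Q \<omega> $$ (i, i)) - lam * (\<Sum>i<n. \<Sum>k<n. (Q \<omega> $$ (k, i))\<^sup>2)))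
        + \<sigma>\<^sup>2 * (\<Sum>i<n. \<Sum>k<n. (Q \<omega> $$ (k, i))\<^sup>2)"
    proof -
      have "(\<Sum>i<n. d * (N * (a i - lam * f i)) + s * f i) = d * (N * ((\<Sum>i<n. a i) - lam * (\<Sum>i<n. f i))) + s * (\<Sum>i<n. f i)"
        for d N s and a f :: "nat \<Rightarrow> real"
        by (simp add: sum.distrib sum_subtractf flip: sum_distrib_left)
      moreover have "(\<Sum>i<n. \<Sum>a\<in>J. (c i a \<omega>)\<^sup>2 * \<tau> a) = (\<Sum>i<n. \<alpha>\<^sup>2 / real p * (real n * (Q \<omega> $$ (i, i) - lam * (\<Sum>k<n. (Q \<omega> $$ (k, i))\<^sup>2)))
        + \<sigma>\<^sup>2 * (\<Sum>k<n. (Q \<omega> $$ (k, i))\<^sup>2))"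
        using row by (intro sum.cong) auto
      ultimately show ?thesis by (simp only:)
    qed
    then show ?case
      using elim n unfolding train_risk_hat_def residual F_def[symmetric] by (simp add: field_simps)
  qed
qed

section \<open>Deterministic equivalents\<close>

text \<open>The existentially given \<open>F\<close> and \<open>F'\<close> are replaced by real
  parts, which are explicit terms and can be used uniformly over indices and over
  \<open>n\<close>.\<close>

lemma stieltjes_class_Re:
  assumes f: "stieltjes_class f" and a: "a > 0"
  shows "f (- complex_of_real a) = complex_of_real (Re (f (- complex_of_real a)))"
    and "0 \<le> Re (f (- complex_of_real a))" and "Re (f (- complex_of_real a)) \<le> 1 / a"
    and "deriv f (- complex_of_real a) = complex_of_real (Re (deriv f (- complex_of_real a)))"
    and "\<And>b. a < b \<Longrightarrow> \<bar>(Re (f (- complex_of_real a)) - Re (f (- complex_of_real b))) / (b - a)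
      - Re (deriv f (- complex_of_real a))\<bar> \<le> (b - a) / a ^ 3"
    and "\<bar>Re (deriv f (- complex_of_real a))\<bar> \<le> 2 / a\<^sup>2"
proof -
  obtain F F' :: "real \<Rightarrow> real"
    where F: "\<And>a. a > 0 \<Longrightarrow> f (- complex_of_real a) = complex_of_real (F a)"
    and F0: "\<And>a. a > 0 \<Longrightarrow> 0 \<le> F a" and F1: "\<And>a. a > 0 \<Longrightarrow> F a \<le> 1 / a"
    and F': "\<And>a. a > 0 \<Longrightarrow> deriv f (- complex_of_real a) = complex_of_real (F' a)"
    and q: "\<And>a b. 0 < a \<Longrightarrow> a < b \<Longrightarrow> \<bar>(F a - F b) / (b - a) - F' a\<bar> \<le> (b - a) / a ^ 3"
    using stieltjes_class_negative_axis[OF f] by blast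
  show "f (- complex_of_real a) = complex_of_real (Re (f (- complex_of_real a)))"
    "0 \<le> Re (f (- complex_of_real a))" "Re (f (- complex_of_real a)) \<le> 1 / a"
    "deriv f (- complex_of_real a) = complex_of_real (Re (deriv f (- complex_of_real a)))"
    using F[OF a] F'[OF a] F0[OF a] F1[OF a] by simp_all
  show "\<bar>(Re (f (- complex_of_real a)) - Re (f (- complex_of_real b))) / (b - a)
      - Re (deriv f (- complex_of_real a))\<bar> \<le> (b - a) / a ^ 3" if "a < b" for b
    using q[OF a that] F[OF a] F[of b] F'[OF a] a that by simp
  \<comment> \<open>The quotient over \<open>[a, 2 a]\<close> and the quotient error are each at
    most \<open>1 / a^2\<close>; this bounds the derivative without returning to the
    measure.\<close>
  have "\<bar>(F a - F (2 * a)) / a - F' a\<bar> \<le> 1 / a\<^sup>2"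
    using q[of a "2 * a"] a by (simp add: power2_eq_square power3_eq_cube)
  moreover have "\<bar>(F a - F (2 * a)) / a\<bar> \<le> 1 / a\<^sup>2"
  proof -
    have "1 / (2 * a) \<le> 1 / a" using a by (simp add: field_simps)
    then have "\<bar>F a - F (2 * a)\<bar> \<le> 1 / a"
      using F0[OF a] F1[OF a] F0[of "2 * a"] F1[of "2 * a"] a by (simp add: abs_le_iff)
    then have "\<bar>F a - F (2 * a)\<bar> / a \<le> 1 / a / a" using a by (intro divide_right_mono) auto
    then show ?thesis using a by (simp add: power2_eq_square)
  qed
  ultimately have "\<bar>F' a\<bar> \<le> 1 / a\<^sup>2 + 1 / a\<^sup>2" by linarith
  then have "\<bar>F' a\<bar> \<le> 2 / a\<^sup>2" by simp
  then show "\<bar>Re (deriv f (- complex_of_real a))\<bar> \<le> 2 / a\<^sup>2"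
    using F'[OF a] by simp
qed

context
  fixes n p :: nat and \<gamma> :: "nat \<Rightarrow> nat \<Rightarrow> real" and T Tt :: "nat \<Rightarrow> complex \<Rightarrow> complex" and lam :: real
  assumes sol: "canonical_solution n p \<gamma> T Tt" and n: "n > 0" and lam: "lam > 0"
begin

lemma canonical_solution_stieltjes:
  "j < p \<Longrightarrow> stieltjes_class (T j)" "i < n \<Longrightarrow> stieltjes_class (Tt i)"
  using sol by (auto simp: canonical_solution_def)

private abbreviation (input) "t j \<equiv> Re (T j (- complex_of_real lam))"
private abbreviation (input) "tt i \<equiv> Re (Tt i (- complex_of_real lam))"
private abbreviation (input) "tt' i \<equiv> Re (deriv (Tt i) (- complex_of_real lam))"

text \<open>At \<open>z = -lam\<close> the signs cancel, leaving the positive real system treated by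
  \<open>fixed_point_stability\<close>, with weights \<open>(\<gamma> i j)^2 / n\<close>, the
  variances of the scaled entries.\<close>

lemma canonical_solution_real:
  shows "j < p \<Longrightarrow> t j = 1 / (lam * (1 + (\<Sum>i<n. (\<gamma> i j)\<^sup>2 / real n * tt i)))"
    and "i < n \<Longrightarrow> tt i = 1 / (lam * (1 + (\<Sum>j<p. (\<gamma> i j)\<^sup>2 / real n * t j)))"
proof -
  have z: "- complex_of_real lam \<notin> \<real>\<^sub>\<ge>\<^sub>0"
    using lam by (auto simp: complex_nonneg_Reals_iff)
  have real: "-1 / (- complex_of_real lam * (1 + 1 / of_nat n * (\<Sum>i\<in>I. of_real (w i) * of_real (x i))))
      = complex_of_real (1 / (lam * (1 + (\<Sum>i\<in>I. w i / real n * x i))))"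
    for I :: "nat set" and w x :: "nat \<Rightarrow> real"
  proof -
    have "complex_of_real (\<Sum>i\<in>I. w i / real n * x i) = 1 / of_nat n * (\<Sum>i\<in>I. of_real (w i) * of_real (x i))"
      by (simp add: sum_distrib_left)
    then show ?thesis by simp
  qed
  show "t j = 1 / (lam * (1 + (\<Sum>i<n. (\<gamma> i j)\<^sup>2 / real n * tt i)))" if j: "j < p" for j
  proof -
    have "T j (- complex_of_real lam)
      = -1 / (- complex_of_real lam * (1 + 1 / of_nat n * (\<Sum>i<n. of_real ((\<gamma> i j)\<^sup>2) * Tt i (- complex_of_real lam))))"
      using sol z j unfolding canonical_solution_def by blast
    also have "(\<Sum>i<n. of_real ((\<gamma> i j)\<^sup>2) * Tt i (- complex_of_real lam)) = (\<Sum>i<n. of_real ((\<gamma> i j)\<^sup>2) * of_real (tt i))"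
      using stieltjes_class_Re(1)[OF canonical_solution_stieltjes(2) lam] by (intro sum.cong) auto
    finally show ?thesis unfolding real by (simp only: Re_complex_of_real)
  qed
  show "tt i = 1 / (lam * (1 + (\<Sum>j<p. (\<gamma> i j)\<^sup>2 / real n * t j)))" if i: "i < n" for i
  proof -
    have "Tt i (- complex_of_real lam)
      = -1 / (- complex_of_real lam * (1 + 1 / of_nat n * (\<Sum>j<p. of_real ((\<gamma> i j)\<^sup>2) * T j (- complex_of_real lam))))"
      using sol z i unfolding canonical_solution_def by blast
    also have "(\<Sum>j<p. of_real ((\<gamma> i j)\<^sup>2) * T j (- complex_of_real lam)) = (\<Sum>j<p. of_real ((\<gamma> i j)\<^sup>2) * of_real (t j))"
      using stieltjes_class_Re(1)[OF canonical_solution_stieltjes(1) lam] by (intro sum.cong) auto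
    finally show ?thesis unfolding real by (simp only: Re_complex_of_real)
  qed
qed

lemma canonical_solution_pos: "i < n \<Longrightarrow> 0 < tt i"
proof -
  assume i: "i < n"
  have "0 \<le> (\<Sum>j<p. (\<gamma> i j)\<^sup>2 / real n * t j)"
    using stieltjes_class_Re(2)[OF canonical_solution_stieltjes(1) lam] by (intro sum_nonneg mult_nonneg_nonneg) auto
  then show ?thesis
    using lam by (subst canonical_solution_real(2)[OF i]) simp
qed

text \<open>The a priori bound \<open>1 / lam\<close> on the row entries is inserted into the column
  equation. The resulting lower bound, uniform in \<open>n\<close>, keeps \<open>1 - df1_det\<close>
  away from 0.\<close>

lemma canonical_solution_lower:
  assumes g: "\<And>i j. i < n \<Longrightarrow> j < p \<Longrightarrow> \<bar>\<gamma> i j\<bar> \<le> g" and j: "j < p"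
  shows "1 / (lam + g\<^sup>2) \<le> t j"
proof -
  have nonneg: "0 \<le> (\<Sum>i<n. (\<gamma> i j)\<^sup>2 / real n * tt i)"
    using canonical_solution_pos by (intro sum_nonneg mult_nonneg_nonneg) (auto intro: less_imp_le)
  have "(\<Sum>i<n. (\<gamma> i j)\<^sup>2 / real n * tt i) \<le> (\<Sum>i<n. g\<^sup>2 / real n * (1 / lam))"
  proof (intro sum_mono mult_mono divide_right_mono)
    fix i assume i: "i \<in> {..<n}"
    have "\<bar>\<gamma> i j\<bar>\<^sup>2 \<le> g\<^sup>2" using g[of i j] i j by (intro power_mono) auto
    then show "(\<gamma> i j)\<^sup>2 \<le> g\<^sup>2" by simp
    show "tt i \<le> 1 / lam" using i by (intro stieltjes_class_Re(3)[OF canonical_solution_stieltjes(2) lam]) auto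
    show "0 \<le> tt i" using canonical_solution_pos[of i] i by simp
  qed auto
  also have "\<dots> = g\<^sup>2 / lam" using n by simp
  finally have "lam * (1 + (\<Sum>i<n. (\<gamma> i j)\<^sup>2 / real n * tt i)) \<le> lam * (1 + g\<^sup>2 / lam)"
    using lam by (intro mult_left_mono) auto
  also have "\<dots> = lam + g\<^sup>2" using lam by (simp add: field_simps)
  finally show ?thesis
    using lam nonneg by (subst canonical_solution_real(1)[OF j]) (intro divide_left_mono mult_pos_pos add_pos_nonneg, auto)
qed

text \<open>With \<open>s1\<close> and \<open>s2\<close> the plain and the weighted column sums,
  \<open>kappa\<close> is \<open>s1 / s2\<close>, so \<open>s1\<close> cancels from the term,
  leaving \<open>s2 / (s2 + n)\<close>; the canonical equation reads
  \<open>lam * t j = n / (s2 + n)\<close>.\<close>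

lemma df1_det_eq:
  assumes p: "p > 0"
  shows "df1_det n p \<gamma> Tt lam = complex_of_real (1 - lam / real p * (\<Sum>j<p. t j))"
proof -
  have term_eq: "(if \<forall>i<n. \<gamma> i j = 0 then 0
      else complex_of_real (pop_cov n \<gamma> j) / (complex_of_real (pop_cov n \<gamma> j) + kappa n \<gamma> Tt lam j))
    = complex_of_real (1 - lam * t j)" if j: "j < p" for j
  proof -
    define s1 where "s1 = (\<Sum>i<n. (\<gamma> i j)\<^sup>2)"
    define s2 where "s2 = (\<Sum>i<n. (\<gamma> i j)\<^sup>2 * tt i)"
    have s2n: "(\<Sum>i<n. (\<gamma> i j)\<^sup>2 / real n * tt i) = s2 / real n"
      by (simp add: s2_def sum_divide_distrib)
    have tj: "t j = 1 / (lam * (1 + s2 / real n))"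
      using canonical_solution_real(1)[OF j] unfolding s2n .
    show ?thesis
    proof (cases "\<forall>i<n. \<gamma> i j = 0")
      \<comment> \<open>For a vanishing column the equation gives \<open>lam * t j = 1\<close>, so
        the convention of a zero term agrees with the formula.\<close>
      case True
      then have "s2 = 0" by (simp add: s2_def)
      then show ?thesis using True tj lam by simp
    next
      case False
      then obtain i where i: "i < n" "\<gamma> i j \<noteq> 0" by blast
      have s1: "0 < s1"
        unfolding s1_def using i by (intro sum_pos2[of _ i]) auto
      have s2: "0 < s2"
        unfolding s2_def
      proof (rule sum_pos2[of _ i])
        show "0 < (\<gamma> i j)\<^sup>2 * tt i" using i canonical_solution_pos by simp
        show "0 \<le> (\<gamma> k j)\<^sup>2 * tt k" if "k \<in> {..<n}" for k
          using that canonical_solution_pos[of k] by simp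
      qed (use i in auto)
      have "kappa n \<gamma> Tt lam j = complex_of_real (s1 / s2)"
      proof -
        have "(\<Sum>i<n. of_real ((\<gamma> i j)\<^sup>2) * Tt i (- complex_of_real lam)) = (\<Sum>i<n. of_real ((\<gamma> i j)\<^sup>2) * of_real (tt i))"
          using stieltjes_class_Re(1)[OF canonical_solution_stieltjes(2) lam] by (intro sum.cong) auto
        also have "\<dots> = complex_of_real s2" by (simp add: s2_def)
        finally show ?thesis by (simp add: kappa_def s1_def)
      qed
      moreover have "pop_cov n \<gamma> j = s1 / real n" by (simp add: pop_cov_def s1_def)
      moreover have "s1 / real n / (s1 / real n + s1 / s2) = 1 - lam * t j"
      proof -
        have "s1 / real n + s1 / s2 = s1 / real n * ((s2 + real n) / s2)"
          using s2 n by (simp add: field_simps)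
        then have "s1 / real n / (s1 / real n + s1 / s2) = s2 / (s2 + real n)"
          using s1 n by simp
        moreover have "1 + s2 / real n = (s2 + real n) / real n" using n by (simp add: field_simps)
        then have "lam * t j = real n / (s2 + real n)" unfolding tj using lam by simp
        moreover have "s2 / (s2 + real n) = 1 - real n / (s2 + real n)" using s2 n by (simp add: field_simps)
        ultimately show ?thesis by (simp only:)
      qed
      ultimately show ?thesis
        unfolding if_not_P[OF False] by (simp only: flip: of_real_add of_real_divide)
    qed
  qed
  have "df1_det n p \<gamma> Tt lam = 1 / of_nat p * (\<Sum>j<p. complex_of_real (1 - lam * t j))"
    unfolding df1_det_def using term_eq by (intro arg_cong2[where f = "(*)"] sum.cong) auto
  also have "\<dots> = complex_of_real (1 / real p * (\<Sum>j<p. 1 - lam * t j))"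
    by simp
  also have "1 / real p * (\<Sum>j<p. 1 - lam * t j) = 1 - lam / real p * (\<Sum>j<p. t j)"
    using p by (simp add: sum_subtractf field_simps flip: sum_distrib_left)
  finally show ?thesis .
qed

lemma train_risk_det_eq:
  "train_risk_det n p \<alpha> \<sigma> Tt lam = complex_of_real (lam\<^sup>2 * \<alpha>\<^sup>2 / real p * ((\<Sum>i<n. tt i) - lam * (\<Sum>i<n. tt' i))
    + lam\<^sup>2 * \<sigma>\<^sup>2 / real n * (\<Sum>i<n. tt' i))"
proof -
  have "(\<Sum>i<n. Tt i (- of_real lam) - of_real lam * deriv (Tt i) (- of_real lam))
    = (\<Sum>i<n. complex_of_real (tt i) - of_real lam * complex_of_real (tt' i))"
    using stieltjes_class_Re(1,4)[OF canonical_solution_stieltjes(2) lam]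
    by (intro sum.cong refl arg_cong2[where f = "(-)"] arg_cong2[where f = "(*)"]) auto
  moreover have "(\<Sum>i<n. deriv (Tt i) (- of_real lam)) = (\<Sum>i<n. complex_of_real (tt' i))"
    using stieltjes_class_Re(4)[OF canonical_solution_stieltjes(2) lam] by (intro sum.cong) auto
  ultimately show ?thesis
    unfolding train_risk_det_def by (simp add: sum_subtractf sum_distrib_left)
qed

lemma G_det_eq:
  assumes p: "p > 0"
  shows "G_det n p \<alpha> \<sigma> \<gamma> Tt lam
    = complex_of_real ((lam\<^sup>2 * \<alpha>\<^sup>2 / real p * ((\<Sum>i<n. tt i) - lam * (\<Sum>i<n. tt' i))
      + lam\<^sup>2 * \<sigma>\<^sup>2 / real n * (\<Sum>i<n. tt' i)) / (lam / real p * (\<Sum>j<p. t j))\<^sup>2)"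
  unfolding G_det_def train_risk_det_eq df1_det_eq[OF p] by simp

end

text \<open>Order of limits: first \<open>k\<close> is fixed to make the discretization error
  \<open>C / Suc k\<close> small, then \<open>n\<close> grows. The factor \<open>Suc k\<close> is
  the inverse step of the quotient; it amplifies the trace errors but stays fixed.\<close>

lemma tendsto_zero_by_difference_quotients:
  fixes D u0 :: "nat \<Rightarrow> real" and u :: "nat \<Rightarrow> nat \<Rightarrow> real"
  assumes u0: "u0 \<longlonglongrightarrow> 0" and u: "\<And>k. u k \<longlonglongrightarrow> 0"
    and bound: "\<And>k. \<forall>\<^sub>F n in sequentially.
      \<bar>D n\<bar> \<le> (\<bar>u0 n\<bar> + \<bar>u k n\<bar>) * real (Suc k) + C / real (Suc k)"
  shows "D \<longlonglongrightarrow> 0"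
  unfolding tendsto_iff
proof safe
  fix e :: real assume e: "0 < e"
  have "(\<lambda>k. C / real (Suc k)) \<longlonglongrightarrow> 0"
    by (rule LIMSEQ_Suc[OF lim_const_over_n])
  then have "\<forall>\<^sub>F k in sequentially. C / real (Suc k) < e / 2"
    using e by (intro order_tendstoD(2)[of _ 0]) auto
  then obtain k where k: "C / real (Suc k) < e / 2"
    by (auto simp: eventually_sequentially)
  have "(\<lambda>n. (\<bar>u0 n\<bar> + \<bar>u k n\<bar>) * real (Suc k)) \<longlonglongrightarrow> (\<bar>0\<bar> + \<bar>0\<bar>) * real (Suc k)"
    by (intro tendsto_intros u0 u)
  then have "\<forall>\<^sub>F n in sequentially. (\<bar>u0 n\<bar> + \<bar>u k n\<bar>) * real (Suc k) < e / 2"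
    using e by (intro order_tendstoD(2)[of _ "(\<bar>0\<bar> + \<bar>0\<bar>) * real (Suc k)"]) auto
  with bound[of k] show "\<forall>\<^sub>F n in sequentially. dist (D n) 0 < e"
  proof eventually_elim
    case (elim n)
    have "\<bar>D n\<bar> < e" using elim k by linarith
    then show ?case by simp
  qed
qed

text \<open>Only the deterministic denominator is assumed bounded below; the random one inherits
  half of that bound eventually, because the difference vanishes.\<close>

lemma ratio_difference_tendsto_zero:
  fixes R r s S :: "nat \<Rightarrow> real"
  assumes R: "(\<lambda>n. R n - r n) \<longlonglongrightarrow> 0" and s: "(\<lambda>n. s n - S n) \<longlonglongrightarrow> 0"
    and r: "\<forall>\<^sub>F n in sequentially. \<bar>r n\<bar> \<le> K" and S: "\<forall>\<^sub>F n in sequentially. \<delta> \<le> S n" and \<delta>: "0 < \<delta>"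
  shows "(\<lambda>n. R n / (s n)\<^sup>2 - r n / (S n)\<^sup>2) \<longlonglongrightarrow> 0"
proof (rule Lim_null_comparison)
  define d where "d = \<delta> / 2"
  have d: "0 < d" using \<delta> by (simp add: d_def)
  have "\<forall>\<^sub>F n in sequentially. - d < s n - S n"
    using s d by (intro order_tendstoD(1)[of _ 0]) auto
  with r S show "\<forall>\<^sub>F n in sequentially. norm (R n / (s n)\<^sup>2 - r n / (S n)\<^sup>2)
    \<le> \<bar>R n - r n\<bar> * (1 / d\<^sup>2) + K * (\<bar>s n - S n\<bar> * (2 / d ^ 3))"
  proof eventually_elim
    case (elim n)
    have sd: "d \<le> s n" and Sd: "d \<le> S n" using elim \<delta> by (auto simp: d_def)
    have s0: "0 < s n" and S0: "0 < S n" using sd Sd d by linarith+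
    \<comment> \<open>Numerator and denominator errors are separated, with \<open>S^2 - s^2\<close>
      factored so that \<open>S - s\<close> appears linearly.\<close>
    have eq: "R n / (s n)\<^sup>2 - r n / (S n)\<^sup>2
      = (R n - r n) * (1 / (s n)\<^sup>2) + r n * ((S n - s n) * (1 / ((s n)\<^sup>2 * S n) + 1 / (s n * (S n)\<^sup>2)))"
      using s0 S0 by (simp add: field_simps power2_eq_square)
    have b1: "1 / (s n)\<^sup>2 \<le> 1 / d\<^sup>2"
      using sd d s0 by (intro divide_left_mono power_mono mult_pos_pos) auto
    have "d\<^sup>2 * d \<le> (s n)\<^sup>2 * S n" "d * d\<^sup>2 \<le> s n * (S n)\<^sup>2"
      using sd Sd d by (auto intro!: mult_mono power_mono)
    then have "1 / ((s n)\<^sup>2 * S n) \<le> 1 / d ^ 3" "1 / (s n * (S n)\<^sup>2) \<le> 1 / d ^ 3"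
      using s0 S0 d by (auto intro!: divide_left_mono simp: power2_eq_square power3_eq_cube)
    then have b2: "1 / ((s n)\<^sup>2 * S n) + 1 / (s n * (S n)\<^sup>2) \<le> 2 / d ^ 3" by simp
    have nn: "0 \<le> 1 / ((s n)\<^sup>2 * S n) + 1 / (s n * (S n)\<^sup>2)" using s0 S0 by simp
    have "\<bar>R n / (s n)\<^sup>2 - r n / (S n)\<^sup>2\<bar> \<le> \<bar>R n - r n\<bar> * (1 / (s n)\<^sup>2)
      + \<bar>r n\<bar> * (\<bar>s n - S n\<bar> * (1 / ((s n)\<^sup>2 * S n) + 1 / (s n * (S n)\<^sup>2)))"
      unfolding eq using nn
      by (intro order.trans[OF abs_triangle_ineq] add_mono)
        (simp_all only: abs_mult abs_of_nonneg abs_minus_commute[of "S n"] abs_divide abs_one abs_power2 order_refl)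
    also have "\<dots> \<le> \<bar>R n - r n\<bar> * (1 / d\<^sup>2) + K * (\<bar>s n - S n\<bar> * (2 / d ^ 3))"
      using b1 b2 nn elim(1) by (intro add_mono mult_mono mult_left_mono mult_nonneg_nonneg) auto
    finally show ?case by simp
  qed
  have "(\<lambda>n. \<bar>R n - r n\<bar> * (1 / d\<^sup>2) + K * (\<bar>s n - S n\<bar> * (2 / d ^ 3)))
    \<longlonglongrightarrow> \<bar>0\<bar> * (1 / d\<^sup>2) + K * (\<bar>0\<bar> * (2 / d ^ 3))"
    by (intro tendsto_intros R s)
  then show "(\<lambda>n. \<bar>R n - r n\<bar> * (1 / d\<^sup>2) + K * (\<bar>s n - S n\<bar> * (2 / d ^ 3))) \<longlonglongrightarrow> 0" by simp
qed

theorem mainTheorem6: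
  fixes M :: "'w measure"
    and p :: "nat \<Rightarrow> nat"
    and \<gamma> :: "nat \<Rightarrow> nat \<Rightarrow> nat \<Rightarrow> real"
    and Z :: "nat \<Rightarrow> nat \<Rightarrow> nat \<Rightarrow> 'w \<Rightarrow> real"
    and \<beta> \<epsilon> :: "nat \<Rightarrow> nat \<Rightarrow> 'w \<Rightarrow> real"
    and X :: "nat \<Rightarrow> 'w \<Rightarrow> real mat"
    and T Tt :: "nat \<Rightarrow> nat \<Rightarrow> complex \<Rightarrow> complex"
    and \<zeta> :: "real measure"
    and c \<alpha> \<sigma> :: real
  assumes "prob_space M"
    and "c > 0"
    and ratio: "(\<lambda>n. real (p n) / real n) \<longlonglongrightarrow> c"
    and X_def: "\<And>n. X n = design n (p n) (\<gamma> n) (Z n)"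
    and Z_iid: "\<And>n. n \<ge> 1 \<Longrightarrow> iid M ({..<n} \<times> {..<p n}) (\<lambda>(i, j). Z n i j) \<zeta>"
    and Z_mean: "\<And>n i j. i < n \<Longrightarrow> j < p n \<Longrightarrow> prob_space.expectation M (Z n i j) = 0"
    and Z_var: "\<And>n i j. i < n \<Longrightarrow> j < p n \<Longrightarrow> prob_space.variance M (Z n i j) = 1"
    and Z_moment: "\<exists>\<delta>>0. \<forall>n. \<forall>i<n. \<forall>j<p n. integrable M (\<lambda>\<omega>. \<bar>Z n i j \<omega>\<bar> powr (4 + \<delta>))"
    and gamma_bounded:
      "\<exists>\<gamma>max>0. (SUP n\<in>{1..}. SUP i\<in>{..<n}. SUP j\<in>{..<p n}. ereal \<bar>\<gamma> n i j\<bar>) < ereal \<gamma>max"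
    and eps_iid: "\<And>n. n \<ge> 1 \<Longrightarrow> \<exists>\<tau>. iid M {..<n} (\<epsilon> n) \<tau>"
    and eps_square_integrable: "\<And>n i. i < n \<Longrightarrow> integrable M (\<lambda>\<omega>. (\<epsilon> n i \<omega>)\<^sup>2)"
    and eps_mean: "\<And>n i. i < n \<Longrightarrow> prob_space.expectation M (\<epsilon> n i) = 0"
    and eps_var: "\<And>n i. i < n \<Longrightarrow> prob_space.variance M (\<epsilon> n i) = \<sigma>\<^sup>2"
    and "\<sigma>\<^sup>2 > 0"
    and "\<alpha> > 0"
    and beta_square_integrable: "\<And>n j. n \<ge> 1 \<Longrightarrow> j < p n \<Longrightarrow> integrable M (\<lambda>\<omega>. (\<beta> n j \<omega>)\<^sup>2)"
    and beta_mean: "\<And>n j. n \<ge> 1 \<Longrightarrow> j < p n \<Longrightarrow> prob_space.expectation M (\<beta> n j) = 0"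
    and beta_cov: "\<And>n j k. n \<ge> 1 \<Longrightarrow> j < p n \<Longrightarrow> k < p n \<Longrightarrow>
        prob_space.expectation M (\<lambda>\<omega>. \<beta> n j \<omega> * \<beta> n k \<omega>) = (if j = k then \<alpha>\<^sup>2 / real (p n) else 0)"
    and indep: "\<And>n. n \<ge> 1 \<Longrightarrow> model_indep M n (p n) (\<beta> n) (X n) (\<epsilon> n)"
    and T_solution: "\<And>n. n \<ge> 1 \<Longrightarrow> canonical_solution n (p n) (\<gamma> n) (T n) (Tt n)"
  shows "\<forall>lam>0. AE \<omega> in M.
    (\<lambda>n. cmod (complex_of_real (G_hat M n (p n) (\<beta> n) (X n) (\<epsilon> n) lam \<omega>) -
               G_det n (p n) \<alpha> \<sigma> (\<gamma> n) (Tt n) lam)) \<longlonglongrightarrow> 0"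
proof (intro allI impI)
  fix lam :: real assume lam: "0 < lam"
  interpret prob_space M by (rule assms(1))

  \<comment> \<open>Uniform bounds on the profile and moments of the entries\<close>
  obtain gmax where gmax: "gmax > 0"
    and sup: "(SUP n\<in>{1..}. SUP i\<in>{..<n}. SUP j\<in>{..<p n}. ereal \<bar>\<gamma> n i j\<bar>) < ereal gmax"
    using gamma_bounded by blast
  have gamma: "\<bar>\<gamma> n i j\<bar> \<le> gmax" if "n \<ge> 1" "i < n" "j < p n" for n i j
  proof -
    have "ereal \<bar>\<gamma> n i j\<bar> \<le> (SUP j\<in>{..<p n}. ereal \<bar>\<gamma> n i j\<bar>)"
      using that by (intro SUP_upper) auto
    also have "\<dots> \<le> (SUP i\<in>{..<n}. SUP j\<in>{..<p n}. ereal \<bar>\<gamma> n i j\<bar>)"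
      using that by (intro SUP_upper) auto
    also have "\<dots> \<le> (SUP n\<in>{1..}. SUP i\<in>{..<n}. SUP j\<in>{..<p n}. ereal \<bar>\<gamma> n i j\<bar>)"
      using that by (intro SUP_upper) auto
    also have "\<dots> < ereal gmax" by (rule sup)
    finally show ?thesis by simp
  qed
  obtain \<delta>Z where \<delta>Z: "\<delta>Z > 0"
    and Z_mom: "\<And>n i j. i < n \<Longrightarrow> j < p n \<Longrightarrow> integrable M (\<lambda>\<omega>. \<bar>Z n i j \<omega>\<bar> powr (4 + \<delta>Z))"
    using Z_moment by blast
  have Z_indep: "indep_vars (\<lambda>_. borel) (\<lambda>(i, j). Z n i j) ({..<n} \<times> {..<p n})" if "n \<ge> 1" for n
    using Z_iid[OF that] by (simp add: iid_def)
  have Z_distr: "distr M borel (Z n i j) = \<zeta>" if "n \<ge> 1" "i < n" "j < p n" for n i j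
    using Z_iid[OF that(1)] that unfolding iid_def by auto
  have Z_meas: "Z n i j \<in> borel_measurable M" if "n \<ge> 1" "i < n" "j < p n" for n i j
    using Z_indep[OF that(1)] that unfolding indep_vars_def by force
  \<comment> \<open>Taken under the common law of the entries, so the fourth-moment bound does not
    depend on \<open>n\<close>, \<open>i\<close> or \<open>j\<close>.\<close>
  define K where "K = (\<integral>x. x ^ 4 \<partial>\<zeta>)"
  have Z4: "integrable M (\<lambda>\<omega>. (Z n i j \<omega>) ^ 4)" if "n \<ge> 1" "i < n" "j < p n" for n i j
  proof (rule Bochner_Integration.integrable_bound[of M "\<lambda>\<omega>. 1 + \<bar>Z n i j \<omega>\<bar> powr (4 + \<delta>Z)"])
    \<comment> \<open>Split at \<open>|z| = 1\<close>: the constant 1 covers small values, the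
      larger exponent covers the rest.\<close>
    have "z ^ 4 \<le> 1 + \<bar>z\<bar> powr (4 + \<delta>Z)" for z :: real
    proof (cases "\<bar>z\<bar> \<le> 1")
      case True
      then have "\<bar>z\<bar> ^ 4 \<le> 1" by (intro power_le_one) auto
      then show ?thesis by (simp add: add_increasing2)
    next
      case False
      then have "\<bar>z\<bar> powr 4 \<le> \<bar>z\<bar> powr (4 + \<delta>Z)" using \<delta>Z by (intro powr_mono) auto
      moreover have "\<bar>z\<bar> powr 4 = z ^ 4" using False by (simp add: powr_numeral)
      ultimately show ?thesis by simp
    qed
    then show "AE \<omega> in M. norm ((Z n i j \<omega>) ^ 4) \<le> norm (1 + \<bar>Z n i j \<omega>\<bar> powr (4 + \<delta>Z))"
      by (intro AE_I2) (simp add: abs_of_nonneg add_nonneg_nonneg)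
  qed (use Z_mom Z_meas that in auto)
  have EZ4: "expectation (\<lambda>\<omega>. (Z n i j \<omega>) ^ 4) = K" if "n \<ge> 1" "i < n" "j < p n" for n i j
    unfolding K_def Z_distr[OF that, symmetric] using Z_meas[OF that] by (subst integral_distr) auto
  have EZ2: "expectation (\<lambda>\<omega>. (Z n i j \<omega>)\<^sup>2) = 1" if "n \<ge> 1" "i < n" "j < p n" for n i j
    using Z_var[OF that(2,3)] Z_mean[OF that(2,3)] by simp
  have K0: "0 \<le> K" unfolding K_def by (intro integral_nonneg_AE AE_I2) auto

  \<comment> \<open>Scaled entries and their moment bounds\<close>
  define y where "y n i j \<omega> = \<gamma> n i j / sqrt (real n) * Z n i j \<omega>" for n i j \<omega>
  define v where "v n i j = (\<gamma> n i j)\<^sup>2 / real n" for n i j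
  define B where "B = gmax\<^sup>2"
  define K' where "K' = K * gmax ^ 4"
  have B: "0 < B" using gmax by (simp add: B_def)
  have K': "0 \<le> K'" using K0 by (simp add: K'_def)
  \<comment> \<open>The spectral parameter \<open>a\<close> stays free, because traces are needed at
    \<open>lam\<close> and at all points \<open>lam + h k\<close>.\<close>
  have IE: "independent_entries M (y n) n (p n) (v n) (B / real n) (K' / (real n)\<^sup>2) a"
    if n: "n \<ge> 1" and a: "0 < a" for n a
  proof (unfold_locales)
    have "indep_vars (\<lambda>_. borel) (\<lambda>ij \<omega>. (\<lambda>z. \<gamma> n (fst ij) (snd ij) / sqrt (real n) * z) ((\<lambda>(i, j). Z n i j) ij \<omega>))
      ({..<n} \<times> {..<p n})"
      by (rule indep_vars_compose2[OF Z_indep[OF n]]) auto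
    then show "indep_vars (\<lambda>_. borel) (\<lambda>(i, j). y n i j) ({..<n} \<times> {..<p n})"
      by (rule indep_vars_cong[THEN iffD1, rotated -1]) (auto simp: y_def fun_eq_iff)
    show "0 < B / real n" using B n by simp
    show "0 \<le> K' / (real n)\<^sup>2" using K' by simp
    show "0 < a" by (rule a)
    fix i j assume ij: "i < n" "j < p n"
    have g2: "(\<gamma> n i j)\<^sup>2 \<le> gmax\<^sup>2" using gamma[OF n ij] by (metis abs_ge_zero power2_abs power_mono)
    show "expectation (y n i j) = 0"
      unfolding y_def using Z_mean[OF ij] by simp
    have sq: "(y n i j \<omega>)\<^sup>2 = v n i j * (Z n i j \<omega>)\<^sup>2" for \<omega>
      by (simp add: y_def v_def power_mult_distrib power_divide)
    show "expectation (\<lambda>\<omega>. (y n i j \<omega>)\<^sup>2) = v n i j"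
      unfolding sq using EZ2[OF n ij] by simp
    show "v n i j \<le> B / real n"
      unfolding v_def B_def using g2 by (intro divide_right_mono) auto
    have q: "(y n i j \<omega>) ^ 4 = (v n i j)\<^sup>2 * (Z n i j \<omega>) ^ 4" for \<omega>
    proof -
      have "(y n i j \<omega>) ^ 4 = ((y n i j \<omega>)\<^sup>2)\<^sup>2" by (simp flip: power_mult)
      also have "\<dots> = (v n i j)\<^sup>2 * (Z n i j \<omega>) ^ 4"
        unfolding sq power_mult_distrib by (simp flip: power_mult)
      finally show ?thesis .
    qed
    show "integrable M (\<lambda>\<omega>. (y n i j \<omega>) ^ 4)"
      unfolding q using Z4[OF n ij] by simp
    have "(v n i j)\<^sup>2 \<le> (B / real n)\<^sup>2"
      using \<open>v n i j \<le> B / real n\<close> by (intro power_mono) (auto simp: v_def)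
    then have "(v n i j)\<^sup>2 * K \<le> (B / real n)\<^sup>2 * K" using K0 by (intro mult_right_mono)
    also have "\<dots> = K' / (real n)\<^sup>2" by (simp add: B_def K'_def power_divide flip: power_mult)
    finally show "expectation (\<lambda>\<omega>. (y n i j \<omega>) ^ 4) \<le> K' / (real n)\<^sup>2"
      unfolding q using EZ4[OF n ij] by simp
  qed
  have X_carrier: "X n \<omega> \<in> carrier_mat n (p n)" for n \<omega>
    by (simp add: X_def design_def)
  have Y_eq: "Matrix.mat n (p n) (\<lambda>(i, j). y n i j \<omega>) = scaled n (X n \<omega>)" for n \<omega>
    by (rule eq_matI) (auto simp: X_def design_def scaled_def y_def)
  have Yt_eq: "Matrix.mat (p n) n (\<lambda>(j, i). y n i j \<omega>) = transpose_mat (scaled n (X n \<omega>))" for n \<omega>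
    unfolding Y_eq[symmetric] by (rule eq_matI) auto
  have n1: "\<forall>\<^sub>F n in sequentially. n \<ge> (1::nat)" by (rule eventually_ge_at_top)
  have p1: "\<forall>\<^sub>F n in sequentially. 0 < p n"
  proof -
    have "\<forall>\<^sub>F n in sequentially. 0 < real (p n) / real n"
      using ratio \<open>c > 0\<close> by (rule order_tendstoD(1))
    then show ?thesis by eventually_elim (auto intro: gr0I)
  qed
  define C where "C = c + 1"
  have C: "1 \<le> C" using \<open>c > 0\<close> by (simp add: C_def)
  have pC: "\<forall>\<^sub>F n in sequentially. real (p n) \<le> C * real n"
  proof -
    have "\<forall>\<^sub>F n in sequentially. real (p n) / real n < C"
      using ratio by (rule order_tendstoD(2)) (simp add: C_def)
    with n1 show ?thesis by eventually_elim (auto simp: divide_less_eq)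
  qed
  have nC: "real n \<le> C * real n" for n :: nat using C by (simp add: mult_le_cancel_right1)

  \<comment> \<open>The canonical solution at real points\<close>
  define t where "t n a j = Re (T n j (- complex_of_real a))" for n a j
  define tt where "tt n a i = Re (Tt n i (- complex_of_real a))" for n a i
  define tt' where "tt' n i = Re (deriv (Tt n i) (- complex_of_real lam))" for n i
  have t_props: "0 \<le> t n a j \<and> t n a j \<le> 1 / a \<and> t n a j = 1 / (a * (1 + (\<Sum>i<n. v n i j * tt n a i)))"
    if "n \<ge> 1" "0 < a" "j < p n" for n a j
  proof -
    have "n > 0" using that by simp
    note sol = T_solution[OF that(1)] this that(2)
    show ?thesis
      using stieltjes_class_Re(2,3)[OF canonical_solution_stieltjes(1)[OF sol that(3)] that(2)]
        canonical_solution_real(1)[OF sol that(3)] unfolding t_def tt_def v_def by blast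
  qed
  have tt_props: "0 \<le> tt n a i \<and> tt n a i \<le> 1 / a \<and> tt n a i = 1 / (a * (1 + (\<Sum>j<p n. v n i j * t n a j)))"
    if "n \<ge> 1" "0 < a" "i < n" for n a i
  proof -
    have "n > 0" using that by simp
    note sol = T_solution[OF that(1)] this that(2)
    show ?thesis
      using stieltjes_class_Re(2,3)[OF canonical_solution_stieltjes(2)[OF sol that(3)] that(2)]
        canonical_solution_real(2)[OF sol that(3)] unfolding t_def tt_def v_def by blast
  qed

  \<comment> \<open>Almost sure convergence of the normalized traces\<close>
  define Q where "Q n a \<omega> = resolvent a (transpose_mat (scaled n (X n \<omega>)))" for n a \<omega>
  define R where "R n \<omega> = resolvent lam (scaled n (X n \<omega>))" for n \<omega>
  have AE_Q: "AE \<omega> in M. (\<lambda>n. ((\<Sum>i<n. Q n a \<omega> $$ (i, i)) - (\<Sum>i<n. tt n a i)) / real n) \<longlonglongrightarrow> 0"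
    if a: "0 < a" for a
  proof -
    have "AE \<omega> in M. (\<lambda>n. ((\<Sum>i<n. resolvent a (Matrix.mat (p n) n (\<lambda>(j, i). y n i j \<omega>)) $$ (i, i))
      - (\<Sum>i<n. tt n a i)) / real n) \<longlonglongrightarrow> 0"
    \<comment> \<open>The transposed array is used here: the dimensions are \<open>p n\<close> and
      \<open>n\<close>, and the two families of the canonical solution exchange their
      places.\<close>
    proof (rule normalized_resolvent_trace_convergence[where v = "\<lambda>n j i. v n i j" and Tt = "\<lambda>n. t n a"
          and B = B and K = K' and C = C])
      show "\<forall>\<^sub>F n in sequentially. independent_entries M (\<lambda>j i. y n i j) (p n) n (\<lambda>j i. v n i j) (B / real n) (K' / (real n)\<^sup>2) a"
        using n1 by eventually_elim (rule independent_entries.transpose[OF IE[OF _ a]])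
      show "\<forall>\<^sub>F n in sequentially. 0 < p n \<and> real (p n) \<le> C * real n \<and> real n \<le> C * real n"
        using p1 pC by eventually_elim (use nC in auto)
      show "\<forall>\<^sub>F n in sequentially. \<forall>i<n. 0 \<le> tt n a i \<and> tt n a i \<le> 1 / a
        \<and> tt n a i = 1 / (a * (1 + (\<Sum>j<p n. v n i j * t n a j)))"
        using n1 by eventually_elim (use tt_props a in blast)
      show "\<forall>\<^sub>F n in sequentially. \<forall>j<p n. 0 \<le> t n a j \<and> t n a j \<le> 1 / a
        \<and> t n a j = 1 / (a * (1 + (\<Sum>i<n. v n i j * tt n a i)))"
        using n1 by eventually_elim (use t_props a in blast)
    qed (use B K' a C in auto)
    then show ?thesis unfolding Yt_eq Q_def .
  qed
  have AE_R: "AE \<omega> in M. (\<lambda>n. ((\<Sum>j<p n. R n \<omega> $$ (j, j)) - (\<Sum>j<p n. t n lam j)) / real n) \<longlonglongrightarrow> 0"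
  proof -
    have "AE \<omega> in M. (\<lambda>n. ((\<Sum>j<p n. resolvent lam (Matrix.mat n (p n) (\<lambda>(i, j). y n i j \<omega>)) $$ (j, j))
      - (\<Sum>j<p n. t n lam j)) / real n) \<longlonglongrightarrow> 0"
    proof (rule normalized_resolvent_trace_convergence[where v = v and Tt = "\<lambda>n. tt n lam"
          and B = B and K = K' and C = C])
      show "\<forall>\<^sub>F n in sequentially. independent_entries M (y n) n (p n) (v n) (B / real n) (K' / (real n)\<^sup>2) lam"
        using n1 by eventually_elim (rule IE[OF _ lam])
      show "\<forall>\<^sub>F n in sequentially. 0 < n \<and> real n \<le> C * real n \<and> real (p n) \<le> C * real n"
        using n1 pC by eventually_elim (use nC in auto)
      show "\<forall>\<^sub>F n in sequentially. \<forall>j<p n. 0 \<le> t n lam j \<and> t n lam j \<le> 1 / lam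
        \<and> t n lam j = 1 / (lam * (1 + (\<Sum>i<n. v n i j * tt n lam i)))"
        using n1 by eventually_elim (use t_props lam in blast)
      show "\<forall>\<^sub>F n in sequentially. \<forall>i<n. 0 \<le> tt n lam i \<and> tt n lam i \<le> 1 / lam
        \<and> tt n lam i = 1 / (lam * (1 + (\<Sum>j<p n. v n i j * t n lam j)))"
        using n1 by eventually_elim (use tt_props lam in blast)
    qed (use B K' lam C in auto)
    then show ?thesis unfolding Y_eq R_def .
  qed

  \<comment> \<open>The training risk in terms of the companion resolvent\<close>
  define fr where "fr n \<omega> = (\<Sum>i<n. \<Sum>k<n. (Q n lam \<omega> $$ (k, i))\<^sup>2)" for n \<omega>
  have risk: "AE \<omega> in M. train_risk_hat M n (p n) (\<beta> n) (X n) (\<epsilon> n) lam \<omega>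
    = lam\<^sup>2 * \<alpha>\<^sup>2 / real (p n) * ((\<Sum>i<n. Q n lam \<omega> $$ (i, i)) - lam * fr n \<omega>) + lam\<^sup>2 * \<sigma>\<^sup>2 / real n * fr n \<omega>"
    if n: "n \<ge> 1" for n
    unfolding fr_def Q_def
  proof (rule train_risk_hat_eq)
    obtain \<tau> where "iid M {..<n} (\<epsilon> n) \<tau>" using eps_iid[OF n] by blast
    then show "indep_vars (\<lambda>_. borel) (\<epsilon> n) {..<n}" by (simp add: iid_def)
    show "expectation (\<lambda>\<omega>. (\<epsilon> n i \<omega>)\<^sup>2) = \<sigma>\<^sup>2" if "i < n" for i
      using eps_var[OF that] eps_mean[OF that] by simp
  qed (use X_carrier n lam indep eps_square_integrable eps_mean beta_square_integrable beta_mean beta_cov in auto)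
  \<comment> \<open>The training risk involves derivatives in \<open>lam\<close>. They are recovered from difference quotients
    at countably many points, so that one null set suffices.\<close>
  define h where "h k = 1 / real (Suc k)" for k
  have h: "0 < h k" for k by (simp add: h_def)
  have "AE \<omega> in M. \<forall>k. (\<lambda>n. ((\<Sum>i<n. Q n (lam + h k) \<omega> $$ (i, i)) - (\<Sum>i<n. tt n (lam + h k) i)) / real n) \<longlonglongrightarrow> 0"
    unfolding AE_all_countable using AE_Q lam h by (simp add: add_pos_pos)
  moreover have "AE \<omega> in M. \<forall>n. n \<ge> 1 \<longrightarrow> train_risk_hat M n (p n) (\<beta> n) (X n) (\<epsilon> n) lam \<omega>
    = lam\<^sup>2 * \<alpha>\<^sup>2 / real (p n) * ((\<Sum>i<n. Q n lam \<omega> $$ (i, i)) - lam * fr n \<omega>) + lam\<^sup>2 * \<sigma>\<^sup>2 / real n * fr n \<omega>"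
    unfolding AE_all_countable using risk by (auto intro: AE_I2)
  ultimately show "AE \<omega> in M. (\<lambda>n. cmod (complex_of_real (G_hat M n (p n) (\<beta> n) (X n) (\<epsilon> n) lam \<omega>) -
               G_det n (p n) \<alpha> \<sigma> (\<gamma> n) (Tt n) lam)) \<longlonglongrightarrow> 0"
    using AE_Q[OF lam] AE_R
  proof eventually_elim
    case (elim \<omega>)
    note conv_h = elim(1)[rule_format] and risk_eq = elim(2)[rule_format] and conv_0 = elim(3) and conv_R = elim(4)

    \<comment> \<open>Passage to the limit for a fixed outcome\<close>
    have np: "(\<lambda>n. real n / real (p n)) \<longlonglongrightarrow> 1 / c"
      using tendsto_inverse[OF ratio] \<open>c > 0\<close> by (simp add: inverse_eq_divide)
    define u where "u n = ((\<Sum>i<n. Q n lam \<omega> $$ (i, i)) - (\<Sum>i<n. tt n lam i)) / real n" for n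
    define uk where "uk k n = ((\<Sum>i<n. Q n (lam + h k) \<omega> $$ (i, i)) - (\<Sum>i<n. tt n (lam + h k) i)) / real n" for k n
    \<comment> \<open>Deterministic counterpart of \<open>fr\<close>: each is minus the derivative
      of the corresponding trace in the ridge parameter, at \<open>lam\<close>.\<close>
    define d where "d n = (\<Sum>i<n. tt' n i)" for n
    define D where "D n = (fr n \<omega> - d n) / real n" for n
    have St: "transpose_mat (scaled n (X n \<omega>)) \<in> carrier_mat (p n) n" for n
      using X_carrier by simp
    have D_lim: "D \<longlonglongrightarrow> 0"
    \<comment> \<open>The constant \<open>2 / lam ^ 3\<close> collects one quotient error
      \<open>1 / lam ^ 3\<close> from the resolvent and one from the Stieltjes transforms.\<close>
    proof (rule tendsto_zero_by_difference_quotients[where u = uk and ?u0.0 = u and C = "2 / lam ^ 3"])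
      show "u \<longlonglongrightarrow> 0" unfolding u_def by (rule conv_0)
      show "uk k \<longlonglongrightarrow> 0" for k unfolding uk_def by (rule conv_h)
      fix k
      show "\<forall>\<^sub>F n in sequentially. \<bar>D n\<bar> \<le> (\<bar>u n\<bar> + \<bar>uk k n\<bar>) * real (Suc k) + 2 / lam ^ 3 / real (Suc k)"
        using n1
      proof eventually_elim
        case (elim n)
        then have n: "0 < real n" by simp
        let ?e = "h k / lam ^ 3"
        have quot: "\<bar>(\<Sum>i<n. a i - b i) / h k - (\<Sum>i<n. f i)\<bar> \<le> real n * ?e"
          if "\<And>i. i < n \<Longrightarrow> \<bar>(a i - b i) / h k - f i\<bar> \<le> ?e" for a b f :: "nat \<Rightarrow> real"
        proof -
          have "(\<Sum>i<n. a i - b i) / h k - (\<Sum>i<n. f i) = (\<Sum>i<n. (a i - b i) / h k - f i)"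
            unfolding sum_divide_distrib sum_subtractf[symmetric] ..
          also have "\<bar>\<dots>\<bar> \<le> (\<Sum>i<n. ?e)"
            using that by (intro order.trans[OF sum_abs] sum_mono) auto
          finally show ?thesis by simp
        qed
        have q1: "\<bar>(\<Sum>i<n. Q n lam \<omega> $$ (i, i) - Q n (lam + h k) \<omega> $$ (i, i)) / h k - fr n \<omega>\<bar> \<le> real n * ?e"
          unfolding fr_def Q_def
          by (rule quot) (use resolvent_diff_quotient[OF St lam, of "lam + h k"] h[of k] in auto)
        have q2: "\<bar>(\<Sum>i<n. tt n lam i - tt n (lam + h k) i) / h k - d n\<bar> \<le> real n * ?e"
          unfolding d_def
        proof (rule quot)
          fix i assume i: "i < n"
          have "0 < n" using i by simp
          note st = canonical_solution_stieltjes(2)[OF T_solution[OF elim] this lam i]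
          show "\<bar>(tt n lam i - tt n (lam + h k) i) / h k - tt' n i\<bar> \<le> ?e"
            using stieltjes_class_Re(5)[OF st lam, of "lam + h k"] h[of k]
            unfolding tt_def tt'_def by simp
        qed
        define A where "A = (\<Sum>i<n. Q n lam \<omega> $$ (i, i) - Q n (lam + h k) \<omega> $$ (i, i)) / h k"
        define A' where "A' = (\<Sum>i<n. tt n lam i - tt n (lam + h k) i) / h k"
        \<comment> \<open>Dividing by \<open>h k\<close> is multiplying by \<open>Suc k\<close>, so
          the quotients differ only through the normalized trace errors at the two points.\<close>
        have AA: "A - A' = real n * (u n - uk k n) * real (Suc k)"
          using n by (simp add: A_def A'_def u_def uk_def h_def sum_subtractf diff_divide_distrib algebra_simps)
        have "\<bar>fr n \<omega> - d n\<bar> \<le> \<bar>A - A'\<bar> + 2 * (real n * ?e)"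
          using q1 q2 unfolding A_def[symmetric] A'_def[symmetric] by linarith
        also have "\<bar>A - A'\<bar> \<le> real n * (\<bar>u n\<bar> + \<bar>uk k n\<bar>) * real (Suc k)"
          unfolding AA abs_mult by (intro mult_mono mult_left_mono) auto
        finally have "\<bar>fr n \<omega> - d n\<bar> \<le> real n * ((\<bar>u n\<bar> + \<bar>uk k n\<bar>) * real (Suc k) + 2 / lam ^ 3 / real (Suc k))"
          by (simp add: h_def algebra_simps)
        then show ?case
          using n by (simp add: D_def abs_divide divide_le_eq mult.commute)
      qed
    qed
    define rh where "rh n = lam\<^sup>2 * \<alpha>\<^sup>2 / real (p n) * ((\<Sum>i<n. Q n lam \<omega> $$ (i, i)) - lam * fr n \<omega>)
      + lam\<^sup>2 * \<sigma>\<^sup>2 / real n * fr n \<omega>" for n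
    define r where "r n = lam\<^sup>2 * \<alpha>\<^sup>2 / real (p n) * ((\<Sum>i<n. tt n lam i) - lam * d n)
      + lam\<^sup>2 * \<sigma>\<^sup>2 / real n * d n" for n
    define sh where "sh n = lam / real (p n) * (\<Sum>j<p n. R n \<omega> $$ (j, j))" for n
    define s where "s n = lam / real (p n) * (\<Sum>j<p n. t n lam j)" for n
    have "(\<lambda>n. rh n / (sh n)\<^sup>2 - r n / (s n)\<^sup>2) \<longlonglongrightarrow> 0"
    proof (rule ratio_difference_tendsto_zero)
      \<comment> \<open>The signal term is normalized by \<open>p n\<close> but the trace errors by
        \<open>n\<close>; the ratio tends to \<open>1 / c\<close>, which is where positivity of
        \<open>c\<close> enters.\<close>
      have "(\<lambda>n. lam\<^sup>2 * \<alpha>\<^sup>2 * (real n / real (p n)) * (u n - lam * D n) + lam\<^sup>2 * \<sigma>\<^sup>2 * D n)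
        \<longlonglongrightarrow> lam\<^sup>2 * \<alpha>\<^sup>2 * (1 / c) * (0 - lam * 0) + lam\<^sup>2 * \<sigma>\<^sup>2 * 0"
        by (intro tendsto_intros np D_lim) (simp add: u_def conv_0)
      moreover have "\<forall>\<^sub>F n in sequentially. rh n - r n
        = lam\<^sup>2 * \<alpha>\<^sup>2 * (real n / real (p n)) * (u n - lam * D n) + lam\<^sup>2 * \<sigma>\<^sup>2 * D n"
        using n1 p1
      proof eventually_elim
        case (elim n)
        have "real n * u n = (\<Sum>i<n. Q n lam \<omega> $$ (i, i)) - (\<Sum>i<n. tt n lam i)"
          "real n * D n = fr n \<omega> - d n"
          using elim by (simp_all add: u_def D_def)
        then have e: "(\<Sum>i<n. Q n lam \<omega> $$ (i, i)) = (\<Sum>i<n. tt n lam i) + real n * u n"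
          "fr n \<omega> = d n + real n * D n" by simp_all
        show ?case
          unfolding rh_def r_def e using elim by (simp add: field_simps)
      qed
      ultimately show "(\<lambda>n. rh n - r n) \<longlonglongrightarrow> 0"
        by (simp add: tendsto_cong)
      have "(\<lambda>n. lam * (real n / real (p n)) * (((\<Sum>j<p n. R n \<omega> $$ (j, j)) - (\<Sum>j<p n. t n lam j)) / real n))
        \<longlonglongrightarrow> lam * (1 / c) * 0"
        by (intro tendsto_intros np conv_R)
      moreover have "\<forall>\<^sub>F n in sequentially. sh n - s n
        = lam * (real n / real (p n)) * (((\<Sum>j<p n. R n \<omega> $$ (j, j)) - (\<Sum>j<p n. t n lam j)) / real n)"
        using n1 by eventually_elim (simp add: sh_def s_def flip: right_diff_distrib diff_divide_distrib)
      ultimately show "(\<lambda>n. sh n - s n) \<longlonglongrightarrow> 0"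
        by (simp add: tendsto_cong)
      \<comment> \<open>This is \<open>lam\<close> times the lower bound of
        \<open>canonical_solution_lower\<close>, averaged over the \<open>p n\<close>
        indices.\<close>
      show "0 < lam / (lam + gmax\<^sup>2)" using lam by (intro divide_pos_pos add_pos_nonneg) auto
      show "\<forall>\<^sub>F n in sequentially. lam / (lam + gmax\<^sup>2) \<le> s n"
        using n1 p1
      proof eventually_elim
        case (elim n)
        then have n: "0 < n" by simp
        have "(\<Sum>j<p n. 1 / (lam + gmax\<^sup>2)) \<le> (\<Sum>j<p n. t n lam j)"
          unfolding t_def using canonical_solution_lower[OF T_solution[OF elim(1)] n lam gamma[OF elim(1)]]
          by (intro sum_mono) auto
        then have "lam / real (p n) * (\<Sum>j<p n. 1 / (lam + gmax\<^sup>2)) \<le> s n"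
          unfolding s_def using lam by (intro mult_left_mono) auto
        then show ?case using elim by simp
      qed
      have "\<forall>\<^sub>F n in sequentially. real n / real (p n) < 1 / c + 1"
        using np by (rule order_tendstoD(2)) simp
      with n1 p1 show "\<forall>\<^sub>F n in sequentially.
        \<bar>r n\<bar> \<le> lam\<^sup>2 * \<alpha>\<^sup>2 * (1 / c + 1) * (3 / lam) + lam\<^sup>2 * \<sigma>\<^sup>2 * (2 / lam\<^sup>2)"
      proof eventually_elim
        case (elim n)
        then have n: "0 < n" by simp
        have tt_le: "\<bar>\<Sum>i<n. tt n lam i\<bar> \<le> real n * (1 / lam)"
        proof -
          have "\<bar>\<Sum>i<n. tt n lam i\<bar> \<le> (\<Sum>i<n. 1 / lam)"
            using tt_props[OF elim(1) lam] by (intro order.trans[OF sum_abs] sum_mono) (metis abs_of_nonneg lessThan_iff)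
          then show ?thesis by simp
        qed
        have d_le: "\<bar>d n\<bar> \<le> real n * (2 / lam\<^sup>2)"
        proof -
          have "\<bar>d n\<bar> \<le> (\<Sum>i<n. 2 / lam\<^sup>2)"
            unfolding d_def tt'_def
            using stieltjes_class_Re(6)[OF canonical_solution_stieltjes(2)[OF T_solution[OF elim(1)] n lam] lam]
            by (intro order.trans[OF sum_abs] sum_mono) auto
          then show ?thesis by simp
        qed
        \<comment> \<open>Per index the trace contributes \<open>1 / lam\<close> and the derivative
          term \<open>lam * 2 / lam^2\<close>, together \<open>3 / lam\<close>.\<close>
        have "\<bar>(\<Sum>i<n. tt n lam i) - lam * d n\<bar> \<le> real n * (1 / lam) + lam * (real n * (2 / lam\<^sup>2))"
          using tt_le mult_left_mono[OF d_le, of lam] lam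
          by (intro order.trans[OF abs_triangle_ineq4] add_mono) (auto simp: abs_mult)
        also have "\<dots> = real n * (3 / lam)" using lam by (simp add: field_simps power2_eq_square)
        finally have a: "\<bar>(\<Sum>i<n. tt n lam i) - lam * d n\<bar> \<le> real n * (3 / lam)" .
        have "\<bar>r n\<bar> \<le> lam\<^sup>2 * \<alpha>\<^sup>2 / real (p n) * \<bar>(\<Sum>i<n. tt n lam i) - lam * d n\<bar> + lam\<^sup>2 * \<sigma>\<^sup>2 / real n * \<bar>d n\<bar>"
          unfolding r_def by (intro order.trans[OF abs_triangle_ineq] add_mono) (simp_all add: abs_mult)
        also have "\<dots> \<le> lam\<^sup>2 * \<alpha>\<^sup>2 / real (p n) * (real n * (3 / lam)) + lam\<^sup>2 * \<sigma>\<^sup>2 / real n * (real n * (2 / lam\<^sup>2))"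
          using a d_le by (intro add_mono mult_left_mono) auto
        also have "\<dots> = lam\<^sup>2 * \<alpha>\<^sup>2 * (real n / real (p n)) * (3 / lam) + lam\<^sup>2 * \<sigma>\<^sup>2 * (2 / lam\<^sup>2)"
          using n by simp
        also have "\<dots> \<le> lam\<^sup>2 * \<alpha>\<^sup>2 * (1 / c + 1) * (3 / lam) + lam\<^sup>2 * \<sigma>\<^sup>2 * (2 / lam\<^sup>2)"
          using elim(3) lam by (intro add_mono mult_right_mono mult_left_mono) auto
        finally show ?case .
      qed
    qed
    then have lim: "(\<lambda>n. \<bar>rh n / (sh n)\<^sup>2 - r n / (s n)\<^sup>2\<bar>) \<longlonglongrightarrow> 0"
      by (rule tendsto_rabs_zero)

    \<comment> \<open>Identification with the complex-valued statement\<close>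
    have "\<forall>\<^sub>F n in sequentially. \<bar>rh n / (sh n)\<^sup>2 - r n / (s n)\<^sup>2\<bar>
      = cmod (complex_of_real (G_hat M n (p n) (\<beta> n) (X n) (\<epsilon> n) lam \<omega>) - G_det n (p n) \<alpha> \<sigma> (\<gamma> n) (Tt n) lam)"
      using n1 p1
    proof eventually_elim
      case (elim n)
      then have n: "0 < n" by simp
      have "G_det n (p n) \<alpha> \<sigma> (\<gamma> n) (Tt n) lam = complex_of_real (r n / (s n)\<^sup>2)"
        unfolding G_det_eq[OF T_solution[OF elim(1)] n lam elim(2)] r_def s_def t_def tt_def d_def tt'_def ..
      moreover have "G_hat M n (p n) (\<beta> n) (X n) (\<epsilon> n) lam \<omega> = rh n / (sh n)\<^sup>2"
        unfolding G_hat_def risk_eq[OF elim(1)] df1_hat_eq[OF X_carrier n lam elim(2)] rh_def sh_def R_def by simp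
      ultimately show ?case
        by (simp only: of_real_diff[symmetric] norm_of_real)
    qed
    with lim show ?case
      by (rule Lim_transform_eventually)
  qed
qed

end
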